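(* Let $L$ be a real-valued function on the unit circle $\partial\mathbb{D}$ such that $L\in L^1(\partial\mathbb{D},\frac{d\theta}{2\pi})$ and $e^L\in L^1(\partial\mathbb{D},\frac{d\theta}{2\pi})$. Then $$\lim_{n\to\infty} D_n\Bigl(e^L\,\frac{d\theta}{2\pi}\Bigr)\,e^{-(n+1)\hat L_0}=\exp\Bigl(\sum_{k=1}^\infty k\,|\hat L_k|^2\Bigr),$$ where the right side may be finite or $+\infty$ (in the latter case the limit is $+\infty$).
   Context: $\partial\mathbb{D}=\{z\in\mathbb{C}: |z|=1\}$, parametrized by $e^{i\theta}$, $\theta\in[0,2\pi)$. For $f\in L^1(\frac{d\theta}{2\pi})$, $\hat f_m=\int_0^{2\pi} e^{-im\theta}f(\theta)\,\frac{d\theta}{2\pi}$, $m\in\mathbb{Z}$. For a measure $d\mu$ on $\partial\mathbb{D}$ let $c_m=\int e^{-im\theta}\,d\mu(\theta)$; $D_n(d\mu)$ is the determinant of the $(n+1)\times(n+1)$ Toeplitz matrix $(c_{j-i})_{0\le i,j\le n}$. *)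

theory Defs
  imports "HOL-Analysis.Analysis" "Jordan_Normal_Form.Determinant"
begin

(* Normalized Lebesgue measure on the unit circle, transported along \<theta> \<mapsto> e^(i \<theta>).
   The completion makes the measurable sets the Lebesgue (not only the Borel) sets. *)
definition circle_measure :: "complex measure" where
  "circle_measure =
     completion (distr (uniform_measure lborel {0..<2 * pi})
                       (restrict_space borel (sphere 0 1)) cis)"

(* On the circle, e^(-i m \<theta>) is z powi (-m) for z = e^(i \<theta>). *)
definition measure_coeff :: "complex measure \<Rightarrow> int \<Rightarrow> complex" where
  "measure_coeff \<mu> m = (\<integral>z. z powi (- m) \<partial>\<mu>)"

definition fourier_coeff :: "(complex \<Rightarrow> complex) \<Rightarrow> int \<Rightarrow> complex" where
  "fourier_coeff f m = (\<integral>z. z powi (- m) * f z \<partial>circle_measure)"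

definition toeplitz_mat :: "complex measure \<Rightarrow> nat \<Rightarrow> complex mat" where
  "toeplitz_mat \<mu> n = Matrix.mat (n + 1) (n + 1) (\<lambda>(i, j). measure_coeff \<mu> (int j - int i))"

definition toeplitz_det :: "complex measure \<Rightarrow> nat \<Rightarrow> complex" where
  "toeplitz_det \<mu> n = Determinant.det (toeplitz_mat \<mu> n)"

(* The exponential function extended by exp (+\<infinity>) = +\<infinity> and exp (-\<infinity>) = 0. *)
fun exp_ereal :: "ereal \<Rightarrow> ereal" where
  "exp_ereal (ereal x) = ereal (exp x)"
| "exp_ereal PInfty = PInfty"
| "exp_ereal MInfty = 0"

end

theory Submission
  imports Defs "HOL-Complex_Analysis.Cauchy_Integral_Formula"
    "HOL-Computational_Algebra.Fundamental_Theorem_Algebra"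
begin

text \<open>
  Let \<open>w = e\<^sup>L\<close> with \<open>L\<close> of mean zero, and let \<open>P\<^sub>n\<close> minimize \<open>\<integral> \<bar>P\<bar>\<^sup>2 w\<close> among the polynomials of degree
  at most \<open>n\<close> with \<open>P(0) = 1\<close>. Write \<open>P\<^sub>n = \<Prod>\<^sub>i (1 - a\<^sub>i z)\<close>. Splitting off one factor at a time shows
  that the \<open>n \<times> n\<close> Toeplitz determinant equals \<open>\<parallel>P\<^sub>n\<parallel>\<^sup>2\<^sup>n \<Prod>\<^sub>i\<^sub>j (1 - a\<^sub>i cnj a\<^sub>j)\<^sup>-\<^sup>1\<close>, which is
  \<open>\<parallel>P\<^sub>n\<parallel>\<^sup>2\<^sup>n exp (\<Sum>\<^sub>k \<bar>s\<^sub>k\<bar>\<^sup>2 / k)\<close> for the power sums \<open>s\<^sub>k = \<Sum>\<^sub>i a\<^sub>i\<^sup>k\<close>.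

  Lower bound: \<open>\<parallel>P\<^sub>n\<parallel>\<^sup>2 \<ge> 1\<close> because \<open>log \<bar>P\<^sub>n\<bar>\<^sup>2\<close> has mean zero, and \<open>\<parallel>P\<^sub>n\<parallel>\<^sup>2 \<rightarrow> 1\<close> by Szego's theorem.
  Hence \<open>u = log \<bar>P\<^sub>n\<bar>\<^sup>2 + L\<close> satisfies \<open>\<integral> u = 0\<close> and \<open>\<integral> e\<^sup>u \<rightarrow> 1\<close>, so \<open>u \<rightarrow> 0\<close> in \<open>L\<^sup>1\<close> and the Fourier
  coefficients \<open>- s\<^sub>k / k\<close> of \<open>log \<bar>P\<^sub>n\<bar>\<^sup>2\<close> converge to those of \<open>- L\<close>.

  Upper bound: the normalized determinants increase with the size and with the weight. For the weights
  \<open>\<bar>1 - q/m\<bar>\<^sup>-\<^sup>2\<^sup>m\<close> the formula above is explicit for large sizes; \<open>m \<rightarrow> \<infinity>\<close> gives the bound for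
  \<open>exp (2 Re q)\<close>, and the Fejer means of \<open>L\<close>, whose coefficients are dominated by those of \<open>L\<close>, give it for \<open>w\<close>.
\<close>

hide_const (open) Module.smult

section \<open>The normalized circle measure\<close>

text \<open>The hypotheses give no smoothness and no bounds on \<open>exp L\<close>, and the limit
  may be infinite; this shapes both halves. In the lower bound only finitely many power sums are
  compared at a time: the other terms of the energy are nonnegative and are dropped, so the full sum
  may diverge. In the upper bound, Fejer means approximate \<open>L\<close> only in L^1, and their
  exponentials come with no evident integrable majorant; replacing each approximating weight by its
  minimum with \<open>exp L\<close> supplies one, and monotonicity in the weight makes the
  replacement harmless. The exact formula for the weight 1 / |P|^2 still contains an infinite energy
  sum; its tail is uniformly small because the s_k are the Taylor coefficients of - z P' / P, which
  stays bounded on the circle along the approximating polynomials. Parametrizing polynomials by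
  reciprocals of zeros lets entries a = 0 pad a list to a prescribed length, which is how the number
  of factors is matched to the size of a matrix.\<close>

lemma cis_measurable: "cis \<in> lborel \<rightarrow>\<^sub>M restrict_space borel (sphere 0 1)"
  by (intro measurable_restrict_space2) (auto intro!: borel_measurable_continuous_onI continuous_intros)

lemma cis_measurable':
  "cis \<in> uniform_measure lborel {0..<2 * pi} \<rightarrow>\<^sub>M restrict_space borel (sphere 0 1)"
  using cis_measurable by (simp add: measurable_def)

lemma space_circle [simp]: "space circle_measure = sphere 0 1"
  by (simp add: circle_measure_def)

lemma emeasure_circle: "emeasure circle_measure (sphere 0 1) = 1"
proof -
  let ?D = "distr (uniform_measure lborel {0..<2 * pi}) (restrict_space borel (sphere 0 1)) cis"
  have S: "sphere 0 1 \<in> sets ?D"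
    using sets.top[of ?D] by simp
  have "emeasure circle_measure (sphere 0 1) = emeasure ?D (sphere 0 1)"
    unfolding circle_measure_def using S
    by (simp only: emeasure_completion sets_completionI_sets main_part)
  also have "\<dots> = emeasure (uniform_measure lborel {0..<2 * pi}) UNIV"
    by (subst emeasure_distr[OF cis_measurable']) (use S in \<open>auto simp: vimage_def\<close>)
  also have "\<dots> = 1"
    by (simp add: ennreal_divide_self)
  finally show ?thesis .
qed

lemma finite_measure_circle: "finite_measure circle_measure"
  by (rule finite_measureI) (simp add: emeasure_circle)

interpretation circle: finite_measure circle_measure
  by (rule finite_measure_circle)

lemma measure_circle [simp]: "measure circle_measure (sphere 0 1) = 1"
  by (simp add: measure_def emeasure_circle)

lemma circle_measurable_borel:
  assumes "f \<in> borel_measurable (restrict_space borel (sphere 0 1))"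
  shows "f \<in> borel_measurable circle_measure"
  unfolding circle_measure_def by (rule measurable_completion) (use assms in simp)

lemma circle_measurable_continuous:
  assumes "continuous_on (sphere 0 1) f"
  shows "f \<in> borel_measurable circle_measure"
  by (intro circle_measurable_borel borel_measurable_continuous_on_restrict assms)

lemma circle_bound_continuous:
  fixes f :: "complex \<Rightarrow> 'a::real_normed_vector"
  assumes "continuous_on (sphere 0 1) f"
  obtains B where "B > 0" "\<And>z. norm z = 1 \<Longrightarrow> norm (f z) \<le> B"
proof -
  have "bounded (f ` sphere 0 1)"
    using assms by (intro compact_imp_bounded compact_continuous_image) auto
  then show ?thesis
    using that unfolding bounded_pos by auto
qed

lemma circle_integrable_continuous:
  fixes f :: "complex \<Rightarrow> 'a::{banach,second_countable_topology}"
  assumes "continuous_on (sphere 0 1) f"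
  shows "integrable circle_measure f"
proof -
  obtain B where "\<And>z. norm z = 1 \<Longrightarrow> norm (f z) \<le> B"
    using circle_bound_continuous[OF assms] by metis
  then show ?thesis
    by (intro circle.integrable_const_bound[where B=B] circle_measurable_continuous assms AE_I2) auto
qed

lemma circle_integrable_continuous_mult:
  fixes f :: "complex \<Rightarrow> 'a::{real_normed_field,banach,second_countable_topology}"
  assumes "continuous_on (sphere 0 1) f" "integrable circle_measure g"
  shows "integrable circle_measure (\<lambda>z. f z * g z)"
proof -
  obtain B where B: "\<And>z. norm z = 1 \<Longrightarrow> norm (f z) \<le> B" "B > 0"
    using circle_bound_continuous[OF assms(1)] by metis
  show ?thesis
  proof (rule Bochner_Integration.integrable_bound)
    show "integrable circle_measure (\<lambda>z. B * norm (g z))"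
      using assms by auto
    show "(\<lambda>z. f z * g z) \<in> borel_measurable circle_measure"
      using circle_measurable_continuous[OF assms(1)] assms(2) by measurable
    show "AE z in circle_measure. norm (f z * g z) \<le> norm (B * norm (g z))"
      using B by (intro AE_I2) (auto simp: norm_mult mult_right_mono)
  qed
qed

lemma circle_integral_eq:
  fixes f :: "complex \<Rightarrow> 'a::{banach,second_countable_topology}"
  assumes "f \<in> borel_measurable (restrict_space borel (sphere 0 1))"
  shows "integral\<^sup>L circle_measure f = integral\<^sup>L (uniform_measure lborel {0..<2 * pi}) (\<lambda>t. f (cis t))"
  unfolding circle_measure_def
  by (subst integral_completion) (use assms cis_measurable' in \<open>auto intro!: integral_distr\<close>)

section \<open>Orthogonality of the powers of z and integrals of power series\<close>

lemma integral_power: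
  assumes "k > 0"
  shows "(\<integral>z. z ^ k \<partial>circle_measure) = 0"
proof -
  have AE: "AE t in lborel. t \<noteq> 2 * pi"
    by (rule AE_lborel_singleton)
  have "(\<integral>z. z ^ k \<partial>circle_measure) =
      integral\<^sup>L (uniform_measure lborel {0..<2 * pi}) (\<lambda>t. cis (real k * t))"
    by (subst circle_integral_eq)
      (auto intro!: borel_measurable_continuous_on_restrict continuous_intros simp: Complex.DeMoivre)
  also have "\<dots> = integral\<^sup>L lborel (\<lambda>t. indicator {0..<2 * pi} t *\<^sub>R cis (real k * t)) /\<^sub>R (2 * pi)"
  proof -
    have "uniform_measure lborel {0..<2 * pi} =
        density lborel (\<lambda>t. ennreal (indicator {0..<2 * pi} t / (2 * pi)))"
      unfolding uniform_measure_def
      by (intro density_cong) (auto simp: divide_ennreal[symmetric] split: split_indicator)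
    then have "integral\<^sup>L (uniform_measure lborel {0..<2 * pi}) (\<lambda>t. cis (real k * t)) =
        integral\<^sup>L lborel (\<lambda>t. (indicator {0..<2 * pi} t / (2 * pi)) *\<^sub>R cis (real k * t))"
      by (simp only:) (intro integral_density, auto intro!: borel_measurable_continuous_onI continuous_intros)
    also have "\<dots> = integral\<^sup>L lborel (\<lambda>t. (1 / (2 * pi)) *\<^sub>R (indicator {0..<2 * pi} t *\<^sub>R cis (real k * t)))"
      by simp
    also have "\<dots> = integral\<^sup>L lborel (\<lambda>t. indicator {0..<2 * pi} t *\<^sub>R cis (real k * t)) /\<^sub>R (2 * pi)"
      unfolding integral_scaleR_right by (simp add: inverse_eq_divide)
    finally show ?thesis .
  qed
  \<comment> \<open>Passing to the closed interval, where the fundamental theorem of calculus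
    applies, changes the integrand only at the null point 2 pi.\<close>
  also have "integral\<^sup>L lborel (\<lambda>t. indicator {0..<2 * pi} t *\<^sub>R cis (real k * t)) =
      integral\<^sup>L lborel (\<lambda>t. indicator {0..2 * pi} t *\<^sub>R cis (real k * t))"
  proof (rule integral_cong_AE)
    have [measurable]: "(\<lambda>t. cis (real k * t)) \<in> borel_measurable lborel"
      by (auto intro!: borel_measurable_continuous_onI continuous_intros)
    show "(\<lambda>t. indicator {0..<2 * pi} t *\<^sub>R cis (real k * t)) \<in> borel_measurable lborel"
      "(\<lambda>t. indicator {0..2 * pi} t *\<^sub>R cis (real k * t)) \<in> borel_measurable lborel"
      by measurable
  qed (use AE in \<open>auto elim!: eventually_mono split: split_indicator\<close>)
  also have "\<dots> = cis (real k * (2 * pi)) / (\<i> * k) - cis (real k * 0) / (\<i> * k)"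
  proof (rule integral_FTC_atLeastAtMost)
    show "((\<lambda>t. cis (real k * t) / (\<i> * k)) has_vector_derivative cis (real k * x)) (at x within {0..2 * pi})"
      for x
    proof -
      have "((\<lambda>w. exp (\<i> * k * w) / (\<i> * k)) has_field_derivative exp (\<i> * k * of_real x)) (at (of_real x))"
        using assms by (auto intro!: derivative_eq_intros)
      then show ?thesis
        by (drule_tac has_vector_derivative_real_field) (simp add: cis_conv_exp mult_ac)
    qed
  qed (auto intro!: continuous_intros)
  also have "\<dots> = 0"
    using cis_multiple_2pi[of "real k"] by (simp add: mult.commute mult.left_commute)
  finally show ?thesis by simp
qed

lemma circle_mult_cnj: "norm z = 1 \<Longrightarrow> z * cnj z = 1"
  by (metis complex_norm_square of_real_1 one_power2)

lemma circle_cnj_mult: "norm z = 1 \<Longrightarrow> cnj z * z = 1"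
  by (metis circle_mult_cnj mult.commute)

lemma integral_power_cnj:
  "(\<integral>z. z ^ i * cnj z ^ j \<partial>circle_measure) = (if i = j then 1 else 0)"
proof -
  have red: "(z::complex) ^ i * cnj z ^ j = (if j \<le> i then z ^ (i - j) else cnj (z ^ (j - i)))"
    if "norm z = 1" for z i j
  proof (cases "j \<le> i")
    case True
    then have "z ^ i * cnj z ^ j = z ^ (i - j) * (z * cnj z) ^ j"
      by (simp add: power_mult_distrib flip: power_add mult.assoc)
    then show ?thesis using True circle_mult_cnj[OF that] by simp
  next
    case False
    then have "z ^ i * cnj z ^ j = cnj z ^ (j - i) * (z * cnj z) ^ i"
      using power_add[of "cnj z" "j - i" i] by (simp add: power_mult_distrib mult_ac)
    then show ?thesis using False circle_mult_cnj[OF that] by simp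
  qed
  have "(\<integral>z. z ^ i * cnj z ^ j \<partial>circle_measure) =
      (\<integral>z. (if j \<le> i then z ^ (i - j) else cnj (z ^ (j - i))) \<partial>circle_measure)"
    by (intro Bochner_Integration.integral_cong) (auto simp: red)
  also have "\<dots> = (if i = j then 1 else 0)"
    using integral_power[of "i - j"] integral_power[of "j - i"]
    by (cases "j \<le> i"; cases "i = j") (auto simp del: complex_cnj_power)
  finally show ?thesis .
qed

text \<open>Absolute summability allows termwise integration against any continuous unimodular
  factor; orthogonality of the powers then isolates one coefficient, or none when the factor is a
  positive power of z.\<close>

lemma integral_power_series:
  fixes g :: "nat \<Rightarrow> complex"
  assumes summ: "summable (\<lambda>k. norm (g k))"
    and f: "\<And>z. norm z = 1 \<Longrightarrow> (\<lambda>k. g k * z ^ k) sums f z"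
  shows integral_power_series_coeff: "(\<integral>z. cnj z ^ m * f z \<partial>circle_measure) = g m"
    and integral_power_series_vanish: "m > 0 \<Longrightarrow> (\<integral>z. z ^ m * f z \<partial>circle_measure) = 0"
proof -
  have gen: "(\<lambda>k. \<integral>z. h z * (g k * z ^ k) \<partial>circle_measure) sums (\<integral>z. h z * f z \<partial>circle_measure)"
    if h: "continuous_on (sphere 0 1) h" "\<And>z. norm z = 1 \<Longrightarrow> norm (h z) = 1" for h :: "complex \<Rightarrow> complex"
  proof -
    have "(\<integral>z. h z * f z \<partial>circle_measure) = (\<integral>z. (\<Sum>k. h z * (g k * z ^ k)) \<partial>circle_measure)"
    proof (rule Bochner_Integration.integral_cong)
      fix z assume "z \<in> space circle_measure"
      then have "(\<lambda>k. h z * (g k * z ^ k)) sums (h z * f z)"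
        by (intro sums_mult f) auto
      then show "h z * f z = (\<Sum>k. h z * (g k * z ^ k))"
        by (simp add: sums_iff)
    qed simp
    moreover have "(\<lambda>k. \<integral>z. h z * (g k * z ^ k) \<partial>circle_measure) sums
        (\<integral>z. (\<Sum>k. h z * (g k * z ^ k)) \<partial>circle_measure)"
    proof (rule sums_integral)
      show "integrable circle_measure (\<lambda>z. h z * (g k * z ^ k))" for k
        by (intro circle_integrable_continuous continuous_intros h)
      show "AE z in circle_measure. summable (\<lambda>k. norm (h z * (g k * z ^ k)))"
        using summ by (intro AE_I2) (auto simp: norm_mult norm_power h)
      have "(\<integral>z. norm (h z * (g k * z ^ k)) \<partial>circle_measure) = (\<integral>z. norm (g k) \<partial>circle_measure)" for k
        by (intro Bochner_Integration.integral_cong) (auto simp: norm_mult norm_power h)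
      then show "summable (\<lambda>k. \<integral>z. norm (h z * (g k * z ^ k)) \<partial>circle_measure)"
        using summ by simp
    qed
    ultimately show ?thesis by simp
  qed
  have "(\<lambda>k. \<integral>z. cnj z ^ m * (g k * z ^ k) \<partial>circle_measure) sums (\<integral>z. cnj z ^ m * f z \<partial>circle_measure)"
    by (intro gen continuous_intros) (auto simp: norm_power)
  moreover have "(\<integral>z. cnj z ^ m * (g k * z ^ k) \<partial>circle_measure) = (if k = m then g k else 0)" for k
  proof -
    have "(\<integral>z. cnj z ^ m * (g k * z ^ k) \<partial>circle_measure) = (\<integral>z. g k * (z ^ k * cnj z ^ m) \<partial>circle_measure)"
      by (simp add: mult_ac)
    then show ?thesis
      by (simp add: integral_power_cnj)
  qed
  ultimately show "(\<integral>z. cnj z ^ m * f z \<partial>circle_measure) = g m"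
    using sums_unique2[OF _ sums_single[of m g]] by simp
  assume "m > 0"
  have "(\<lambda>k. \<integral>z. z ^ m * (g k * z ^ k) \<partial>circle_measure) sums (\<integral>z. z ^ m * f z \<partial>circle_measure)"
    by (intro gen continuous_intros) (auto simp: norm_power)
  moreover have "(\<integral>z. z ^ m * (g k * z ^ k) \<partial>circle_measure) = 0" for k
  proof -
    have "(\<integral>z. z ^ m * (g k * z ^ k) \<partial>circle_measure) = (\<integral>z. g k * z ^ (m + k) \<partial>circle_measure)"
      by (simp add: mult_ac power_add)
    then show ?thesis
      using \<open>m > 0\<close> by (simp add: integral_power)
  qed
  ultimately show "(\<integral>z. z ^ m * f z \<partial>circle_measure) = 0"
    by (simp add: sums_iff)
qed

lemma circle_integral_holomorphic:
  assumes "f holomorphic_on ball 0 R" "R > 1"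
  shows "(\<integral>z. z ^ m * f z \<partial>circle_measure) = (if m = 0 then f 0 else 0)"
proof -
  define g where "g k = (deriv ^^ k) f 0 / fact k" for k
  have sums: "(\<lambda>k. g k * z ^ k) sums f z" if "norm z < R" for z
    using holomorphic_power_series[OF assms(1), of z] that by (simp add: g_def)
  \<comment> \<open>The radius (1 + R) / 2 lies strictly between 1 and R; convergence there makes
    the series absolutely convergent at 1.\<close>
  have "summable (\<lambda>k. norm (g k * 1 ^ k))"
  proof (rule powser_insidea)
    show "summable (\<lambda>k. g k * of_real ((1 + R) / 2) ^ k)"
      using sums[of "of_real ((1 + R) / 2)"] assms(2) by (auto simp: sums_iff simp del: of_real_add of_real_divide)
    show "norm (1::complex) < norm (of_real ((1 + R) / 2) :: complex)"
      using assms(2) by (simp del: of_real_add of_real_divide)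
  qed
  then have summ: "summable (\<lambda>k. norm (g k))" by simp
  have s1: "(\<lambda>k. g k * z ^ k) sums f z" if "norm z = 1" for z
    using sums that assms(2) by simp
  show ?thesis
    using integral_power_series_coeff[OF summ s1, of 0] integral_power_series_vanish[OF summ s1, of m]
    by (auto simp: g_def)
qed

section \<open>Gram determinants of polynomials on the circle\<close>

definition wip :: "(complex \<Rightarrow> real) \<Rightarrow> complex poly \<Rightarrow> complex poly \<Rightarrow> complex" where
  "wip w p q = (\<integral>z. poly p z * cnj (poly q z) * of_real (w z) \<partial>circle_measure)"

definition wnorm :: "(complex \<Rightarrow> real) \<Rightarrow> complex poly \<Rightarrow> real" where
  "wnorm w p = (\<integral>z. (cmod (poly p z))\<^sup>2 * w z \<partial>circle_measure)"

text \<open>Strict positivity almost everywhere, rather than nonnegativity, forces a polynomial of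
  zero weighted norm to vanish almost everywhere on the circle.\<close>

definition weight :: "(complex \<Rightarrow> real) \<Rightarrow> bool" where
  "weight w \<longleftrightarrow> integrable circle_measure w \<and> (AE z in circle_measure. w z > 0)"

text \<open>The Gram matrix of 1, z, ..., z^(n-1) is the Toeplitz matrix of the weight. Indexing by
  the size makes the empty determinant 1 the start of the recursion; D_n of the theorem is
  \<open>tdet w (Suc n)\<close>.\<close>

definition tdet :: "(complex \<Rightarrow> real) \<Rightarrow> nat \<Rightarrow> complex" where
  "tdet w n = Determinant.det (Matrix.mat n n (\<lambda>(i, j). wip w (monom 1 i) (monom 1 j)))"

lemma weight_integrable: "weight w \<Longrightarrow> integrable circle_measure w"
  by (simp add: weight_def)

lemma weight_nonneg: "weight w \<Longrightarrow> AE z in circle_measure. w z \<ge> 0"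
  unfolding weight_def by (auto elim!: eventually_mono)

lemma wip_integrable:
  assumes "weight w"
  shows "integrable circle_measure (\<lambda>z. poly p z * cnj (poly q z) * of_real (w z))"
  using weight_integrable[OF assms]
  by (intro circle_integrable_continuous_mult continuous_intros) auto

lemma wnorm_integrable:
  assumes "weight w"
  shows "integrable circle_measure (\<lambda>z. (cmod (poly p z))\<^sup>2 * w z)"
  using weight_integrable[OF assms]
  by (intro circle_integrable_continuous_mult continuous_intros) auto

lemma wip_self: "wip w p p = of_real (wnorm w p)"
  unfolding wip_def wnorm_def integral_complex_of_real[symmetric]
  by (intro Bochner_Integration.integral_cong) (simp_all add: complex_norm_square del: of_real_power)

lemma wip_commute: "wip w q p = cnj (wip w p q)"
  unfolding wip_def
  by (subst Bochner_Integration.integral_cnj[symmetric]) (simp add: mult.commute mult.left_commute)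

lemma wip_add_left: "weight w \<Longrightarrow> wip w (p + q) r = wip w p r + wip w q r"
  unfolding wip_def
  using Bochner_Integration.integral_add[OF wip_integrable[of w p r] wip_integrable[of w q r]]
  by (simp add: distrib_right)

lemma wip_smult_left: "wip w (smult c p) r = c * wip w p r"
  unfolding wip_def by (subst integral_mult_right_zero[symmetric]) (simp add: algebra_simps)

lemma wip_zero_left [simp]: "wip w 0 r = 0"
  by (simp add: wip_def)

lemma wip_zero_right [simp]: "wip w r 0 = 0"
  by (simp add: wip_def)

lemma wip_add_right: "weight w \<Longrightarrow> wip w r (p + q) = wip w r p + wip w r q"
  using wip_add_left[of w p q r] by (simp add: wip_commute[of w r])

lemma wip_smult_right: "wip w r (smult c p) = cnj c * wip w r p"
  using wip_smult_left[of w c p r] by (simp add: wip_commute[of w r])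

lemma wip_diff_left: "weight w \<Longrightarrow> wip w (p - q) r = wip w p r - wip w q r"
  using wip_add_left[of w "p - q" q r] by simp

lemma wip_sum_left: "weight w \<Longrightarrow> wip w (\<Sum>i\<in>I. f i) r = (\<Sum>i\<in>I. wip w (f i) r)"
  by (induction I rule: infinite_finite_induct) (auto simp: wip_add_left)

lemma wip_sum_right: "weight w \<Longrightarrow> wip w r (\<Sum>i\<in>I. f i) = (\<Sum>i\<in>I. wip w r (f i))"
  by (induction I rule: infinite_finite_induct) (auto simp: wip_add_right)

text \<open>Multiplication by r is an isometry between two weights; this is what moves a factor of a
  polynomial into the weight.\<close>

lemma wip_mult:
  "wip w (r * p) (r * q) = wip (\<lambda>z. (cmod (poly r z))\<^sup>2 * w z) p q"
  unfolding wip_def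
  by (intro Bochner_Integration.integral_cong)
    (auto simp: complex_norm_square simp del: of_real_power)

lemma wip_cong:
  assumes "\<And>z. norm z = 1 \<Longrightarrow> w z = w' z"
  shows "wip w p q = wip w' p q"
  unfolding wip_def by (intro Bochner_Integration.integral_cong) (use assms in auto)

lemma wnorm_cong:
  assumes "\<And>z. norm z = 1 \<Longrightarrow> (cmod (poly p z))\<^sup>2 * w z = (cmod (poly q z))\<^sup>2 * w' z"
  shows "wnorm w p = wnorm w' q"
  unfolding wnorm_def by (intro Bochner_Integration.integral_cong) (use assms in auto)

lemma tdet_cong:
  assumes "\<And>z. norm z = 1 \<Longrightarrow> w z = w' z"
  shows "tdet w n = tdet w' n"
  using wip_cong[of w w'] assms by (simp add: tdet_def)

lemma wnorm_nonneg: "weight w \<Longrightarrow> wnorm w p \<ge> 0"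
  unfolding wnorm_def using weight_nonneg[of w]
  by (intro integral_nonneg_AE) (auto elim!: eventually_mono)

lemma wnorm_add_orth:
  assumes "weight w" "wip w p q = 0"
  shows "wnorm w (p + q) = wnorm w p + wnorm w q"
proof -
  have "of_real (wnorm w (p + q)) = wip w (p + q) (p + q)"
    by (simp add: wip_self)
  also have "\<dots> = wip w p p + wip w q q"
    using assms wip_commute[of w q p] by (simp add: wip_add_left wip_add_right)
  also have "\<dots> = of_real (wnorm w p + wnorm w q)"
    by (simp add: wip_self)
  finally show ?thesis
    using of_real_eq_iff by blast
qed

lemma wnorm_eq_0_AE:
  assumes "weight w" "wnorm w p = 0"
  shows "AE z in circle_measure. poly p z = 0"
proof -
  have "AE z in circle_measure. (cmod (poly p z))\<^sup>2 * w z = 0"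
    using assms weight_nonneg[OF assms(1)] wnorm_integrable[OF assms(1), of p] unfolding wnorm_def
    by (subst (asm) integral_nonneg_eq_0_iff_AE) (auto elim!: eventually_mono)
  moreover have "AE z in circle_measure. w z > 0"
    using assms by (simp add: weight_def)
  ultimately show ?thesis
    by eventually_elim auto
qed

lemma wip_eq_0_if_wnorm_eq_0:
  assumes "weight w" "wnorm w p = 0"
  shows "wip w q p = 0"
  unfolding wip_def using wnorm_eq_0_AE[OF assms]
  by (intro integral_eq_zero_AE) (auto elim!: eventually_mono)

lemma circle_integral_poly: "(\<integral>z. poly p z \<partial>circle_measure) = poly p 0"
proof -
  have "(\<lambda>z. poly p z) holomorphic_on ball 0 2"
    unfolding poly_altdef by (intro holomorphic_intros)
  from circle_integral_holomorphic[OF this, of 0] show ?thesis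
    by simp
qed

text \<open>The value at 0 is the mean over the circle, so a polynomial with value 1 there cannot
  vanish almost everywhere.\<close>

lemma wnorm_pos:
  assumes "weight w" "poly p 0 = 1"
  shows "wnorm w p > 0"
proof (rule ccontr)
  assume "\<not> wnorm w p > 0"
  then have "wnorm w p = 0"
    using wnorm_nonneg[OF assms(1)] by (meson antisym not_less)
  then have "AE z in circle_measure. poly p z = 0"
    by (rule wnorm_eq_0_AE[OF assms(1)])
  then have "(\<integral>z. poly p z \<partial>circle_measure) = 0"
    by (intro integral_eq_zero_AE)
  with assms(2) show False
    by (simp add: circle_integral_poly)
qed

section \<open>Orthogonal projection and the extremal problem\<close>

lemma wip_eq_0_if_orth_monoms:
  assumes w: "weight w" and orth: "\<And>j. j \<in> {1..n} \<Longrightarrow> wip w p (monom 1 j) = 0"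
    and q: "poly q 0 = 0" "degree q \<le> n"
  shows "wip w p q = 0"
proof -
  have q_eq: "q = (\<Sum>j\<le>n. smult (coeff q j) (monom 1 j))"
    using poly_as_sum_of_monoms'[OF q(2)] by (simp add: smult_monom)
  have "wip w p q = (\<Sum>j\<le>n. cnj (coeff q j) * wip w p (monom 1 j))"
    by (subst q_eq) (simp add: wip_sum_right[OF w] wip_smult_right)
  also have "\<dots> = 0"
  proof (intro sum.neutral ballI)
    fix j assume "j \<in> {..n}"
    then show "cnj (coeff q j) * wip w p (monom 1 j) = 0"
      using orth[of j] q(1) by (cases "j = 0") (auto simp: poly_0_coeff_0)
  qed
  finally show ?thesis .
qed

text \<open>Gram-Schmidt by induction on n, for all p at once because z^(n+1) itself is projected by
  the induction hypothesis. The residual r of that projection is orthogonal to z, ..., z^n, so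
  subtracting a multiple of r affects only the last condition.\<close>

lemma exists_projection:
  assumes w: "weight w"
  shows "\<exists>q. poly q 0 = 0 \<and> degree q \<le> n \<and> (\<forall>j\<in>{1..n}. wip w (p - q) (monom 1 j) = 0)"
proof (induction n arbitrary: p)
  case 0
  show ?case by (intro exI[of _ 0]) auto
next
  case (Suc n)
  let ?m = "monom 1 (Suc n) :: complex poly"
  obtain q where q: "poly q 0 = 0" "degree q \<le> n" "\<forall>j\<in>{1..n}. wip w (p - q) (monom 1 j) = 0"
    using Suc.IH by blast
  obtain s where s: "poly s 0 = 0" "degree s \<le> n" "\<forall>j\<in>{1..n}. wip w (?m - s) (monom 1 j) = 0"
    using Suc.IH by blast
  define r where "r = ?m - s"
  \<comment> \<open>If r has norm 0, division by 0 makes c = 0, and \<open>rr\<close> still holds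
    because both of its sides vanish.\<close>
  define c where "c = wip w (p - q) r / wip w r r"
  have rr: "wip w (p - q) r = c * wip w r r"
    using wip_eq_0_if_wnorm_eq_0[OF w, of r "p - q"] by (cases "wnorm w r = 0") (simp_all add: c_def wip_self)
  have orth: "wip w (p - q - smult c r) (monom 1 j) = 0" if "j \<in> {1..n}" for j
  proof -
    have "wip w (p - q) (monom 1 j) = 0" "wip w r (monom 1 j) = 0"
      using q(3) s(3) that unfolding r_def by blast+
    then show ?thesis
      unfolding wip_diff_left[OF w, of "p - q"] wip_smult_left by simp
  qed
  have "wip w (p - q - smult c r) (r + s) = wip w (p - q - smult c r) r"
    using wip_eq_0_if_orth_monoms[OF w orth s(1,2)] by (simp add: wip_add_right[OF w])
  also have "\<dots> = 0"
    using rr by (simp add: wip_diff_left[OF w] wip_smult_left)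
  finally have "wip w (p - (q + smult c r)) ?m = 0"
    by (simp only: r_def diff_diff_eq diff_add_cancel)
  moreover have "\<forall>j\<in>{1..n}. wip w (p - (q + smult c r)) (monom 1 j) = 0"
    using orth by (metis diff_diff_eq)
  ultimately have "\<forall>j\<in>{1..Suc n}. wip w (p - (q + smult c r)) (monom 1 j) = 0"
    by (metis atLeastAtMost_iff le_Suc_eq)
  moreover have "poly (q + smult c r) 0 = 0"
    using q(1) s(1) by (simp add: r_def poly_monom)
  moreover have "degree (q + smult c r) \<le> Suc n"
  proof -
    have "degree r \<le> Suc n"
      unfolding r_def using s(2) by (intro degree_diff_le degree_monom_le) simp
    then show ?thesis
      using q(2) degree_smult_le[of c r] by (intro degree_add_le) linarith+
  qed
  ultimately show ?case
    by (intro exI[of _ "q + smult c r"] conjI)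
qed

text \<open>These are the reversed monic orthogonal polynomials, usually written \<open>\<Phi>\<^sub>n\<^sup>*\<close>.\<close>

definition is_dual :: "(complex \<Rightarrow> real) \<Rightarrow> nat \<Rightarrow> complex poly \<Rightarrow> bool" where
  "is_dual w n p \<longleftrightarrow> poly p 0 = 1 \<and> degree p \<le> n \<and> (\<forall>j\<in>{1..n}. wip w p (monom 1 j) = 0)"

definition dual_poly :: "(complex \<Rightarrow> real) \<Rightarrow> nat \<Rightarrow> complex poly" where
  "dual_poly w n = (SOME p. is_dual w n p)"

lemma is_dual_dual_poly:
  assumes "weight w"
  shows "is_dual w n (dual_poly w n)"
proof -
  obtain q where "poly q 0 = 0 \<and> degree q \<le> n \<and> (\<forall>j\<in>{1..n}. wip w (1 - q) (monom 1 j) = 0)"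
    using exists_projection[OF assms] by blast
  then have "is_dual w n (1 - q)"
    by (auto simp: is_dual_def intro!: degree_diff_le)
  then show ?thesis
    unfolding dual_poly_def by (rule someI)
qed

text \<open>q - p vanishes at 0 and has degree at most n, hence is orthogonal to p; the claim is
  then Pythagoras.\<close>

lemma wnorm_dual_le:
  assumes "weight w" "is_dual w n p" "poly q 0 = 1" "degree q \<le> n"
  shows "wnorm w p \<le> wnorm w q"
proof -
  have "wip w p (q - p) = 0"
    using assms by (rule_tac wip_eq_0_if_orth_monoms[where n=n]) (auto simp: is_dual_def intro!: degree_diff_le)
  then have "wnorm w (p + (q - p)) = wnorm w p + wnorm w (q - p)"
    by (intro wnorm_add_orth assms)
  then show ?thesis
    using wnorm_nonneg[OF assms(1), of "q - p"] by simp
qed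

section \<open>Gram determinants under a change of the polynomials\<close>

lemma det_first_column:
  fixes A :: "'a::comm_ring_1 mat"
  assumes A: "A \<in> carrier_mat (Suc n) (Suc n)" and z: "\<And>i. 0 < i \<Longrightarrow> i \<le> n \<Longrightarrow> A $$ (i, 0) = 0"
  shows "Determinant.det A = A $$ (0, 0) * Determinant.det (Matrix.mat n n (\<lambda>(i, j). A $$ (Suc i, Suc j)))"
proof -
  have "Determinant.det A = (\<Sum>i<Suc n. A $$ (i, 0) * cofactor A i 0)"
    using laplace_expansion_column[OF A, of 0] by simp
  also have "\<dots> = (\<Sum>i\<in>{0}. A $$ (i, 0) * cofactor A i 0)"
    by (rule sum.mono_neutral_right) (use z in auto)
  also have "\<dots> = A $$ (0, 0) * Determinant.det (mat_delete A 0 0)"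
    by (simp add: cofactor_def)
  also have "mat_delete A 0 0 = Matrix.mat n n (\<lambda>(i, j). A $$ (Suc i, Suc j))"
    using A by (auto simp: mat_delete_def)
  finally show ?thesis .
qed

lemma prod_list_ones: "(\<And>x. x \<in> set xs \<Longrightarrow> x = 1) \<Longrightarrow> prod_list xs = 1"
  by (induction xs) auto

lemma det_cnj:
  "Determinant.det (Matrix.mat n n (\<lambda>(i, j). cnj (f i j))) = cnj (Determinant.det (Matrix.mat n n (\<lambda>(i, j). f i j)))"
proof -
  have "cnj (signof p) = signof p" for p :: "nat \<Rightarrow> nat"
    by (simp add: sign_def)
  then show ?thesis
    unfolding Determinant.det_def
    by (auto simp: cnj_prod intro!: sum.cong prod.cong dest: permutes_in_image)
qed

text \<open>The Gram matrix is A T B with A the coefficient matrix, T the Gram matrix of the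
  monomials and B the conjugate transpose of A.\<close>

lemma gram_det:
  assumes w: "weight w" and deg: "\<And>i. i < n \<Longrightarrow> degree (p i) < n"
  shows "Determinant.det (Matrix.mat n n (\<lambda>(i, j). wip w (p i) (p j))) =
    of_real ((cmod (Determinant.det (Matrix.mat n n (\<lambda>(i, j). coeff (p i) j))))\<^sup>2) * tdet w n"
proof -
  define A where "A = Matrix.mat n n (\<lambda>(i, j). coeff (p i) j)"
  define B where "B = Matrix.mat n n (\<lambda>(i, j). cnj (coeff (p j) i))"
  define T where "T = Matrix.mat n n (\<lambda>(i, j). wip w (monom 1 i) (monom 1 j))"
  have p_eq: "p i = (\<Sum>k<n. smult (coeff (p i) k) (monom 1 k))" if "i < n" for i
  proof -
    have "degree (p i) \<le> n - 1"
      using deg[OF that] by simp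
    from poly_as_sum_of_monoms'[OF this] have "p i = (\<Sum>k\<le>n - 1. monom (coeff (p i) k) k)"
      by simp
    also have "{..n - 1} = {..<n}"
      using that by auto
    finally show ?thesis
      by (simp add: smult_monom)
  qed
  have "wip w (p i) (p j) = (\<Sum>l<n. (\<Sum>k<n. coeff (p i) k * wip w (monom 1 k) (monom 1 l)) * cnj (coeff (p j) l))"
    if "i < n" "j < n" for i j
  proof -
    have "wip w (p i) (p j) = (\<Sum>l<n. cnj (coeff (p j) l) * wip w (p i) (monom 1 l))"
      by (subst p_eq[OF that(2)]) (simp only: wip_sum_right[OF w] wip_smult_right)
    also have "\<dots> = (\<Sum>l<n. (\<Sum>k<n. coeff (p i) k * wip w (monom 1 k) (monom 1 l)) * cnj (coeff (p j) l))"
      by (subst p_eq[OF that(1)]) (simp only: wip_sum_left[OF w] wip_smult_left mult.commute)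
    finally show ?thesis .
  qed
  then have eq: "Matrix.mat n n (\<lambda>(i, j). wip w (p i) (p j)) = A * T * B"
    by (intro eq_matI) (auto simp: A_def B_def T_def scalar_prod_def atLeast0LessThan)
  have carr: "A \<in> carrier_mat n n" "B \<in> carrier_mat n n" "T \<in> carrier_mat n n"
    by (auto simp: A_def B_def T_def)
  have "B = transpose_mat (Matrix.mat n n (\<lambda>(i, j). cnj (coeff (p i) j)))"
    by (auto simp: B_def)
  then have "Determinant.det B = cnj (Determinant.det A)"
    using det_cnj[of n "\<lambda>i j. coeff (p i) j"]
    by (simp add: Determinant.det_transpose[of _ n] A_def)
  moreover have "Determinant.det (A * T * B) = Determinant.det A * tdet w n * Determinant.det B"
    using carr by (simp add: Determinant.det_mult[of _ n] tdet_def T_def)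
  ultimately show ?thesis
    unfolding eq A_def[symmetric] by (simp add: complex_norm_square mult_ac del: of_real_power)
qed

text \<open>Modulo the multiples of \<open>z - c\<close>, every polynomial is congruent to its value at \<open>c\<close>.\<close>

lemma det_coeff_eval:
  fixes p :: "'a::comm_ring_1 poly"
  assumes "degree p \<le> n"
  shows "Determinant.det (Matrix.mat (Suc n) (Suc n)
      (\<lambda>(i, j). coeff (case i of 0 \<Rightarrow> p | Suc k \<Rightarrow> [:- c, 1:] * monom 1 k) j)) = poly p c"
proof -
  define f where "f i = (case i of 0 \<Rightarrow> p | Suc k \<Rightarrow> [:- c, 1:] * monom 1 k)" for i
  have f0: "f 0 = p" and fS: "f (Suc k) = [:- c, 1:] * monom 1 k" for k
    by (simp_all add: f_def)
  have coeff_fS: "coeff (f (Suc k)) j = (if j = Suc k then 1 else if j = k then - c else 0)" for k j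
    by (auto simp: fS coeff_pCons split: nat.splits)
  define A where "A = Matrix.mat (Suc n) (Suc n) (\<lambda>(i, j). coeff (f i) j)"
  \<comment> \<open>Right multiplication by U replaces the first column by the values at c and keeps
    the other columns. The rows after the first are multiples of z - c and get 0 there, and their
    remaining block is triangular with unit diagonal.\<close>
  define U where "U = Matrix.mat (Suc n) (Suc n) (\<lambda>(i, j). if j = 0 then c ^ i else if i = j then 1 else 0)"
  have carr: "A \<in> carrier_mat (Suc n) (Suc n)" "U \<in> carrier_mat (Suc n) (Suc n)"
    by (auto simp: A_def U_def)
  have "Determinant.det U = prod_list (diag_mat U)"
    by (rule det_lower_triangular[OF _ carr(2)]) (auto simp: U_def)
  also have "\<dots> = 1"
    by (intro prod_list_ones) (auto simp: diag_mat_def U_def)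
  finally have detU: "Determinant.det U = 1" .
  have deg: "degree (f i) \<le> n" if "i < Suc n" for i
    using assms that by (cases i) (auto simp: f0 coeff_fS intro!: degree_le)
  define V where "V = A * U"
  have V: "V \<in> carrier_mat (Suc n) (Suc n)"
    using carr by (simp add: V_def)
  have V_eq: "V $$ (i, j) = (\<Sum>k<Suc n. coeff (f i) k * (if j = 0 then c ^ k else if k = j then 1 else 0))"
    if "i < Suc n" "j < Suc n" for i j
    using that by (simp add: V_def A_def U_def scalar_prod_def atLeast0LessThan del: sum.lessThan_Suc)
  have V0: "V $$ (i, 0) = poly (f i) c" if "i < Suc n" for i
  proof -
    have "V $$ (i, 0) = (\<Sum>k<Suc n. coeff (f i) k * c ^ k)"
      using that by (simp add: V_eq del: sum.lessThan_Suc)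
    also have "\<dots> = poly (f i) c"
      unfolding poly_altdef using deg[OF that]
      by (intro sum.mono_neutral_right) (auto simp: coeff_eq_0)
    finally show ?thesis .
  qed
  have VS: "V $$ (i, Suc j) = coeff (f i) (Suc j)" if "i < Suc n" "j < n" for i j
  proof -
    have "V $$ (i, Suc j) = (\<Sum>k<Suc n. if k = Suc j then coeff (f i) k else 0)"
      using that by (subst V_eq) (simp_all del: sum.lessThan_Suc add: if_distrib cong: if_cong)
    also have "\<dots> = coeff (f i) (Suc j)"
      using that by (subst sum.delta) auto
    finally show ?thesis .
  qed
  define M where "M = Matrix.mat n n (\<lambda>(i, j). V $$ (Suc i, Suc j))"
  have M: "M $$ (i, j) = (if j = i then 1 else if i = Suc j then - c else 0)" if "i < n" "j < n" for i j
    using that VS[of "Suc i" j] by (simp add: M_def coeff_fS)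
  have "Determinant.det M = prod_list (diag_mat M)"
    by (rule det_lower_triangular[where n=n]) (auto simp: M, simp add: M_def)
  also have "\<dots> = 1"
  proof (rule prod_list_ones)
    fix x assume "x \<in> set (diag_mat M)"
    then obtain i where "i < n" "x = M $$ (i, i)"
      by (auto simp: diag_mat_def M_def)
    then show "x = 1"
      by (simp add: M)
  qed
  finally have detM: "Determinant.det M = 1" .
  have "Determinant.det V = V $$ (0, 0) * Determinant.det M"
    unfolding M_def
  proof (rule det_first_column[OF V])
    fix i assume "0 < i" "i \<le> n"
    then show "V $$ (i, 0) = 0"
      by (cases i) (simp_all add: V0 fS)
  qed
  then have "Determinant.det V = poly p c"
    by (simp add: V0 detM f0)
  then show ?thesis
    using carr detU by (simp add: Determinant.det_mult[of _ "Suc n"] A_def V_def f_def)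
qed

text \<open>Take the Gram matrix of p, z - c, (z - c) z, ..., (z - c) z^(n-1). It splits because p
  is orthogonal to the rest, and the rest has the Gram matrix of the weight |z - c|^2 w. The
  coefficient matrix of this family has determinant p(c).\<close>

lemma tdet_Suc_eval:
  assumes w: "weight w" and deg: "degree p \<le> n"
    and orth: "\<And>j. j < n \<Longrightarrow> wip w p ([:- c, 1:] * monom 1 j) = 0"
  shows "tdet w (Suc n) * of_real ((cmod (poly p c))\<^sup>2) =
    of_real (wnorm w p) * tdet (\<lambda>z. (cmod (z - c))\<^sup>2 * w z) n"
proof -
  define f where "f i = (case i of 0 \<Rightarrow> p | Suc k \<Rightarrow> [:- c, 1:] * monom 1 k)" for i
  have f0: "f 0 = p" and fS: "f (Suc k) = [:- c, 1:] * monom 1 k" for k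
    by (simp_all add: f_def)
  have deg': "degree (f i) < Suc n" if "i < Suc n" for i
  proof (cases i)
    case (Suc k)
    have "degree (f i) \<le> degree [:- c, 1:] + degree (monom (1::complex) k)"
      unfolding Suc fS by (rule degree_mult_le)
    also have "\<dots> \<le> 1 + k"
      by (simp add: degree_monom_le)
    finally show ?thesis
      using that Suc by simp
  qed (use deg f0 in simp)
  let ?G = "Matrix.mat (Suc n) (Suc n) (\<lambda>(i, j). wip w (f i) (f j))"
  have "Determinant.det ?G = ?G $$ (0, 0) * Determinant.det (Matrix.mat n n (\<lambda>(i, j). ?G $$ (Suc i, Suc j)))"
  proof (rule det_first_column)
    fix i assume i: "0 < i" "i \<le> n"
    then obtain k where k: "i = Suc k" by (cases i) auto
    then show "?G $$ (i, 0) = 0"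
      using orth[of k] i wip_commute[of w "[:- c, 1:] * monom 1 k" p] by (simp add: f0 fS del: mult_pCons_left)
  qed auto
  also have "Matrix.mat n n (\<lambda>(i, j). ?G $$ (Suc i, Suc j)) =
      Matrix.mat n n (\<lambda>(i, j). wip (\<lambda>z. (cmod (z - c))\<^sup>2 * w z) (monom 1 i) (monom 1 j))"
    by (auto simp: fS wip_mult simp del: mult_pCons_left)
  finally have "Determinant.det ?G = of_real (wnorm w p) * tdet (\<lambda>z. (cmod (z - c))\<^sup>2 * w z) n"
    by (simp add: tdet_def f0 wip_self)
  moreover have "Determinant.det ?G = of_real ((cmod (poly p c))\<^sup>2) * tdet w (Suc n)"
    using gram_det[OF w deg'] det_coeff_eval[OF deg, of c] by (simp add: f_def)
  ultimately show ?thesis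
    by (simp add: mult.commute)
qed

section \<open>Toeplitz determinants and zeros of dual orthogonal polynomials\<close>

text \<open>The case c = 0 of \<open>tdet_Suc_eval\<close>: \<open>is_dual\<close> is orthogonality
  to multiples of z, and |z|^2 = 1 leaves the weight unchanged.\<close>

lemma tdet_Suc:
  assumes w: "weight w" and p: "is_dual w n p"
  shows "tdet w (Suc n) = of_real (wnorm w p) * tdet w n"
proof -
  have "tdet w (Suc n) * of_real ((cmod (poly p 0))\<^sup>2) =
      of_real (wnorm w p) * tdet (\<lambda>z. (cmod (z - 0))\<^sup>2 * w z) n"
  proof (rule tdet_Suc_eval[OF w])
    show "degree p \<le> n"
      using p by (simp add: is_dual_def)
    fix j assume "j < n"
    moreover have "[:- 0, 1:] * monom 1 j = (monom 1 (Suc j) :: complex poly)"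
      by (simp add: monom_Suc)
    ultimately show "wip w p ([:- 0, 1:] * monom 1 j) = 0"
      using p unfolding is_dual_def by (metis Suc_le_eq atLeastAtMost_iff le_add1 plus_1_eq_Suc)
  qed
  moreover have "tdet (\<lambda>z. (cmod (z - 0))\<^sup>2 * w z) n = tdet w n"
    by (rule tdet_cong) simp
  moreover have "poly p 0 = 1"
    using p by (simp add: is_dual_def)
  ultimately show ?thesis by simp
qed

lemma tdet_0 [simp]: "tdet w 0 = 1"
  by (simp add: tdet_def)

text \<open>The Toeplitz determinant as a real number, see \<open>tdet_eq_rdet\<close>; written as a
  product of minima it is visibly positive and monotone in the weight.\<close>

definition rdet :: "(complex \<Rightarrow> real) \<Rightarrow> nat \<Rightarrow> real" where
  "rdet w n = (\<Prod>k<n. wnorm w (dual_poly w k))"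

lemma tdet_eq_rdet: "weight w \<Longrightarrow> tdet w n = of_real (rdet w n)"
  by (induction n) (simp_all add: rdet_def tdet_Suc[OF _ is_dual_dual_poly] mult.commute)

lemma rdet_Suc:
  assumes "weight w" "is_dual w n p"
  shows "rdet w (Suc n) = wnorm w p * rdet w n"
  using tdet_Suc[OF assms] unfolding tdet_eq_rdet[OF assms(1)] by (simp flip: of_real_mult)

lemma poly_dual_poly_0: "weight w \<Longrightarrow> poly (dual_poly w n) 0 = 1"
  using is_dual_dual_poly[of w n] by (simp add: is_dual_def)

lemma rdet_pos: "weight w \<Longrightarrow> rdet w n > 0"
  unfolding rdet_def by (intro prod_pos ballI wnorm_pos poly_dual_poly_0)

section \<open>Dependence of the determinants on the weight\<close>

lemma wnorm_mono:
  assumes "weight w" "weight w'" "AE z in circle_measure. w z \<le> w' z"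
  shows "wnorm w p \<le> wnorm w' p"
  unfolding wnorm_def using assms(3)
  by (intro integral_mono_AE wnorm_integrable assms) (auto elim!: eventually_mono intro!: mult_left_mono)

text \<open>Factor by factor: the minimizer for w' competes in the minimum problem for w, and its
  norm only grows when w is replaced by w'.\<close>

lemma rdet_mono:
  assumes w: "weight w" "weight w'" "AE z in circle_measure. w z \<le> w' z"
  shows "rdet w n \<le> rdet w' n"
  unfolding rdet_def
proof (intro prod_mono conjI)
  fix k
  show "0 \<le> wnorm w (dual_poly w k)"
    by (rule wnorm_nonneg[OF w(1)])
  have "wnorm w (dual_poly w k) \<le> wnorm w (dual_poly w' k)"
    using is_dual_dual_poly[OF w(1), of k] is_dual_dual_poly[OF w(2), of k]
    by (intro wnorm_dual_le[OF w(1)]) (auto simp: is_dual_def)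
  also have "\<dots> \<le> wnorm w' (dual_poly w' k)"
    by (rule wnorm_mono[OF w])
  finally show "wnorm w (dual_poly w k) \<le> wnorm w' (dual_poly w' k)" .
qed

lemma weight_scale: "weight w \<Longrightarrow> c > 0 \<Longrightarrow> weight (\<lambda>z. c * w z)"
  by (auto simp: weight_def elim!: eventually_mono)

lemma rdet_scale:
  assumes w: "weight w" and c: "c > 0"
  shows "rdet (\<lambda>z. c * w z) n = c ^ n * rdet w n"
proof -
  have "wip (\<lambda>z. c * w z) p q = of_real c * wip w p q" for p q
    unfolding wip_def by (subst integral_mult_right_zero[symmetric]) (simp add: mult_ac)
  then have "Matrix.mat n n (\<lambda>(i, j). wip (\<lambda>z. c * w z) (monom 1 i) (monom 1 j)) =
      of_real c \<cdot>\<^sub>m Matrix.mat n n (\<lambda>(i, j). wip w (monom 1 i) (monom 1 j))"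
    by auto
  then have "tdet (\<lambda>z. c * w z) n = of_real c ^ n * tdet w n"
    by (simp add: tdet_def)
  then have "complex_of_real (rdet (\<lambda>z. c * w z) n) = of_real (c ^ n * rdet w n)"
    by (simp add: tdet_eq_rdet w weight_scale c)
  then show ?thesis
    using of_real_eq_iff by blast
qed

text \<open>The limit is taken in \<open>tdet\<close>, a polynomial in finitely many entries, each
  convergent by dominated convergence; minimizers of different weights are never compared.\<close>

lemma rdet_tendsto:
  assumes w: "weight w" "\<And>k. weight (v k)"
    and lim: "AE z in circle_measure. (\<lambda>k. v k z) \<longlonglongrightarrow> w z"
    and g: "integrable circle_measure g" "\<And>k. AE z in circle_measure. v k z \<le> g z"
  shows "(\<lambda>k. rdet (v k) n) \<longlonglongrightarrow> rdet w n"
proof -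
  have lim_wip: "(\<lambda>k. wip (v k) (monom 1 i) (monom 1 j)) \<longlonglongrightarrow> wip w (monom 1 i) (monom 1 j)" for i j
    unfolding wip_def
  proof (rule integral_dominated_convergence[where w=g])
    show "AE z in circle_measure. (\<lambda>k. poly (monom 1 i) z * cnj (poly (monom 1 j) z) * of_real (v k z)) \<longlonglongrightarrow>
        poly (monom 1 i) z * cnj (poly (monom 1 j) z) * of_real (w z)"
      using lim by eventually_elim (auto intro!: tendsto_intros)
    show "AE z in circle_measure. norm (poly (monom 1 i) z * cnj (poly (monom 1 j) z) * of_real (v k z)) \<le> g z" for k
    proof -
      have "AE z in circle_measure. norm z = 1"
        by (rule AE_I2) simp
      with g(2)[of k] weight_nonneg[OF w(2)[of k]] show ?thesis
        by eventually_elim (auto simp: poly_monom norm_mult norm_power)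
    qed
  qed (use g(1) borel_measurable_integrable[OF wip_integrable[OF w(1)]]
         borel_measurable_integrable[OF wip_integrable[OF w(2)]] in auto)
  have tdet_eq: "tdet u n = (\<Sum>p | p permutes {0..<n}. signof p * (\<Prod>i = 0..<n. wip u (monom 1 i) (monom 1 (p i))))" for u
    unfolding tdet_def
    by (subst det_def'[where n=n]) (auto intro!: sum.cong prod.cong dest: permutes_in_image)
  have "(\<lambda>k. tdet (v k) n) \<longlonglongrightarrow> tdet w n"
    unfolding tdet_eq by (intro tendsto_sum tendsto_mult tendsto_const tendsto_prod lim_wip)
  then show ?thesis
    by (simp add: tdet_eq_rdet w tendsto_of_real_iff)
qed

section \<open>Polynomials written through the reciprocals of their zeros\<close>

lemma prod_list_mult:
  fixes f g :: "'b \<Rightarrow> 'a::comm_monoid_mult"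
  shows "(\<Prod>x\<leftarrow>xs. f x * g x) = (\<Prod>x\<leftarrow>xs. f x) * (\<Prod>x\<leftarrow>xs. g x)"
  by (induction xs) (simp_all add: mult_ac)

text \<open>The parameters are reciprocals of zeros, which normalizes the value at 0 to 1. An entry
  a = 0 gives the factor 1, so a list may be longer than the degree.\<close>

definition rpoly :: "complex list \<Rightarrow> complex poly" where
  "rpoly as = (\<Prod>a\<leftarrow>as. [:1, - a:])"

lemma rpoly_Nil [simp]: "rpoly [] = 1"
  by (simp add: rpoly_def)

lemma rpoly_Cons: "rpoly (a # as) = [:1, - a:] * rpoly as"
  by (simp add: rpoly_def)

lemma poly_rpoly: "poly (rpoly as) z = (\<Prod>a\<leftarrow>as. 1 - a * z)"
  by (induction as) (simp_all add: rpoly_Cons algebra_simps)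

lemma poly_rpoly_0 [simp]: "poly (rpoly as) 0 = 1"
  by (induction as) (simp_all add: rpoly_Cons)

lemma degree_rpoly: "degree (rpoly as) \<le> length as"
proof (induction as)
  case (Cons a as)
  have "degree (rpoly (a # as)) \<le> degree [:1, - a:] + degree (rpoly as)"
    unfolding rpoly_Cons by (rule degree_mult_le)
  also have "\<dots> \<le> 1 + length as"
    using Cons by (intro add_mono) auto
  finally show ?case by simp
qed simp

lemma cnj_prod_list: "cnj (prod_list xs) = prod_list (map cnj xs)"
  by (induction xs) auto

text \<open>Identifies the weight |z - c|^2 w of \<open>tdet_Suc_eval\<close> at c =
  \<open>cnj a\<close> with the weight obtained by removing the factor 1 - a z.\<close>

lemma cmod_reflected_factor:
  assumes "norm z = 1"
  shows "cmod (z - cnj a) = cmod (1 - a * z)"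
proof -
  have "z - cnj a = z * cnj (1 - a * z)"
    using circle_mult_cnj[OF assms] by (simp add: algebra_simps)
  then show ?thesis
    using assms by (simp only: norm_mult complex_mod_cnj mult_1)
qed

text \<open>Removing the factor \<open>1 - a z\<close> from the dual orthogonal polynomial and multiplying the weight by
  \<open>\<bar>1 - a z\<bar>\<^sup>2\<close> gives the dual orthogonal polynomial of the new weight; the two Toeplitz
  determinants are related by evaluation at \<open>cnj a\<close>.\<close>

theorem toeplitz_det_zeros:
  assumes "weight w" "\<And>j. j \<in> {1..length as} \<Longrightarrow> wip w (rpoly as) (monom 1 j) = 0"
  shows "(\<forall>a\<in>set as. cmod a < 1) \<and>
    tdet w (length as) * (\<Prod>a\<leftarrow>as. \<Prod>b\<leftarrow>as. 1 - a * cnj b) = of_real (wnorm w (rpoly as)) ^ length as"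
  using assms
proof (induction as arbitrary: w)
  case Nil
  then show ?case by simp
next
  case (Cons a as)
  note w = Cons.prems(1)
  define n where "n = length as"
  define P where "P = rpoly (a # as)"
  define Q where "Q = rpoly as"
  define w' where "w' z = (cmod (1 - a * z))\<^sup>2 * w z" for z
  have orthP: "wip w P q = 0" if "poly q 0 = 0" "degree q \<le> Suc n" for q
    by (rule wip_eq_0_if_orth_monoms[OF w _ that])
      (use Cons.prems(2) in \<open>simp add: P_def n_def\<close>)
  have degQ: "degree Q \<le> n"
    unfolding Q_def n_def by (rule degree_rpoly)
  have P_eq: "P = [:1, - a:] * Q"
    by (simp add: P_def Q_def rpoly_Cons)
  have polyP: "poly P z = (1 - a * z) * poly Q z" for z
    by (simp add: P_eq algebra_simps)
  \<comment> \<open>Since z Q is orthogonal to P, the squared norms satisfy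
    \<open>wnorm w P = (1 - (cmod a)\<^sup>2) * wnorm w Q\<close>; positivity of the left side
    yields |a| < 1.\<close>
  have Q_eq: "Q = P + smult a (pCons 0 Q)"
    by (simp add: P_eq algebra_simps)
  have "wip w P (smult a (pCons 0 Q)) = 0"
  proof (rule orthP)
    show "degree (smult a (pCons 0 Q)) \<le> Suc n"
      using degQ degree_smult_le[of a "pCons 0 Q"] degree_pCons_le[of 0 Q] by linarith
  qed simp
  then have "wnorm w (P + smult a (pCons 0 Q)) = wnorm w P + wnorm w (smult a (pCons 0 Q))"
    by (rule wnorm_add_orth[OF w])
  also have "wnorm w (smult a (pCons 0 Q)) = (cmod a)\<^sup>2 * wnorm w Q"
  proof -
    have "wnorm w (smult a (pCons 0 Q)) = wnorm (\<lambda>z. (cmod a)\<^sup>2 * w z) Q"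
      by (rule wnorm_cong) (simp add: norm_mult power_mult_distrib)
    also have "\<dots> = (cmod a)\<^sup>2 * wnorm w Q"
      unfolding wnorm_def by (subst integral_mult_right_zero[symmetric]) (simp add: mult_ac)
    finally show ?thesis .
  qed
  finally have normQ: "wnorm w P = (1 - (cmod a)\<^sup>2) * wnorm w Q"
    unfolding Q_eq[symmetric] left_diff_distrib by linarith
  have "wnorm w P > 0"
    by (rule wnorm_pos[OF w]) (simp add: P_def)
  then have "(cmod a)\<^sup>2 < 1"
    using normQ wnorm_nonneg[OF w, of Q] by (simp add: zero_less_mult_iff)
  then have a: "cmod a < 1"
    by (simp add: power_less_one_iff)
  have w': "weight w'"
  proof -
    have "integrable circle_measure w'"
      unfolding w'_def
      by (intro circle_integrable_continuous_mult weight_integrable[OF w] continuous_intros)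
    moreover have "AE z in circle_measure. norm z = 1"
      by (rule AE_I2) simp
    moreover have "1 - a * z \<noteq> 0" if "norm z = 1" for z
      using a that by (metis norm_mult norm_one mult.right_neutral less_irrefl right_minus_eq)
    ultimately show ?thesis
      using w unfolding weight_def w'_def by (auto elim!: eventually_elim2)
  qed
  have IH: "(\<forall>a\<in>set as. cmod a < 1) \<and>
      tdet w' n * (\<Prod>a\<leftarrow>as. \<Prod>b\<leftarrow>as. 1 - a * cnj b) = of_real (wnorm w' Q) ^ n"
    unfolding n_def Q_def
  proof (rule Cons.IH[OF w'])
    fix j assume j: "j \<in> {1..length as}"
    have "wip w' (rpoly as) (monom 1 j) = wip w ([:1, - a:] * rpoly as) ([:1, - a:] * monom 1 j)"
      unfolding wip_mult w'_def by (simp add: algebra_simps)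
    also have "\<dots> = wip w P ([:1, - a:] * monom 1 j)"
      by (simp add: P_eq Q_def)
    also have "\<dots> = 0"
    proof (rule orthP)
      show "poly ([:1, - a:] * monom 1 j) 0 = 0"
        using j by (simp add: poly_monom)
      have "degree ([:1, - a:] * monom 1 j) \<le> degree [:1, - a:] + degree (monom (1::complex) j)"
        by (rule degree_mult_le)
      also have "\<dots> \<le> 1 + n"
        using j by (intro add_mono) (auto simp: degree_monom_eq n_def)
      finally show "degree ([:1, - a:] * monom 1 j) \<le> Suc n"
        by simp
    qed
    finally show "wip w' (rpoly as) (monom 1 j) = 0" .
  qed
  have normQ': "wnorm w' Q = wnorm w P"
    by (rule wnorm_cong) (simp add: polyP w'_def norm_mult power_mult_distrib mult_ac)
  \<comment> \<open>Q is orthogonal to the multiples of \<open>z - cnj a\<close> of degree at most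
    n: on the circle \<open>cnj (z - cnj a) = (1 - a * z) * cnj z\<close>, and the factor
    \<open>1 - a * z\<close> turns Q into P.\<close>
  have "tdet w (Suc n) * of_real ((cmod (poly Q (cnj a)))\<^sup>2) =
      of_real (wnorm w Q) * tdet (\<lambda>z. (cmod (z - cnj a))\<^sup>2 * w z) n"
  proof (rule tdet_Suc_eval[OF w degQ])
    fix j assume j: "j < n"
    have "wip w Q ([:- cnj a, 1:] * monom 1 j) = wip w P (pCons 0 (monom 1 j))"
      unfolding wip_def
    proof (rule Bochner_Integration.integral_cong)
      fix z assume "z \<in> space circle_measure"
      then have "cnj (z - cnj a) = (1 - a * z) * cnj z"
        using circle_mult_cnj[of z] by (simp add: algebra_simps)
      moreover have "poly ([:- cnj a, 1:] * monom 1 j) z = (z - cnj a) * poly (monom 1 j) z"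
        by (simp add: algebra_simps)
      ultimately have "cnj (poly ([:- cnj a, 1:] * monom 1 j) z) =
          (1 - a * z) * cnj (poly (pCons 0 (monom 1 j)) z)"
        by (simp only: poly_pCons complex_cnj_mult add_0) simp
      then show "poly Q z * cnj (poly ([:- cnj a, 1:] * monom 1 j) z) * complex_of_real (w z) =
          poly P z * cnj (poly (pCons 0 (monom 1 j)) z) * complex_of_real (w z)"
        by (simp only: polyP) (simp only: mult_ac)
    qed simp
    also have "\<dots> = 0"
    proof (rule orthP)
      show "degree (pCons 0 (monom (1::complex) j)) \<le> Suc n"
        using j by (simp add: degree_monom_eq flip: monom_Suc)
    qed simp
    finally show "wip w Q ([:- cnj a, 1:] * monom 1 j) = 0" .
  qed
  also have "tdet (\<lambda>z. (cmod (z - cnj a))\<^sup>2 * w z) n = tdet w' n"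
    by (rule tdet_cong) (simp add: w'_def cmod_reflected_factor)
  finally have D: "tdet w (Suc n) * of_real ((cmod (poly Q (cnj a)))\<^sup>2) = of_real (wnorm w Q) * tdet w' n" .
  \<comment> \<open>The value |Q(cnj a)|^2 supplies the mixed factors, with exactly one index at the
    new entry, by which the double product grows; the diagonal factor 1 - |a|^2 is absorbed by
    \<open>normQ\<close>.\<close>
  have ev: "of_real ((cmod (poly Q (cnj a)))\<^sup>2) = (\<Prod>b\<leftarrow>as. 1 - b * cnj a) * (\<Prod>b\<leftarrow>as. 1 - a * cnj b)"
    unfolding complex_norm_square Q_def poly_rpoly cnj_prod_list
    by (simp add: o_def mult.commute)
  have "tdet w (Suc n) * (\<Prod>c\<leftarrow>a # as. \<Prod>b\<leftarrow>a # as. 1 - c * cnj b) =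
      (1 - a * cnj a) * (tdet w (Suc n) * of_real ((cmod (poly Q (cnj a)))\<^sup>2)) * (\<Prod>c\<leftarrow>as. \<Prod>b\<leftarrow>as. 1 - c * cnj b)"
    unfolding ev by (simp add: prod_list_mult mult_ac)
  also have "\<dots> = (1 - a * cnj a) * of_real (wnorm w Q) * (tdet w' n * (\<Prod>c\<leftarrow>as. \<Prod>b\<leftarrow>as. 1 - c * cnj b))"
    unfolding D by (simp add: mult_ac)
  also have "\<dots> = (1 - a * cnj a) * of_real (wnorm w Q) * of_real (wnorm w P) ^ n"
    using IH by (simp add: normQ')
  also have "(1 - a * cnj a) * of_real (wnorm w Q) = complex_of_real (wnorm w P)"
    unfolding normQ by (simp flip: complex_norm_square)
  finally show ?case
    using IH a by (simp add: n_def P_def)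
qed

section \<open>Logarithms of polynomials and the lower bound\<close>

lemma sums_sum_list:
  fixes f :: "'b \<Rightarrow> nat \<Rightarrow> 'a::real_normed_vector"
  assumes "\<And>x. x \<in> set xs \<Longrightarrow> f x sums g x"
  shows "(\<lambda>k. \<Sum>x\<leftarrow>xs. f x k) sums (\<Sum>x\<leftarrow>xs. g x)"
  using assms by (induction xs) (auto intro!: sums_add)

lemma exp_sum_list: "exp (\<Sum>x\<leftarrow>xs. f x :: 'a::{real_normed_field,banach}) = (\<Prod>x\<leftarrow>xs. exp (f x))"
  by (induction xs) (auto simp: exp_add)

lemma sum_list_cnj: "cnj (sum_list xs) = sum_list (map cnj xs)"
  by (induction xs) auto

lemma prod_list_map_cong:
  "(\<And>x. x \<in> set xs \<Longrightarrow> f x = g x) \<Longrightarrow> (\<Prod>x\<leftarrow>xs. f x) = (\<Prod>x\<leftarrow>xs. g x)"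
  by (induction xs) auto

definition psum :: "complex list \<Rightarrow> nat \<Rightarrow> complex" where
  "psum as k = (\<Sum>a\<leftarrow>as. a ^ k)"

text \<open>The term \<open>k = 0\<close> vanishes since \<open>x / 0 = 0\<close>.\<close>

definition energy :: "complex list \<Rightarrow> real" where
  "energy as = (\<Sum>k. (cmod (psum as k))\<^sup>2 / real k)"

lemma Ln_one_minus_sums:
  assumes "cmod x < 1"
  shows "(\<lambda>k. - (x ^ k) / of_nat k) sums ln (1 - x)"
  using Ln_series'[of "- x"] assms by simp

text \<open>Expand \<open>- ln (1 - a * cnj b)\<close> into the terms (a cnj b)^k / k with k >= 1;
  for each k the double sum over a and b factors into |s_k|^2 / k.\<close>

lemma energy_sums:
  assumes "\<And>a. a \<in> set as \<Longrightarrow> cmod a < 1"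
  shows "(\<lambda>k. (cmod (psum as k))\<^sup>2 / real k) sums energy as"
    and "(\<Prod>a\<leftarrow>as. \<Prod>b\<leftarrow>as. 1 - a * cnj b) = of_real (exp (- energy as))"
proof -
  define S where "S = (\<Sum>a\<leftarrow>as. \<Sum>b\<leftarrow>as. - ln (1 - a * cnj b))"
  have ab: "cmod (a * cnj b) < 1" if "a \<in> set as" "b \<in> set as" for a b
    using mult_strict_mono'[of "cmod a" 1 "cmod b" 1] assms that by (simp add: norm_mult)
  have "(\<lambda>k. \<Sum>a\<leftarrow>as. \<Sum>b\<leftarrow>as. - (- ((a * cnj b) ^ k) / of_nat k)) sums S"
    unfolding S_def by (intro sums_sum_list sums_minus Ln_one_minus_sums ab)
  moreover have "(\<Sum>a\<leftarrow>as. \<Sum>b\<leftarrow>as. - (- ((a * cnj b) ^ k) / of_nat k)) =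
      complex_of_real ((cmod (psum as k))\<^sup>2 / real k)" for k
  proof -
    have "(\<Sum>a\<leftarrow>as. \<Sum>b\<leftarrow>as. - (- ((a * cnj b) ^ k) / of_nat k)) =
        (\<Sum>a\<leftarrow>as. \<Sum>b\<leftarrow>as. a ^ k * (cnj (b ^ k) / of_nat k))"
      by (simp add: power_mult_distrib)
    also have "\<dots> = psum as k * (cnj (psum as k) / of_nat k)"
      unfolding psum_def sum_list_cnj
      by (simp add: sum_list_const_mult sum_list_mult_const o_def divide_inverse)
    also have "\<dots> = complex_of_real ((cmod (psum as k))\<^sup>2 / real k)"
      by (simp add: complex_norm_square del: of_real_power)
    finally show ?thesis .
  qed
  ultimately have sums: "(\<lambda>k. complex_of_real ((cmod (psum as k))\<^sup>2 / real k)) sums S"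
    by simp
  then have "(\<lambda>k. (cmod (psum as k))\<^sup>2 / real k) sums Re S"
    using sums_Re by fastforce
  then show s: "(\<lambda>k. (cmod (psum as k))\<^sup>2 / real k) sums energy as"
    unfolding energy_def by (simp add: sums_iff)
  have "S = of_real (energy as)"
    using sums sums_of_real[OF s] sums_unique2 by blast
  then have "exp (- S) = of_real (exp (- energy as))"
    by (simp flip: exp_of_real)
  moreover have "- S = (\<Sum>a\<leftarrow>as. \<Sum>b\<leftarrow>as. ln (1 - a * cnj b))"
    unfolding S_def by (simp add: uminus_sum_list_map o_def)
  moreover have "1 - a * cnj b \<noteq> 0" if "a \<in> set as" "b \<in> set as" for a b
    using ab[OF that] by auto
  ultimately show "(\<Prod>a\<leftarrow>as. \<Prod>b\<leftarrow>as. 1 - a * cnj b) = of_real (exp (- energy as))"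
    by (simp add: exp_sum_list cong: prod_list_map_cong)
qed

text \<open>The reversed polynomial is monic because p(0) = 1, so it splits into factors z - r, and
  reversing back turns each into 1 - r z. Zeros are appended to reach length n.\<close>

lemma exists_rpoly:
  assumes "poly p 0 = 1" "degree p \<le> n"
  shows "\<exists>as. length as = n \<and> p = rpoly as"
proof -
  define q where "q = reflect_poly p"
  have c0: "coeff p 0 = 1"
    using assms(1) by (simp add: poly_0_coeff_0)
  obtain rt :: "nat \<Rightarrow> complex" where rt: "smult (lead_coeff q) (\<Prod>i<degree q. [:- rt i, 1:]) = q"
    using complex_poly_decompose'[of q] by auto
  have refl: "reflect_poly q = p"
    using c0 by (simp add: q_def)
  then have "lead_coeff q = 1"
    using c0 by (metis coeff_0_reflect_poly)
  then have "reflect_poly q = reflect_poly (\<Prod>i<degree q. [:- rt i, 1:])"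
    using rt by simp
  also have "\<dots> = (\<Prod>i<degree q. reflect_poly [:- rt i, 1:])"
    by (rule reflect_poly_prod)
  also have "\<dots> = (\<Prod>i<degree q. [:1, - rt i:])"
    by (intro prod.cong) (auto simp: reflect_poly_def)
  also have "\<dots> = rpoly (map rt [0..<degree q])"
    unfolding rpoly_def by (simp add: prod.list_conv_set_nth atLeast0LessThan)
  also note refl
  finally have "p = rpoly (map rt [0..<degree q])" .
  moreover have pad: "rpoly (as @ replicate k 0) = rpoly as" for as k
    by (induction k) (auto simp: rpoly_def)
  moreover have "degree q \<le> n"
    using assms(2) degree_reflect_poly_le[of p] by (simp add: q_def)
  ultimately show ?thesis
    by (intro exI[of _ "map rt [0..<degree q] @ replicate (n - degree q) 0"]) simp
qed

lemma rdet_zeros: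
  assumes w: "weight w" and as: "is_dual w (length as) (rpoly as)"
  shows "\<forall>a\<in>set as. cmod a < 1"
    and "rdet w (length as) = wnorm w (rpoly as) ^ length as * exp (energy as)"
proof -
  have "(\<forall>a\<in>set as. cmod a < 1) \<and> tdet w (length as) * (\<Prod>a\<leftarrow>as. \<Prod>b\<leftarrow>as. 1 - a * cnj b) =
      of_real (wnorm w (rpoly as)) ^ length as"
    by (rule toeplitz_det_zeros[OF w]) (use as in \<open>simp add: is_dual_def\<close>)
  then have small: "\<forall>a\<in>set as. cmod a < 1"
    and det: "tdet w (length as) * (\<Prod>a\<leftarrow>as. \<Prod>b\<leftarrow>as. 1 - a * cnj b) =
      of_real (wnorm w (rpoly as)) ^ length as"
    by blast+
  have "complex_of_real (rdet w (length as) * exp (- energy as)) = of_real (wnorm w (rpoly as) ^ length as)"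
    using det energy_sums(2)[of as] small by (simp add: tdet_eq_rdet[OF w])
  then have "rdet w (length as) * exp (- energy as) = wnorm w (rpoly as) ^ length as"
    using of_real_eq_iff by blast
  then show "rdet w (length as) = wnorm w (rpoly as) ^ length as * exp (energy as)"
    by (simp add: exp_minus field_simps)
  show "\<forall>a\<in>set as. cmod a < 1"
    by (rule small)
qed

lemma Re_one_minus_pos:
  assumes "cmod a < 1" "cmod z = 1"
  shows "Re (1 - a * z) > 0"
  using assms complex_Re_le_cmod[of "a * z"] by (simp add: norm_mult)

text \<open>The Taylor coefficients of ln (1 - a z) are - a^m / m. For m = 0 the right side is 0 by
  division by 0, which is the correct constant term ln 1.\<close>

lemma integral_Ln_one_minus:
  assumes a: "cmod a < 1"
  shows "(\<integral>z. cnj z ^ m * ln (1 - a * z) \<partial>circle_measure) = - (a ^ m) / of_nat m"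
    and "(\<integral>z. z ^ m * ln (1 - a * z) \<partial>circle_measure) = 0"
proof -
  have summ: "summable (\<lambda>k. norm (- (a ^ k) / of_nat k))"
  proof (rule summable_comparison_test')
    show "summable (\<lambda>k. cmod a ^ k)"
      using a by (simp add: summable_geometric)
    show "norm (norm (- (a ^ k) / of_nat k)) \<le> cmod a ^ k" if "k \<ge> 1" for k
      using that by (simp add: norm_divide norm_power divide_le_eq mult_le_cancel_left1)
  qed
  have s: "(\<lambda>k. - (a ^ k) / of_nat k * z ^ k) sums ln (1 - a * z)" if "norm z = 1" for z
    using Ln_one_minus_sums[of "a * z"] a that by (simp add: norm_mult power_mult_distrib)
  show "(\<integral>z. cnj z ^ m * ln (1 - a * z) \<partial>circle_measure) = - (a ^ m) / of_nat m"
    by (rule integral_power_series_coeff[OF summ s])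
  then show "(\<integral>z. z ^ m * ln (1 - a * z) \<partial>circle_measure) = 0"
    using integral_power_series_vanish[OF summ s, of m] by (cases "m = 0") auto
qed

section \<open>The logarithm of |P|^2 and its Fourier coefficients\<close>

definition log_rpoly :: "complex list \<Rightarrow> complex \<Rightarrow> real" where
  "log_rpoly as z = ln ((cmod (poly (rpoly as) z))\<^sup>2)"

lemma poly_rpoly_nonzero:
  assumes "\<And>a. a \<in> set as \<Longrightarrow> cmod a < 1" "cmod z \<le> 1"
  shows "poly (rpoly as) z \<noteq> 0"
proof -
  have "1 - a * z \<noteq> 0" if "a \<in> set as" for a
  proof
    assume "1 - a * z = 0"
    then have "cmod a * cmod z = 1"
      by (metis eq_iff_diff_eq_0 norm_mult norm_one)
    moreover have "cmod a * cmod z \<le> cmod a * 1"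
      using assms(2) by (intro mult_left_mono) auto
    ultimately show False
      using assms(1)[OF that] by simp
  qed
  then show ?thesis
    by (auto simp: poly_rpoly prod_list_zero_iff)
qed

lemma log_rpoly_eq:
  assumes "\<And>a. a \<in> set as \<Longrightarrow> cmod a < 1" "cmod z = 1"
  shows "log_rpoly as z = (\<Sum>a\<leftarrow>as. 2 * Re (ln (1 - a * z)))"
  using assms
proof (induction as)
  case (Cons a as)
  have "Re (1 - a * z) > 0"
    by (rule Re_one_minus_pos) (use Cons.prems in auto)
  then have 1: "1 - a * z \<noteq> 0"
    by (metis less_irrefl zero_complex.sel(1))
  have 2: "poly (rpoly as) z \<noteq> 0"
    using Cons.prems by (intro poly_rpoly_nonzero) auto
  have "log_rpoly (a # as) z = ln ((cmod (1 - a * z))\<^sup>2 * (cmod (poly (rpoly as) z))\<^sup>2)"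
    by (simp add: log_rpoly_def poly_rpoly norm_mult power_mult_distrib)
  also have "\<dots> = 2 * ln (cmod (1 - a * z)) + log_rpoly as z"
    using 1 2 by (simp add: ln_mult ln_realpow log_rpoly_def)
  also have "ln (cmod (1 - a * z)) = Re (ln (1 - a * z))"
    using 1 by simp
  finally show ?case
    using Cons by simp
qed (simp add: log_rpoly_def)

lemma continuous_on_Ln_one_minus:
  assumes "cmod a < 1"
  shows "continuous_on (sphere 0 1) (\<lambda>z. ln (1 - a * z))"
proof (intro continuous_on_Ln continuous_intros)
  fix z assume "z \<in> (sphere 0 1 :: complex set)"
  then have "Re (1 - a * z) > 0"
    using Re_one_minus_pos[OF assms] by simp
  then show "1 - a * z \<notin> \<real>\<^sub>\<le>\<^sub>0"
    using complex_nonpos_Reals_iff by force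
qed

lemma log_rpoly_integrable:
  assumes "\<And>a. a \<in> set as \<Longrightarrow> cmod a < 1"
  shows "integrable circle_measure (log_rpoly as)"
proof (rule circle_integrable_continuous)
  have "continuous_on (sphere 0 1) (\<lambda>z. \<Sum>a\<leftarrow>as. 2 * Re (ln (1 - a * z)))"
    using assms
  proof (induction as)
    case (Cons a as)
    then show ?case
      using continuous_on_Re[OF continuous_on_Ln_one_minus[of a]]
      by (auto intro!: continuous_on_add continuous_on_mult_left)
  qed simp
  then show "continuous_on (sphere 0 1) (log_rpoly as)"
    by (rule continuous_on_eq) (use assms in \<open>simp add: log_rpoly_eq\<close>)
qed

text \<open>Each factor contributes 2 Re l = l + cnj l with l = ln (1 - a z). The conjugate half has
  only negative frequencies, its constant term being 0.\<close>

lemma integral_log_rpoly: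
  assumes "\<And>a. a \<in> set as \<Longrightarrow> cmod a < 1"
  shows "(\<integral>z. cnj z ^ m * of_real (log_rpoly as z) \<partial>circle_measure) = - psum as m / of_nat m"
proof -
  have one: "integrable circle_measure (\<lambda>z. cnj z ^ m * complex_of_real (2 * Re (ln (1 - a * z))))"
     "(\<integral>z. cnj z ^ m * complex_of_real (2 * Re (ln (1 - a * z))) \<partial>circle_measure) = - (a ^ m) / of_nat m"
    if a: "cmod a < 1" for a
  proof -
    define l where "l z = ln (1 - a * z)" for z
    have l: "continuous_on (sphere 0 1) l"
      unfolding l_def by (rule continuous_on_Ln_one_minus[OF a])
    have "integrable circle_measure (\<lambda>z. cnj z ^ m * complex_of_real (2 * Re (l z)))"
      using l by (intro circle_integrable_continuous continuous_intros)
    then show "integrable circle_measure (\<lambda>z. cnj z ^ m * complex_of_real (2 * Re (ln (1 - a * z))))"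
      by (simp only: l_def)
    have i1: "integrable circle_measure (\<lambda>z. cnj z ^ m * l z)"
      and i2: "integrable circle_measure (\<lambda>z. cnj (z ^ m * l z))"
      using l by (intro circle_integrable_continuous continuous_intros; simp)+
    have "(\<integral>z. cnj z ^ m * complex_of_real (2 * Re (l z)) \<partial>circle_measure) =
        (\<integral>z. cnj z ^ m * l z + cnj (z ^ m * l z) \<partial>circle_measure)"
      unfolding complex_add_cnj[symmetric] by (simp add: distrib_left)
    also have "\<dots> = (\<integral>z. cnj z ^ m * l z \<partial>circle_measure) + cnj (\<integral>z. z ^ m * l z \<partial>circle_measure)"
      unfolding Bochner_Integration.integral_add[OF i1 i2] Bochner_Integration.integral_cnj ..
    also have "\<dots> = - (a ^ m) / of_nat m"
      unfolding l_def integral_Ln_one_minus[OF a] by simp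
    finally show "(\<integral>z. cnj z ^ m * complex_of_real (2 * Re (ln (1 - a * z))) \<partial>circle_measure) = - (a ^ m) / of_nat m"
      by (simp only: l_def)
  qed
  have "integrable circle_measure (\<lambda>z. cnj z ^ m * of_real (\<Sum>a\<leftarrow>as. 2 * Re (ln (1 - a * z)))) \<and>
      (\<integral>z. cnj z ^ m * of_real (\<Sum>a\<leftarrow>as. 2 * Re (ln (1 - a * z))) \<partial>circle_measure) = - psum as m / of_nat m"
    using assms
  proof (induction as)
    case (Cons a as)
    have IH: "integrable circle_measure (\<lambda>z. cnj z ^ m * of_real (\<Sum>a\<leftarrow>as. 2 * Re (ln (1 - a * z))))"
      "(\<integral>z. cnj z ^ m * of_real (\<Sum>a\<leftarrow>as. 2 * Re (ln (1 - a * z))) \<partial>circle_measure) = - psum as m / of_nat m"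
      using Cons by auto
    have a: "cmod a < 1"
      using Cons.prems by simp
    have eq: "cnj z ^ m * complex_of_real (\<Sum>a\<leftarrow>a # as. 2 * Re (ln (1 - a * z))) =
        cnj z ^ m * complex_of_real (2 * Re (ln (1 - a * z))) +
        cnj z ^ m * complex_of_real (\<Sum>a\<leftarrow>as. 2 * Re (ln (1 - a * z)))" for z
      by (simp add: distrib_left)
    have "- (a ^ m) / of_nat m + - psum as m / of_nat m = - psum (a # as) m / of_nat m"
      by (simp add: psum_def add_divide_distrib diff_divide_distrib)
    then show ?case
      unfolding eq using one[OF a] IH
      by (subst Bochner_Integration.integral_add) (auto simp del: of_real_mult)
  qed (simp add: psum_def)
  moreover have "(\<integral>z. cnj z ^ m * of_real (log_rpoly as z) \<partial>circle_measure) =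
      (\<integral>z. cnj z ^ m * of_real (\<Sum>a\<leftarrow>as. 2 * Re (ln (1 - a * z))) \<partial>circle_measure)"
    by (rule Bochner_Integration.integral_cong) (use assms in \<open>simp_all add: log_rpoly_eq\<close>)
  ultimately show ?thesis by simp
qed

lemma integral_log_rpoly_0:
  assumes "\<And>a. a \<in> set as \<Longrightarrow> cmod a < 1"
  shows "(\<integral>z. log_rpoly as z \<partial>circle_measure) = 0"
  using integral_log_rpoly[of as 0, OF assms] by simp

text \<open>On the circle \<open>cnj z ^ m\<close> is z to the power -m. For real f the coefficients
  of negative index are the conjugates of these, so natural indices suffice.\<close>

definition fcoef :: "(complex \<Rightarrow> real) \<Rightarrow> nat \<Rightarrow> complex" where
  "fcoef f m = (\<integral>z. cnj z ^ m * of_real (f z) \<partial>circle_measure)"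

text \<open>Mean zero is a normalization: subtracting the mean of L scales the weight by a constant,
  and the resulting power of that constant is the exponential factor in the theorem.\<close>

locale log_weight =
  fixes L :: "complex \<Rightarrow> real"
  assumes L_integrable: "integrable circle_measure L"
    and exp_L_integrable: "integrable circle_measure (\<lambda>z. exp (L z))"
    and integral_L: "(\<integral>z. L z \<partial>circle_measure) = 0"
begin

lemma weight_exp: "weight (\<lambda>z. exp (L z))"
  using exp_L_integrable by (simp add: weight_def)

lemma exp_log_rpoly:
  assumes "\<And>a. a \<in> set as \<Longrightarrow> cmod a < 1" "cmod z = 1"
  shows "exp (log_rpoly as z + L z) = (cmod (poly (rpoly as) z))\<^sup>2 * exp (L z)"
  using poly_rpoly_nonzero[OF assms(1), of as z] assms(2) by (simp add: log_rpoly_def exp_add)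

lemma integral_exp_log_rpoly:
  assumes "\<And>a. a \<in> set as \<Longrightarrow> cmod a < 1"
  shows "integrable circle_measure (\<lambda>z. exp (log_rpoly as z + L z))"
    and "(\<integral>z. exp (log_rpoly as z + L z) \<partial>circle_measure) = wnorm (\<lambda>z. exp (L z)) (rpoly as)"
proof -
  show "(\<integral>z. exp (log_rpoly as z + L z) \<partial>circle_measure) = wnorm (\<lambda>z. exp (L z)) (rpoly as)"
    unfolding wnorm_def by (intro Bochner_Integration.integral_cong) (use exp_log_rpoly assms in auto)
  show "integrable circle_measure (\<lambda>z. exp (log_rpoly as z + L z))"
    using wnorm_integrable[OF weight_exp, of "rpoly as"] exp_log_rpoly[of as] assms
    by (subst Bochner_Integration.integrable_cong[OF refl]) auto
qed

text \<open>Since \<open>u = log \<bar>P\<bar>\<^sup>2 + L\<close> has mean zero, \<open>\<integral> exp u - 1\<close> is the integral of the nonnegative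
  function \<open>exp u - 1 - u\<close>, which controls the \<open>L\<^sup>1\<close> norm of \<open>u\<close>.\<close>

lemma log_rpoly_L1:
  assumes as: "\<And>a. a \<in> set as \<Longrightarrow> cmod a < 1" and d: "d > 0"
  shows "(\<integral>z. \<bar>log_rpoly as z + L z\<bar> \<partial>circle_measure) \<le> 2 * d + (wnorm (\<lambda>z. exp (L z)) (rpoly as) - 1) / d"
proof -
  let ?u = "\<lambda>z. log_rpoly as z + L z"
  have u: "integrable circle_measure ?u"
    using log_rpoly_integrable[of as, OF as] L_integrable by auto
  have u0: "(\<integral>z. ?u z \<partial>circle_measure) = 0"
    using log_rpoly_integrable[of as, OF as] L_integrable integral_log_rpoly_0[of as, OF as] integral_L by simp
  note eu = integral_exp_log_rpoly[of as, OF as]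
  \<comment> \<open>For x >= 0 this combines x^2 / 2 <= exp x - 1 - x with 2 x <= 2 d + x^2 / (2 d);
    for x < 0 the final - x already equals |x|. That linear term integrates to 0, and d stays free
    to be balanced against the excess of the norm over 1.\<close>
  have pt: "\<bar>x\<bar> \<le> 2 * d + (exp x - 1 - x) / d - x" for x :: real
  proof (cases "x \<ge> 0")
    case True
    have "x\<^sup>2 / 2 \<le> exp x - 1 - x"
      using exp_lower_Taylor_quadratic[OF True] by simp
    then have "(x\<^sup>2 / 2) / d \<le> (exp x - 1 - x) / d"
      using d by (intro divide_right_mono) auto
    moreover have "2 * x \<le> 2 * d + (x\<^sup>2 / 2) / d"
    proof -
      have "0 \<le> (x - 2 * d)\<^sup>2 / (2 * d)"
        using d by simp
      also have "\<dots> = (x\<^sup>2 / 2) / d - 2 * x + 2 * d"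
        using d by (simp add: field_simps power2_eq_square)
      finally show ?thesis by simp
    qed
    ultimately show ?thesis using True by simp
  next
    case False
    have "0 \<le> (exp x - 1 - x) / d"
      using d exp_ge_add_one_self[of x] by (intro divide_nonneg_pos) linarith+
    then show ?thesis using False d by simp
  qed
  have "(\<integral>z. \<bar>?u z\<bar> \<partial>circle_measure) \<le> (\<integral>z. 2 * d + (exp (?u z) - 1 - ?u z) / d - ?u z \<partial>circle_measure)"
    using u eu(1) pt by (intro integral_mono) auto
  also have "\<dots> = 2 * d + (wnorm (\<lambda>z. exp (L z)) (rpoly as) - 1 - 0) / d - 0"
    using u eu u0 by simp
  finally show ?thesis by simp
qed

text \<open>Jensen's inequality in the elementary form exp u >= 1 + u, with u of mean zero.\<close>

lemma wnorm_rpoly_ge_1: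
  assumes as: "\<And>a. a \<in> set as \<Longrightarrow> cmod a < 1"
  shows "wnorm (\<lambda>z. exp (L z)) (rpoly as) \<ge> 1"
proof -
  note eu = integral_exp_log_rpoly[of as, OF as]
  have "(\<integral>z. 1 + (log_rpoly as z + L z) \<partial>circle_measure) \<le> (\<integral>z. exp (log_rpoly as z + L z) \<partial>circle_measure)"
    using eu(1) log_rpoly_integrable[of as, OF as] L_integrable exp_ge_add_one_self
    by (intro integral_mono) auto
  then show ?thesis
    using eu(2) log_rpoly_integrable[of as, OF as] L_integrable integral_log_rpoly_0[of as, OF as] integral_L by simp
qed

lemma wnorm_dual_ge_1:
  assumes "is_dual (\<lambda>z. exp (L z)) n p"
  shows "wnorm (\<lambda>z. exp (L z)) p \<ge> 1"
proof -
  obtain as where as: "length as = n" "p = rpoly as"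
    using exists_rpoly[of p n] assms by (auto simp: is_dual_def)
  with assms have "\<forall>a\<in>set as. cmod a < 1"
    by (intro rdet_zeros[OF weight_exp]) simp
  then show ?thesis
    using wnorm_rpoly_ge_1[of as] as by auto
qed

lemma incseq_rdet: "incseq (rdet (\<lambda>z. exp (L z)))"
proof (rule incseq_SucI)
  fix n
  show "rdet (\<lambda>z. exp (L z)) n \<le> rdet (\<lambda>z. exp (L z)) (Suc n)"
    using rdet_Suc[OF weight_exp is_dual_dual_poly[OF weight_exp], of n]
      wnorm_dual_ge_1[OF is_dual_dual_poly[OF weight_exp], of n] rdet_pos[OF weight_exp, of n]
    by (simp add: mult_le_cancel_right1)
qed

text \<open>The difference is, up to sign, a Fourier coefficient of u = log |P|^2 + L, hence at most
  the L^1 norm of u.\<close>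

lemma psum_close:
  assumes as: "\<And>a. a \<in> set as \<Longrightarrow> cmod a < 1" and d: "d > 0"
  shows "cmod (psum as m / of_nat m - fcoef L m) \<le> 2 * d + (wnorm (\<lambda>z. exp (L z)) (rpoly as) - 1) / d"
proof -
  have i1: "integrable circle_measure (\<lambda>z. cnj z ^ m * complex_of_real (log_rpoly as z))"
    and i2: "integrable circle_measure (\<lambda>z. cnj z ^ m * complex_of_real (L z))"
    using log_rpoly_integrable[of as, OF as] L_integrable
    by (intro circle_integrable_continuous_mult continuous_intros; simp)+
  have "cmod (psum as m / of_nat m - fcoef L m) = cmod (- psum as m / of_nat m + fcoef L m)"
    by (metis (no_types, lifting) add.commute minus_divide_left norm_minus_commute uminus_add_conv_diff)
  also have "- psum as m / of_nat m + fcoef L m = (\<integral>z. cnj z ^ m * of_real (log_rpoly as z + L z) \<partial>circle_measure)"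
    using Bochner_Integration.integral_add[OF i1 i2] integral_log_rpoly[of as m, OF as]
    by (simp add: fcoef_def distrib_left)
  also have "cmod \<dots> \<le> (\<integral>z. norm (cnj z ^ m * complex_of_real (log_rpoly as z + L z)) \<partial>circle_measure)"
    by (rule integral_norm_bound)
  also have "\<dots> = (\<integral>z. \<bar>log_rpoly as z + L z\<bar> \<partial>circle_measure)"
    by (intro Bochner_Integration.integral_cong) (auto simp: norm_mult norm_power simp del: of_real_add)
  finally show ?thesis
    using log_rpoly_L1[of as, OF as d] by simp
qed

text \<open>A Fatou-type argument: the sum up to K involves finitely many power sums, each
  convergent. The later terms of the energy are nonnegative and the power of the norm is at least 1,
  so both can be discarded.\<close>

lemma rdet_lower_bound:
  assumes szego: "(\<lambda>n. wnorm (\<lambda>z. exp (L z)) (dual_poly (\<lambda>z. exp (L z)) n)) \<longlonglongrightarrow> 1"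
    and c: "c < exp (\<Sum>k\<le>K. real k * (cmod (fcoef L k))\<^sup>2)"
  shows "eventually (\<lambda>n. rdet (\<lambda>z. exp (L z)) n > c) sequentially"
proof -
  let ?w = "\<lambda>z. exp (L z)"
  have "\<exists>as. length as = n \<and> dual_poly ?w n = rpoly as" for n
    using exists_rpoly[of "dual_poly ?w n" n] is_dual_dual_poly[OF weight_exp, of n]
    by (auto simp: is_dual_def)
  then obtain Z where Z: "\<And>n. length (Z n) = n" "\<And>n. dual_poly ?w n = rpoly (Z n)"
    by metis
  have dual: "is_dual ?w (length (Z n)) (rpoly (Z n))" for n
    using is_dual_dual_poly[OF weight_exp, of n] by (simp add: Z)
  have small: "cmod a < 1" if "a \<in> set (Z n)" for a n
    using rdet_zeros(1)[OF weight_exp dual] that by blast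
  have lim: "(\<lambda>n. psum (Z n) m / of_nat m) \<longlonglongrightarrow> fcoef L m" for m
  proof (rule LIMSEQ_I)
    fix r :: real assume r: "r > 0"
    \<comment> \<open>With d = r / 8, an excess of the norm below d^2 bounds the distance by 2 d + d
      = 3 r / 8.\<close>
    have "eventually (\<lambda>n. wnorm ?w (rpoly (Z n)) < 1 + (r / 8)\<^sup>2) sequentially"
      using order_tendstoD(2)[OF szego, of "1 + (r / 8)\<^sup>2"] r by (simp add: Z)
    then obtain N where N: "\<And>n. n \<ge> N \<Longrightarrow> wnorm ?w (rpoly (Z n)) < 1 + (r / 8)\<^sup>2"
      by (auto simp: eventually_sequentially)
    have "cmod (psum (Z n) m / of_nat m - fcoef L m) < r" if "n \<ge> N" for n
    proof -
      have "cmod (psum (Z n) m / of_nat m - fcoef L m) \<le> 2 * (r / 8) + (wnorm ?w (rpoly (Z n)) - 1) / (r / 8)"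
        by (rule psum_close) (use small r in auto)
      also have "\<dots> \<le> 2 * (r / 8) + (r / 8)\<^sup>2 / (r / 8)"
        using N[OF that] r by (intro add_left_mono divide_right_mono) auto
      also have "\<dots> < r"
        using r by (simp add: power2_eq_square)
      finally show ?thesis .
    qed
    then show "\<exists>N. \<forall>n\<ge>N. cmod (psum (Z n) m / of_nat m - fcoef L m) < r"
      by blast
  qed
  have "(\<lambda>n. exp (\<Sum>k\<le>K. real k * (cmod (psum (Z n) k / of_nat k))\<^sup>2)) \<longlonglongrightarrow> exp (\<Sum>k\<le>K. real k * (cmod (fcoef L k))\<^sup>2)"
    by (intro tendsto_intros lim)
  then have "eventually (\<lambda>n. exp (\<Sum>k\<le>K. real k * (cmod (psum (Z n) k / of_nat k))\<^sup>2) > c) sequentially"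
    using order_tendstoD(1) c by blast
  then show ?thesis
  proof eventually_elim
    fix n assume n: "c < exp (\<Sum>k\<le>K. real k * (cmod (psum (Z n) k / of_nat k))\<^sup>2)"
    have "(\<Sum>k\<le>K. real k * (cmod (psum (Z n) k / of_nat k))\<^sup>2) = (\<Sum>k\<le>K. (cmod (psum (Z n) k))\<^sup>2 / real k)"
      by (intro sum.cong) (auto simp: norm_divide power_divide power2_eq_square)
    also have "\<dots> \<le> energy (Z n)"
      unfolding energy_def using energy_sums(1)[of "Z n"] small
      by (intro sum_le_suminf) (auto simp: sums_iff)
    finally have "exp (\<Sum>k\<le>K. real k * (cmod (psum (Z n) k / of_nat k))\<^sup>2) \<le> 1 * exp (energy (Z n))"
      by simp
    also have "\<dots> \<le> wnorm ?w (rpoly (Z n)) ^ n * exp (energy (Z n))"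
      using wnorm_rpoly_ge_1[of "Z n"] small by (intro mult_right_mono one_le_power) auto
    also have "\<dots> = rdet ?w n"
      using rdet_zeros(2)[OF weight_exp dual, of n] by (simp add: Z)
    finally show "c < rdet ?w n"
      using n by simp
  qed
qed

end

section \<open>Fejer means\<close>

lemma fcoef_integrable:
  assumes "integrable circle_measure f"
  shows "integrable circle_measure (\<lambda>z. cnj z ^ m * complex_of_real (f z))"
  by (intro circle_integrable_continuous_mult continuous_intros) (use assms in auto)

lemma fcoef_add:
  assumes "integrable circle_measure f" "integrable circle_measure g"
  shows "fcoef (\<lambda>z. f z + g z) m = fcoef f m + fcoef g m"
  using Bochner_Integration.integral_add[OF fcoef_integrable[OF assms(1), of m] fcoef_integrable[OF assms(2), of m]]
  by (simp add: fcoef_def distrib_left)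

lemma fcoef_diff:
  assumes "integrable circle_measure f" "integrable circle_measure g"
  shows "fcoef (\<lambda>z. f z - g z) m = fcoef f m - fcoef g m"
  using Bochner_Integration.integral_diff[OF fcoef_integrable[OF assms(1), of m] fcoef_integrable[OF assms(2), of m]]
  by (simp add: fcoef_def right_diff_distrib)

lemma fcoef_mult: "fcoef (\<lambda>z. c * f z) m = of_real c * fcoef f m"
  unfolding fcoef_def by (subst integral_mult_right_zero[symmetric]) (simp add: mult_ac)

lemma fcoef_0: "fcoef f 0 = of_real (\<integral>z. f z \<partial>circle_measure)"
  by (simp add: fcoef_def)

lemma fcoef_cong_AE:
  assumes "integrable circle_measure f" "integrable circle_measure g" "AE z in circle_measure. f z = g z"
  shows "fcoef f m = fcoef g m"
  unfolding fcoef_def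
  using assms(3) fcoef_integrable[OF assms(1), of m] fcoef_integrable[OF assms(2), of m]
  by (intro integral_cong_AE) (auto elim!: eventually_mono)

text \<open>The analytic half of the Cesaro mean; the negative frequencies of a real f return
  through 2 Re in \<open>fejer\<close>. The constant term is left out because the exponents q used
  later must satisfy q(0) = 0.\<close>

definition fejer_poly :: "nat \<Rightarrow> (complex \<Rightarrow> real) \<Rightarrow> complex poly" where
  "fejer_poly K f = (\<Sum>m\<in>{1..K}. monom (of_real (1 - m / Suc K) * fcoef f m) m)"

definition fejer :: "nat \<Rightarrow> (complex \<Rightarrow> real) \<Rightarrow> complex \<Rightarrow> real" where
  "fejer K f z = (\<integral>z. f z \<partial>circle_measure) + 2 * Re (poly (fejer_poly K f) z)"

lemma poly_fejer_poly:
  "poly (fejer_poly K f) z = (\<Sum>m\<in>{1..K}. of_real (1 - m / Suc K) * z ^ m * fcoef f m)"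
  by (simp add: fejer_poly_def poly_sum poly_monom mult_ac)

lemma poly_fejer_poly_0: "poly (fejer_poly K f) 0 = 0"
  by (simp add: poly_fejer_poly power_0_left)

text \<open>Induction on K: the new power adds 1 + 2 Re (u + ... + u^(K+1)) to the square, raising
  every coefficient by one. The identity exhibits the Fejer kernel as nonnegative.\<close>

lemma fejer_kernel:
  assumes u: "cmod u = 1"
  shows "(cmod (\<Sum>j\<le>K. u ^ j))\<^sup>2 = Suc K + 2 * Re (\<Sum>m\<in>{1..K}. of_real (real (Suc K) - real m) * u ^ m)"
proof (induction K)
  case (Suc K)
  have cross: "cnj (\<Sum>j\<le>K. u ^ j) * u ^ Suc K = (\<Sum>m\<in>{1..Suc K}. u ^ m)"
  proof -
    have "cnj (\<Sum>j\<le>K. u ^ j) * u ^ Suc K = (\<Sum>j\<le>K. u ^ (Suc K - j))"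
      unfolding cnj_sum sum_distrib_right
    proof (rule sum.cong)
      fix j assume "j \<in> {..K}"
      then have "u ^ Suc K = u ^ j * u ^ (Suc K - j)"
        by (simp flip: power_add)
      then have "cnj (u ^ j) * u ^ Suc K = (cnj u * u) ^ j * u ^ (Suc K - j)"
        by (simp only: power_mult_distrib complex_cnj_power mult.assoc)
      then show "cnj (u ^ j) * u ^ Suc K = u ^ (Suc K - j)"
        using circle_cnj_mult[OF u] by simp
    qed simp
    also have "\<dots> = (\<Sum>m\<in>{1..Suc K}. u ^ m)"
      by (rule sum.reindex_bij_witness[where i="\<lambda>m. Suc K - m" and j="\<lambda>j. Suc K - j"]) auto
    finally show ?thesis .
  qed
  have sq: "(cmod (a + b))\<^sup>2 = (cmod a)\<^sup>2 + (cmod b)\<^sup>2 + 2 * Re (cnj a * b)" for a b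
    by (simp only: cmod_power2) (simp add: power2_eq_square algebra_simps)
  define A where "A = (\<Sum>j\<le>K. u ^ j)"
  define B where "B = (\<Sum>m\<in>{1..Suc K}. u ^ m)"
  have "(cmod (\<Sum>j\<le>Suc K. u ^ j))\<^sup>2 = (cmod (A + u ^ Suc K))\<^sup>2"
    by (simp add: A_def)
  also have "\<dots> = (cmod A)\<^sup>2 + 1 + 2 * Re B"
    unfolding sq cross[folded A_def B_def] by (simp add: norm_power norm_mult u)
  also have "\<dots> = Suc (Suc K) + 2 * Re ((\<Sum>m\<in>{1..K}. of_real (real (Suc K) - real m) * u ^ m) + B)"
    unfolding A_def Suc.IH by simp
  \<comment> \<open>The added term has coefficient Suc K - Suc K = 0, so the range can be extended
    to match that of B.\<close>
  also have "(\<Sum>m\<in>{1..K}. of_real (real (Suc K) - real m) * u ^ m) = (\<Sum>m\<in>{1..Suc K}. of_real (real (Suc K) - real m) * u ^ m)"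
    by simp
  also have "\<dots> + B = (\<Sum>m\<in>{1..Suc K}. of_real (real (Suc (Suc K)) - real m) * u ^ m)"
    unfolding B_def sum.distrib[symmetric] by (intro sum.cong) (auto simp: algebra_simps)
  finally show ?case .
qed (simp add: u)

text \<open>Convolution with a nonnegative kernel, the source of monotonicity and of the bounds by
  |f|.\<close>

lemma fejer_eq_kernel:
  assumes f: "integrable circle_measure f" and z: "cmod z = 1"
  shows "fejer K f z = (\<integral>y. (cmod (\<Sum>j\<le>K. (z * cnj y) ^ j))\<^sup>2 / Suc K * f y \<partial>circle_measure)"
proof -
  define h where "h y = (\<Sum>m\<in>{1..K}. of_real (1 - m / Suc K) * z ^ m * (cnj y ^ m * complex_of_real (f y)))" for y
  have h: "integrable circle_measure h"
    unfolding h_def using fcoef_integrable[OF f]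
    by (intro Bochner_Integration.integrable_sum integrable_mult_right)
  have "(\<integral>y. h y \<partial>circle_measure) = poly (fejer_poly K f) z"
    unfolding h_def poly_fejer_poly fcoef_def using fcoef_integrable[OF f]
    by (subst Bochner_Integration.integral_sum) (auto intro!: integrable_mult_right)
  then have "fejer K f z = (\<integral>y. f y + 2 * Re (h y) \<partial>circle_measure)"
    unfolding fejer_def using f h by simp
  also have "\<dots> = (\<integral>y. (cmod (\<Sum>j\<le>K. (z * cnj y) ^ j))\<^sup>2 / Suc K * f y \<partial>circle_measure)"
  proof (rule Bochner_Integration.integral_cong)
    fix y assume "y \<in> space circle_measure"
    then have "cmod (z * cnj y) = 1"
      using z by (simp add: norm_mult)
    note kernel = fejer_kernel[OF this, of K]
    have "h y = (\<Sum>m\<in>{1..K}. of_real (real (Suc K) - real m) * (z * cnj y) ^ m) * of_real (f y / Suc K)"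
      unfolding h_def sum_distrib_right
      by (intro sum.cong) (simp_all add: power_mult_distrib field_simps)
    then have "Re (h y) = Re (\<Sum>m\<in>{1..K}. of_real (real (Suc K) - real m) * (z * cnj y) ^ m) * (f y / Suc K)"
      by simp
    then show "f y + 2 * Re (h y) = (cmod (\<Sum>j\<le>K. (z * cnj y) ^ j))\<^sup>2 / Suc K * f y"
      unfolding kernel by (simp add: field_simps)
  qed simp
  finally show ?thesis .
qed

lemma fejer_kernel_integrable:
  assumes f: "integrable circle_measure f"
  shows "integrable circle_measure (\<lambda>y. (cmod (\<Sum>j\<le>K. (z * cnj y) ^ j))\<^sup>2 / Suc K * f y)"
  by (intro circle_integrable_continuous_mult continuous_intros) (use f in auto)

lemma abs_fejer_le:
  assumes f: "integrable circle_measure f" and z: "cmod z = 1"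
  shows "\<bar>fejer K f z\<bar> \<le> fejer K (\<lambda>z. \<bar>f z\<bar>) z"
proof -
  have "\<bar>fejer K f z\<bar> \<le> (\<integral>y. \<bar>(cmod (\<Sum>j\<le>K. (z * cnj y) ^ j))\<^sup>2 / Suc K * f y\<bar> \<partial>circle_measure)"
    unfolding fejer_eq_kernel[OF f z] by (rule integral_abs_bound)
  also have "\<dots> = fejer K (\<lambda>z. \<bar>f z\<bar>) z"
    unfolding fejer_eq_kernel[OF integrable_abs[OF f] z] by (simp add: abs_mult)
  finally show ?thesis .
qed

lemma fejer_const: "fejer K (\<lambda>_. c) z = c"
proof -
  have "fcoef (\<lambda>_. c) m = 0" if "m > 0" for m
    using integral_power_cnj[of 0 m] that by (simp add: fcoef_def)
  then show ?thesis
    by (simp add: fejer_def poly_fejer_poly)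
qed

lemma fejer_mono:
  assumes "integrable circle_measure f" "integrable circle_measure g"
    and "cmod z = 1" "\<And>z. cmod z = 1 \<Longrightarrow> f z \<le> g z"
  shows "fejer K f z \<le> fejer K g z"
  using assms unfolding fejer_eq_kernel[OF assms(1,3)] fejer_eq_kernel[OF assms(2,3)]
  by (intro integral_mono fejer_kernel_integrable mult_left_mono) auto

lemma abs_fejer_bounded:
  assumes "integrable circle_measure f" "cmod z = 1" "\<And>z. cmod z = 1 \<Longrightarrow> \<bar>f z\<bar> \<le> B"
  shows "\<bar>fejer K f z\<bar> \<le> B"
  using abs_fejer_le[OF assms(1,2), of K] fejer_mono[of "\<lambda>z. \<bar>f z\<bar>" "\<lambda>_. B" z K] assms
  by (simp add: fejer_const)

lemma fejer_integrable: "integrable circle_measure (fejer K f)"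
  unfolding fejer_def by (intro circle_integrable_continuous continuous_intros)

lemma integral_fejer: "(\<integral>z. fejer K f z \<partial>circle_measure) = (\<integral>z. f z \<partial>circle_measure)"
proof -
  have i: "integrable circle_measure (\<lambda>z. poly (fejer_poly K f) z)"
    by (intro circle_integrable_continuous continuous_intros)
  then have "(\<integral>z. Re (poly (fejer_poly K f) z) \<partial>circle_measure) = 0"
    using circle_integral_poly[of "fejer_poly K f"] poly_fejer_poly_0[of K f] by simp
  then show ?thesis
    using i by (simp add: fejer_def)
qed

lemma fejer_add:
  assumes "integrable circle_measure f" "integrable circle_measure g"
  shows "fejer K (\<lambda>z. f z + g z) z = fejer K f z + fejer K g z"
  using assms by (simp add: fejer_def poly_fejer_poly fcoef_add sum.distrib distrib_left)

lemma fejer_diff: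
  assumes "integrable circle_measure f" "integrable circle_measure g"
  shows "fejer K (\<lambda>z. f z - g z) z = fejer K f z - fejer K g z"
  using assms by (simp add: fejer_def poly_fejer_poly fcoef_diff sum_subtractf right_diff_distrib)

lemma fejer_mult: "fejer K (\<lambda>z. c * f z) z = c * fejer K f z"
proof -
  have "poly (fejer_poly K (\<lambda>z. c * f z)) z = of_real c * poly (fejer_poly K f) z"
    by (simp add: poly_fejer_poly fcoef_mult sum_distrib_left mult_ac)
  then show ?thesis
    by (simp add: fejer_def algebra_simps)
qed

text \<open>The pointwise bound by the Fejer mean of |f| is integrated, and Fejer means preserve
  integrals; no exchange of integrations is involved.\<close>

lemma integral_abs_fejer_le:
  assumes f: "integrable circle_measure f"
  shows "(\<integral>z. \<bar>fejer K f z\<bar> \<partial>circle_measure) \<le> (\<integral>z. \<bar>f z\<bar> \<partial>circle_measure)"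
proof -
  have "(\<integral>z. \<bar>fejer K f z\<bar> \<partial>circle_measure) \<le> (\<integral>z. fejer K (\<lambda>z. \<bar>f z\<bar>) z \<partial>circle_measure)"
    using abs_fejer_le[OF f] by (intro integral_mono integrable_abs fejer_integrable) auto
  then show ?thesis
    by (simp add: integral_fejer)
qed

section \<open>Convergence of Fejer means in L^1\<close>

definition fejer_conv :: "(complex \<Rightarrow> real) \<Rightarrow> bool" where
  "fejer_conv f \<longleftrightarrow> integrable circle_measure f \<and>
    (\<lambda>K. \<integral>z. \<bar>fejer K f z - f z\<bar> \<partial>circle_measure) \<longlonglongrightarrow> 0"

lemma fejer_conv_integrable: "fejer_conv f \<Longrightarrow> integrable circle_measure f"
  by (simp add: fejer_conv_def)

text \<open>The class is closed in L^1 by a three-term estimate: the Fejer means of f - g are no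
  larger in L^1 than f - g itself.\<close>

lemma fejer_convI:
  assumes f: "integrable circle_measure f"
    and approx: "\<And>e. e > 0 \<Longrightarrow> \<exists>g. fejer_conv g \<and> (\<integral>z. \<bar>f z - g z\<bar> \<partial>circle_measure) < e"
  shows "fejer_conv f"
  unfolding fejer_conv_def
proof (intro conjI f LIMSEQ_I)
  fix e :: real assume e: "e > 0"
  then obtain g where g: "fejer_conv g" "(\<integral>z. \<bar>f z - g z\<bar> \<partial>circle_measure) < e / 3"
    using approx[of "e / 3"] by auto
  note gi = fejer_conv_integrable[OF g(1)]
  have "eventually (\<lambda>K. (\<integral>z. \<bar>fejer K g z - g z\<bar> \<partial>circle_measure) < e / 3) sequentially"
    using g(1) e unfolding fejer_conv_def by (intro order_tendstoD) auto
  then obtain N where N: "\<And>K. K \<ge> N \<Longrightarrow> (\<integral>z. \<bar>fejer K g z - g z\<bar> \<partial>circle_measure) < e / 3"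
    by (auto simp: eventually_sequentially)
  have "norm ((\<integral>z. \<bar>fejer K f z - f z\<bar> \<partial>circle_measure) - 0) < e" if "K \<ge> N" for K
  proof -
    have "(\<integral>z. \<bar>fejer K f z - f z\<bar> \<partial>circle_measure) \<le>
        (\<integral>z. \<bar>fejer K (\<lambda>z. f z - g z) z\<bar> + \<bar>fejer K g z - g z\<bar> + \<bar>f z - g z\<bar> \<partial>circle_measure)"
      using f gi by (intro integral_mono) (auto simp: fejer_diff fejer_integrable)
    also have "\<dots> = (\<integral>z. \<bar>fejer K (\<lambda>z. f z - g z) z\<bar> \<partial>circle_measure) +
        (\<integral>z. \<bar>fejer K g z - g z\<bar> \<partial>circle_measure) + (\<integral>z. \<bar>f z - g z\<bar> \<partial>circle_measure)"
      using f gi by (simp add: fejer_integrable)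
    also have "\<dots> < e"
      using integral_abs_fejer_le[of "\<lambda>z. f z - g z" K] f gi g(2) N[OF that] by simp
    finally show ?thesis by simp
  qed
  then show "\<exists>N. \<forall>K\<ge>N. norm ((\<integral>z. \<bar>fejer K f z - f z\<bar> \<partial>circle_measure) - 0) < e"
    by blast
qed

lemma fejer_conv_limit:
  assumes f: "integrable circle_measure f" and s: "\<And>n. fejer_conv (s n)"
    and lim: "\<And>z. cmod z = 1 \<Longrightarrow> (\<lambda>n. s n z) \<longlonglongrightarrow> f z"
    and g: "integrable circle_measure g" "\<And>n z. cmod z = 1 \<Longrightarrow> \<bar>s n z\<bar> \<le> g z"
  shows "fejer_conv f"
proof (rule fejer_convI[OF f])
  fix e :: real assume e: "e > 0"
  have si: "integrable circle_measure (s n)" for n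
    by (rule fejer_conv_integrable[OF s])
  have "(\<lambda>n. \<integral>z. \<bar>f z - s n z\<bar> \<partial>circle_measure) \<longlonglongrightarrow> (\<integral>z. 0 \<partial>circle_measure)"
  proof (rule integral_dominated_convergence[where w="\<lambda>z. \<bar>f z\<bar> + g z"])
    show "AE z in circle_measure. (\<lambda>n. \<bar>f z - s n z\<bar>) \<longlonglongrightarrow> 0"
    proof (rule AE_I2)
      fix z assume "z \<in> space circle_measure"
      then have "(\<lambda>n. \<bar>f z - s n z\<bar>) \<longlonglongrightarrow> \<bar>f z - f z\<bar>"
        by (intro tendsto_intros lim) simp
      then show "(\<lambda>n. \<bar>f z - s n z\<bar>) \<longlonglongrightarrow> 0" by simp
    qed
    show "AE z in circle_measure. norm \<bar>f z - s n z\<bar> \<le> \<bar>f z\<bar> + g z" for n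
    proof (rule AE_I2)
      fix z assume "z \<in> space circle_measure"
      then show "norm \<bar>f z - s n z\<bar> \<le> \<bar>f z\<bar> + g z"
        using g(2)[of z n] by simp
    qed
  qed (use f g(1) si in auto)
  then have "eventually (\<lambda>n. (\<integral>z. \<bar>f z - s n z\<bar> \<partial>circle_measure) < e) sequentially"
    using e by (intro order_tendstoD(2)) auto
  then obtain n where "(\<integral>z. \<bar>f z - s n z\<bar> \<partial>circle_measure) < e"
    using eventually_happens'[OF sequentially_bot] by blast
  with s show "\<exists>g. fejer_conv g \<and> (\<integral>z. \<bar>f z - g z\<bar> \<partial>circle_measure) < e"
    by blast
qed

lemma fejer_conv_const: "fejer_conv (\<lambda>_. c)"
  by (simp add: fejer_conv_def fejer_const)

lemma fejer_conv_add:
  assumes f: "fejer_conv f" and g: "fejer_conv g"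
  shows "fejer_conv (\<lambda>z. f z + g z)"
proof -
  note fi = fejer_conv_integrable[OF f] and gi = fejer_conv_integrable[OF g]
  have lim: "(\<lambda>K. (\<integral>z. \<bar>fejer K f z - f z\<bar> \<partial>circle_measure) + (\<integral>z. \<bar>fejer K g z - g z\<bar> \<partial>circle_measure)) \<longlonglongrightarrow> 0"
    using f g unfolding fejer_conv_def by (intro tendsto_add_zero) auto
  have le: "(\<integral>z. \<bar>fejer K (\<lambda>z. f z + g z) z - (f z + g z)\<bar> \<partial>circle_measure) \<le>
      (\<integral>z. \<bar>fejer K f z - f z\<bar> \<partial>circle_measure) + (\<integral>z. \<bar>fejer K g z - g z\<bar> \<partial>circle_measure)" for K
  proof -
    have "(\<integral>z. \<bar>fejer K (\<lambda>z. f z + g z) z - (f z + g z)\<bar> \<partial>circle_measure) \<le>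
        (\<integral>z. \<bar>fejer K f z - f z\<bar> + \<bar>fejer K g z - g z\<bar> \<partial>circle_measure)"
      using fi gi by (intro integral_mono) (auto simp: fejer_add fejer_integrable)
    then show ?thesis
      using fi gi by (simp add: fejer_integrable)
  qed
  have "(\<lambda>K. \<integral>z. \<bar>fejer K (\<lambda>z. f z + g z) z - (f z + g z)\<bar> \<partial>circle_measure) \<longlonglongrightarrow> 0"
    by (rule real_tendsto_sandwich[OF always_eventually always_eventually tendsto_const lim]) (use le in auto)
  then show ?thesis
    using fi gi by (simp add: fejer_conv_def)
qed

lemma fejer_conv_mult:
  assumes f: "fejer_conv f"
  shows "fejer_conv (\<lambda>z. c * f z)"
proof -
  have "(\<lambda>K. \<bar>c\<bar> * (\<integral>z. \<bar>fejer K f z - f z\<bar> \<partial>circle_measure)) \<longlonglongrightarrow> 0"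
    using f unfolding fejer_conv_def by (intro tendsto_mult_right_zero) auto
  moreover have "(\<integral>z. \<bar>fejer K (\<lambda>z. c * f z) z - c * f z\<bar> \<partial>circle_measure) =
      \<bar>c\<bar> * (\<integral>z. \<bar>fejer K f z - f z\<bar> \<partial>circle_measure)" for K
    unfolding fejer_mult right_diff_distrib[symmetric] abs_mult by simp
  ultimately show ?thesis
    using fejer_conv_integrable[OF f] by (simp add: fejer_conv_def)
qed

lemma fejer_conv_sum:
  assumes "finite I" "\<And>i. i \<in> I \<Longrightarrow> fejer_conv (f i)"
  shows "fejer_conv (\<lambda>z. \<Sum>i\<in>I. f i z)"
  using assms by (induction I rule: finite_induct) (auto intro: fejer_conv_const fejer_conv_add)

lemma fejer_cong_AE:
  assumes "integrable circle_measure f" "integrable circle_measure g" "AE z in circle_measure. f z = g z"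
  shows "fejer K f z = fejer K g z"
proof -
  have "(\<integral>z. f z \<partial>circle_measure) = (\<integral>z. g z \<partial>circle_measure)"
    using assms by (intro integral_cong_AE) auto
  then show ?thesis
    by (simp add: fejer_def poly_fejer_poly fcoef_cong_AE[OF assms])
qed

lemma fejer_conv_cong_AE:
  assumes g: "fejer_conv g" and f: "integrable circle_measure f" and eq: "AE z in circle_measure. f z = g z"
  shows "fejer_conv f"
proof -
  have "(\<integral>z. \<bar>fejer K f z - f z\<bar> \<partial>circle_measure) = (\<integral>z. \<bar>fejer K g z - g z\<bar> \<partial>circle_measure)" for K
  proof (rule integral_cong_AE)
    show "AE z in circle_measure. \<bar>fejer K f z - f z\<bar> = \<bar>fejer K g z - g z\<bar>"
      using eq by (auto elim!: eventually_mono simp: fejer_cong_AE[OF f fejer_conv_integrable[OF g] eq])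
  qed (use borel_measurable_integrable[OF f] borel_measurable_integrable[OF fejer_conv_integrable[OF g]]
      borel_measurable_integrable[OF fejer_integrable] in auto)
  then show ?thesis
    using g f by (simp add: fejer_conv_def)
qed

text \<open>For m > 0 and K >= m the Fejer mean multiplies the function by 1 - m / (K + 1), so the
  L^1 error is m / (K + 1) times its norm. The coefficient is c / 2 because Re x = (x + cnj x) /
  2.\<close>

lemma fejer_conv_monomial:
  "fejer_conv (\<lambda>z. Re (c * z ^ m))"
proof (cases "m = 0")
  case True
  then show ?thesis by (simp add: fejer_conv_const)
next
  case False
  have int: "integrable circle_measure (\<lambda>z. Re (c * z ^ m))"
    by (intro circle_integrable_continuous continuous_intros)
  have coef: "fcoef (\<lambda>z. Re (c * z ^ m)) k = (if k = m then c / 2 else 0)" for k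
  proof -
    have i1: "integrable circle_measure (\<lambda>z. c / 2 * (z ^ m * cnj z ^ k))"
      and i2: "integrable circle_measure (\<lambda>z. cnj c / 2 * cnj (z ^ (m + k)))"
      by (intro circle_integrable_continuous continuous_intros; simp)+
    have "complex_of_real (Re x) = (x + cnj x) / 2" for x
      by (simp add: complex_add_cnj)
    then have "fcoef (\<lambda>z. Re (c * z ^ m)) k =
        (\<integral>z. c / 2 * (z ^ m * cnj z ^ k) + cnj c / 2 * cnj (z ^ (m + k)) \<partial>circle_measure)"
      unfolding fcoef_def by (simp only:) (simp add: field_simps power_add)
    also have "\<dots> = c / 2 * (\<integral>z. z ^ m * cnj z ^ k \<partial>circle_measure) +
        cnj c / 2 * cnj (\<integral>z. z ^ (m + k) \<partial>circle_measure)"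
      unfolding Bochner_Integration.integral_add[OF i1 i2] integral_mult_right_zero
        Bochner_Integration.integral_cnj ..
    also have "\<dots> = (if k = m then c / 2 else 0)"
      using False by (simp add: integral_power_cnj integral_power)
    finally show ?thesis .
  qed
  have int0: "(\<integral>z. Re (c * z ^ m) \<partial>circle_measure) = 0"
    using coef[of 0] False fcoef_0[of "\<lambda>z. Re (c * z ^ m)"] by simp
  have fej: "fejer K (\<lambda>z. Re (c * z ^ m)) z = (1 - m / Suc K) * Re (c * z ^ m)" if "K \<ge> m" for K z
  proof -
    have "poly (fejer_poly K (\<lambda>z. Re (c * z ^ m))) z =
        (\<Sum>k\<in>{1..K}. if k = m then of_real (1 - m / Suc K) * z ^ m * (c / 2) else 0)"
      unfolding poly_fejer_poly coef by (intro sum.cong) auto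
    also have "\<dots> = of_real (1 - m / Suc K) * z ^ m * (c / 2)"
      using that False by (subst sum.delta) auto
    also have "\<dots> = of_real ((1 - m / Suc K) / 2) * (c * z ^ m)"
      by simp
    finally show ?thesis
      unfolding fejer_def int0 by (simp only: Re_complex_of_real Im_complex_of_real times_complex.simps(1)) simp
  qed
  have "eventually (\<lambda>K. m / Suc K * (\<integral>z. \<bar>Re (c * z ^ m)\<bar> \<partial>circle_measure) =
      (\<integral>z. \<bar>fejer K (\<lambda>z. Re (c * z ^ m)) z - Re (c * z ^ m)\<bar> \<partial>circle_measure)) sequentially"
    using eventually_ge_at_top[of m]
  proof eventually_elim
    fix K assume K: "m \<le> K"
    have "\<bar>fejer K (\<lambda>z. Re (c * z ^ m)) z - Re (c * z ^ m)\<bar> = m / Suc K * \<bar>Re (c * z ^ m)\<bar>" for z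
    proof -
      have "fejer K (\<lambda>z. Re (c * z ^ m)) z - Re (c * z ^ m) = - (m / Suc K) * Re (c * z ^ m)"
        unfolding fej[OF K] left_diff_distrib by simp
      then show ?thesis
        by (simp only: abs_mult) simp
    qed
    then show "m / Suc K * (\<integral>z. \<bar>Re (c * z ^ m)\<bar> \<partial>circle_measure) =
      (\<integral>z. \<bar>fejer K (\<lambda>z. Re (c * z ^ m)) z - Re (c * z ^ m)\<bar> \<partial>circle_measure)"
      by simp
  qed
  moreover have "(\<lambda>K. m / Suc K * (\<integral>z. \<bar>Re (c * z ^ m)\<bar> \<partial>circle_measure)) \<longlonglongrightarrow> 0"
    by (intro tendsto_mult_left_zero LIMSEQ_Suc[OF lim_const_over_n])
  ultimately have "(\<lambda>K. \<integral>z. \<bar>fejer K (\<lambda>z. Re (c * z ^ m)) z - Re (c * z ^ m)\<bar> \<partial>circle_measure) \<longlonglongrightarrow> 0"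
    by (rule Lim_transform_eventually[rotated])
  then show ?thesis
    using int by (simp add: fejer_conv_def)
qed

lemma fejer_conv_trig_poly: "fejer_conv (\<lambda>z. Re (poly p z))"
proof -
  have "fejer_conv (\<lambda>z. \<Sum>i\<le>degree p. Re (coeff p i * z ^ i))"
    by (intro fejer_conv_sum fejer_conv_monomial) simp
  then show ?thesis
    by (simp only: poly_altdef Re_sum)
qed

section \<open>Trigonometric polynomials and continuous functions\<close>

definition trig_poly :: "(complex \<Rightarrow> real) \<Rightarrow> bool" where
  "trig_poly f \<longleftrightarrow> (\<exists>p. \<forall>z. cmod z = 1 \<longrightarrow> f z = Re (poly p z))"

lemma trig_polyI: "(\<And>z. cmod z = 1 \<Longrightarrow> f z = Re (poly p z)) \<Longrightarrow> trig_poly f"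
  by (auto simp: trig_poly_def)

lemma trig_poly_const: "trig_poly (\<lambda>_. c)"
  by (rule trig_polyI[of _ "[:of_real c:]"]) simp

lemma trig_poly_add:
  assumes "trig_poly f" "trig_poly g"
  shows "trig_poly (\<lambda>z. f z + g z)"
proof -
  obtain p q where "\<forall>z. cmod z = 1 \<longrightarrow> f z = Re (poly p z)" "\<forall>z. cmod z = 1 \<longrightarrow> g z = Re (poly q z)"
    using assms by (auto simp: trig_poly_def)
  then show ?thesis
    by (intro trig_polyI[of _ "p + q"]) simp
qed

lemma trig_poly_sum:
  "finite I \<Longrightarrow> (\<And>i. i \<in> I \<Longrightarrow> trig_poly (f i)) \<Longrightarrow> trig_poly (\<lambda>z. \<Sum>i\<in>I. f i z)"
  by (induction I rule: finite_induct) (auto intro: trig_poly_const trig_poly_add)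

text \<open>The product formula 2 Re x Re y = Re (x y + x cnj y) together with z cnj z = 1; the
  order j <= i keeps the exponent i - j natural.\<close>

lemma trig_poly_monomial_mult:
  assumes "j \<le> i"
  shows "trig_poly (\<lambda>z. Re (a * z ^ i) * Re (b * z ^ j))"
proof (rule trig_polyI)
  fix z :: complex assume z: "cmod z = 1"
  have "Re x * Re y = Re (x * y / 2 + x * cnj y / 2)" for x y
    by (simp add: field_simps)
  then have "Re (a * z ^ i) * Re (b * z ^ j) =
      Re ((a * z ^ i) * (b * z ^ j) / 2 + (a * z ^ i) * cnj (b * z ^ j) / 2)"
    by blast
  also have "(a * z ^ i) * cnj (b * z ^ j) = a * cnj b * z ^ (i - j) * (z * cnj z) ^ j"
  proof -
    have "z ^ i = z ^ (i - j) * z ^ j"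
      using assms by (simp flip: power_add)
    then show ?thesis
      by (simp add: power_mult_distrib)
  qed
  also have "(z * cnj z) ^ j = 1"
    using circle_mult_cnj[OF z] by simp
  finally show "Re (a * z ^ i) * Re (b * z ^ j) = Re (poly (monom (a * b / 2) (i + j) + monom (a * cnj b / 2) (i - j)) z)"
    by (simp add: poly_monom power_add mult_ac)
qed

lemma trig_poly_mult:
  assumes "trig_poly f" "trig_poly g"
  shows "trig_poly (\<lambda>z. f z * g z)"
proof -
  obtain p q where pq: "\<forall>z. cmod z = 1 \<longrightarrow> f z = Re (poly p z)" "\<forall>z. cmod z = 1 \<longrightarrow> g z = Re (poly q z)"
    using assms by (auto simp: trig_poly_def)
  have "trig_poly (\<lambda>z. \<Sum>i\<le>degree p. \<Sum>j\<le>degree q. Re (coeff p i * z ^ i) * Re (coeff q j * z ^ j))"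
  proof (intro trig_poly_sum finite_atMost)
    fix i j
    show "trig_poly (\<lambda>z. Re (coeff p i * z ^ i) * Re (coeff q j * z ^ j))"
    proof (cases "j \<le> i")
      case True
      then show ?thesis by (rule trig_poly_monomial_mult)
    next
      case False
      then have "trig_poly (\<lambda>z. Re (coeff q j * z ^ j) * Re (coeff p i * z ^ i))"
        by (intro trig_poly_monomial_mult) simp
      then show ?thesis
        by (subst mult.commute)
    qed
  qed
  moreover have "Re (poly p z) * Re (poly q z) = (\<Sum>i\<le>degree p. \<Sum>j\<le>degree q. Re (coeff p i * z ^ i) * Re (coeff q j * z ^ j))" for z
    by (simp only: poly_altdef Re_sum sum_product)
  ultimately show ?thesis
    using pq by (simp add: trig_poly_def)
qed

text \<open>Turns the approximants of the Stone-Weierstrass theorem, real polynomials in the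
  coordinates, into trigonometric polynomials. A real linear f is the real part of
  \<open>(f 1 - \<i> * f \<i>) * z\<close>.\<close>

lemma trig_poly_polynomial_function:
  fixes f :: "complex \<Rightarrow> real"
  assumes "real_polynomial_function f"
  shows "trig_poly f"
  using assms
proof (induction f rule: real_polynomial_function.induct)
  case (linear f)
  then interpret bounded_linear f .
  have "f z = Re (poly [:0, of_real (f 1) - \<i> * of_real (f \<i>):] z)" for z
  proof -
    have "f z = f (Re z *\<^sub>R 1 + Im z *\<^sub>R \<i>)"
      by (metis complex_eq mult.commute mult.right_neutral scaleR_conv_of_real)
    also have "\<dots> = Re z * f 1 + Im z * f \<i>"
      by (simp only: add scaleR) simp
    finally show ?thesis
      by (simp add: algebra_simps)
  qed
  then show ?case
    by (rule trig_polyI)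
qed (auto intro: trig_poly_const trig_poly_add trig_poly_mult)

lemma fejer_conv_continuous:
  assumes f: "continuous_on (sphere 0 1) f"
  shows "fejer_conv f"
proof (rule fejer_convI)
  show fi: "integrable circle_measure f"
    by (rule circle_integrable_continuous[OF f])
  fix e :: real assume e: "e > 0"
  obtain g where g: "real_polynomial_function g" "\<And>z. z \<in> sphere 0 1 \<Longrightarrow> \<bar>f z - g z\<bar> < e / 2"
    using Stone_Weierstrass_real_polynomial_function[OF compact_sphere f, of "e / 2"] e by auto
  then obtain p where p: "\<And>z. cmod z = 1 \<Longrightarrow> g z = Re (poly p z)"
    using trig_poly_polynomial_function[OF g(1)] by (auto simp: trig_poly_def)
  have pi: "integrable circle_measure (\<lambda>z. Re (poly p z))"
    by (rule fejer_conv_integrable[OF fejer_conv_trig_poly])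
  have "(\<integral>z. \<bar>f z - Re (poly p z)\<bar> \<partial>circle_measure) \<le> (\<integral>z. e / 2 \<partial>circle_measure)"
    using fi pi g(2) p by (intro integral_mono) (auto intro: less_imp_le)
  then have "(\<integral>z. \<bar>f z - Re (poly p z)\<bar> \<partial>circle_measure) < e"
    using e by simp
  with fejer_conv_trig_poly show "\<exists>g. fejer_conv g \<and> (\<integral>z. \<bar>f z - g z\<bar> \<partial>circle_measure) < e"
    by blast
qed

section \<open>From indicators to integrable functions\<close>

lemma circle_integrable_indicator:
  assumes "A \<in> sets borel"
  shows "integrable circle_measure (indicat_real A)"
proof (rule circle.integrable_const_bound[where B=1])
  show "indicat_real A \<in> borel_measurable circle_measure"
    using assms by (intro circle_measurable_borel measurable_restrict_space1) auto
qed (auto simp: indicator_def)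

lemma fejer_conv_indicator_closed:
  assumes C: "closed C"
  shows "fejer_conv (indicat_real C)"
\<comment> \<open>\<open>infdist\<close> to the empty set is 0 by convention, so the approximants
  below would be constantly 1 there; this case is split off.\<close>
proof (cases "C = {}")
  case True
  then have "indicat_real C = (\<lambda>_. 0)" by auto
  then show ?thesis using fejer_conv_const[of 0] by simp
next
  case False
  show ?thesis
  proof (rule fejer_conv_limit[where s="\<lambda>n z. max 0 (1 - real n * infdist z C)" and g="\<lambda>_. 1"])
    show "integrable circle_measure (indicat_real C)"
      using C by (intro circle_integrable_indicator) auto
    show "fejer_conv (\<lambda>z. max 0 (1 - real n * infdist z C))" for n
      by (intro fejer_conv_continuous continuous_intros)
    show "(\<lambda>n. max 0 (1 - real n * infdist z C)) \<longlonglongrightarrow> indicat_real C z" for z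
    proof (cases "z \<in> C")
      case True
      then show ?thesis by simp
    next
      case z: False
      then have d: "infdist z C > 0"
        using infdist_pos_not_in_closed[OF C False z] by simp
      have "eventually (\<lambda>n. real n \<ge> 1 / infdist z C) sequentially"
        by (rule eventually_mono[OF eventually_ge_at_top[of "nat \<lceil>1 / infdist z C\<rceil>"]]) (simp add: nat_ceiling_le_eq)
      then have "eventually (\<lambda>n. max 0 (1 - real n * infdist z C) = 0) sequentially"
        by eventually_elim (use d in \<open>auto simp: field_simps\<close>)
      then show ?thesis
        using z by (simp add: tendsto_eventually)
    qed
    show "\<bar>max 0 (1 - real n * infdist z C)\<bar> \<le> 1" for n z
      using infdist_nonneg[of z C] by (auto simp: max_def)
  qed simp
qed

text \<open>Dynkin's argument from the closed sets, which generate the Borel sets and are stable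
  under intersection; a countable disjoint union is a dominated limit of finite sums.\<close>

lemma fejer_conv_indicator:
  assumes A: "A \<in> sets borel"
  shows "fejer_conv (indicat_real A)"
proof -
  have "Int_stable (Collect closed :: complex set set)" "Collect closed \<subseteq> Pow (UNIV :: complex set)"
      "A \<in> sigma_sets UNIV (Collect closed)"
    using A by (auto simp: borel_eq_closed Int_stable_def)
  then show ?thesis
  proof (induction rule: sigma_sets_induct_disjoint)
    case (basic A)
    then show ?case by (simp add: fejer_conv_indicator_closed)
  next
    case empty
    have "indicat_real {} = (\<lambda>_::complex. 0)" by auto
    then show ?case using fejer_conv_const[of 0] by simp
  next
    case (compl A)
    have "indicat_real (UNIV - A) = (\<lambda>z. 1 + (-1) * indicat_real A z)"
      by (auto simp: indicator_def)
    then show ?case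
      using compl fejer_conv_add[OF fejer_conv_const[of 1] fejer_conv_mult[of "indicat_real A" "-1"]] by simp
  next
    case (union A)
    then have meas: "A i \<in> sets borel" for i
      by (auto simp: borel_eq_closed)
    show ?case
    proof (rule fejer_conv_limit[where s="\<lambda>n z. \<Sum>i<n. indicat_real (A i) z" and g="\<lambda>_. 1"])
      show "integrable circle_measure (indicat_real (\<Union>i. A i))"
        using meas by (intro circle_integrable_indicator) auto
      show "fejer_conv (\<lambda>z. \<Sum>i<n. indicat_real (A i) z)" for n
        using union by (intro fejer_conv_sum) auto
      have eq: "(\<Sum>i<n. indicat_real (A i) z) = indicat_real (\<Union>i<n. A i) z" for n z
        using union(1) by (subst indicator_UN_disjoint) (auto simp: disjoint_family_on_def)
      show "(\<lambda>n. \<Sum>i<n. indicat_real (A i) z) \<longlonglongrightarrow> indicat_real (\<Union>i. A i) z" for z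
        unfolding eq by (rule LIMSEQ_indicator_UN)
      show "\<bar>\<Sum>i<n. indicat_real (A i) z\<bar> \<le> 1" for n z
        unfolding eq by (simp add: indicator_def)
    qed simp
  qed
qed

theorem fejer_L1:
  assumes f: "integrable circle_measure f"
  shows "fejer_conv f"
proof -
  let ?D = "distr (uniform_measure lborel {0..<2 * pi}) (restrict_space borel (sphere 0 1)) cis"
  have "f \<in> borel_measurable (completion ?D)"
    using borel_measurable_integrable[OF f] by (simp add: circle_measure_def)
  \<comment> \<open>The circle measure is a completion, so f is replaced by a Borel function equal
    to it almost everywhere. Induction over integrable functions then runs on the uncompleted
    measure, where measurable sets are traces of Borel sets.\<close>
  then obtain g where g: "g \<in> borel_measurable ?D" "AE z in ?D. f z = g z"
    using completion_ex_borel_measurable_real by blast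
  have AE: "AE z in circle_measure. f z = g z"
    unfolding circle_measure_def by (rule AE_completion[OF g(2)])
  have gm: "g \<in> borel_measurable circle_measure"
    unfolding circle_measure_def by (rule measurable_completion[OF g(1)])
  have "integrable circle_measure g"
    by (rule integrable_cong_AE[THEN iffD1, OF borel_measurable_integrable[OF f] gm AE f])
  then have "integrable ?D g"
    using integrable_completion[OF g(1)] by (simp add: circle_measure_def)
  then have "fejer_conv g"
  proof (induction rule: integrable_induct)
    case (base A c)
    then obtain B where B: "B \<in> sets borel" "A = B \<inter> sphere 0 1"
      by (auto simp: sets_restrict_space)
    have "fejer_conv (\<lambda>z. c * indicat_real B z)"
      by (intro fejer_conv_mult fejer_conv_indicator B)
    moreover have "integrable circle_measure (\<lambda>z. indicat_real A z *\<^sub>R c)"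
      unfolding B(2) using B(1) by (intro integrable_scaleR_left circle_integrable_indicator) auto
    moreover have "AE z in circle_measure. indicat_real A z *\<^sub>R c = c * indicat_real B z"
      by (intro AE_I2) (simp add: B(2) indicator_def)
    ultimately show ?case
      by (rule fejer_conv_cong_AE)
  next
    case (add f g)
    then show ?case by (intro fejer_conv_add)
  next
    case (lim f s)
    have fD: "integrable ?D f" by fact
    have f': "integrable circle_measure f"
      using fD integrable_completion[OF borel_measurable_integrable[OF fD]] by (simp add: circle_measure_def)
    show ?case
      by (rule fejer_conv_limit[where s=s and g="\<lambda>z. 2 * \<bar>f z\<bar>"]) (use f' lim in auto)
  qed
  then show ?thesis
    by (rule fejer_conv_cong_AE[OF _ f AE])
qed

lemma fejer_AE_subseq:
  assumes f: "integrable circle_measure f"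
  obtains r where "strict_mono r" "AE z in circle_measure. (\<lambda>K. fejer (r K) f z) \<longlonglongrightarrow> f z"
proof -
  have "(\<lambda>K. \<integral>z. norm (fejer K f z - f z) \<partial>circle_measure) \<longlonglongrightarrow> 0"
    using fejer_L1[OF f] by (simp add: fejer_conv_def)
  then obtain r :: "nat \<Rightarrow> nat" where r: "strict_mono r" "AE z in circle_measure. (\<lambda>K. fejer (r K) f z - f z) \<longlonglongrightarrow> 0"
    using tendsto_L1_AE_subseq[of circle_measure "\<lambda>K z. fejer K f z - f z"] f fejer_integrable by blast
  have "AE z in circle_measure. (\<lambda>K. fejer (r K) f z) \<longlonglongrightarrow> f z"
    using r(2) by eventually_elim (simp add: LIM_zero_iff)
  with r(1) that show ?thesis by blast
qed

section \<open>Szego's limit theorem\<close>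

text \<open>With h = - x / m the power is exp (- x ln (1 + h) / h) for large m, and the quotient
  tends to the derivative of ln at 1.\<close>

lemma tendsto_one_minus_over_n_power:
  fixes x :: complex
  shows "(\<lambda>m. (1 - x / of_nat m) ^ m) \<longlonglongrightarrow> exp (- x)"
proof (cases "x = 0")
  case False
  define h where "h m = - x / of_nat m" for m :: nat
  have h0: "h \<longlonglongrightarrow> 0"
    unfolding h_def by (rule lim_const_over_n)
  have "filterlim h (at 0) sequentially"
    using h0 False by (intro filterlim_atI eventually_mono[OF eventually_gt_at_top[of 0]]) (auto simp: h_def)
  moreover have "((\<lambda>h. (ln (1 + h) - ln 1) / h) \<longlongrightarrow> inverse 1) (at (0::complex))"
    using has_field_derivative_Ln[of 1] unfolding DERIV_def by (simp add: complex_nonpos_Reals_iff)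
  ultimately have "(\<lambda>m. (ln (1 + h m) - ln 1) / h m) \<longlonglongrightarrow> inverse 1"
    by (rule filterlim_compose[rotated])
  then have "(\<lambda>m. exp (- x * ((ln (1 + h m) - ln 1) / h m))) \<longlonglongrightarrow> exp (- x * inverse 1)"
    by (intro tendsto_exp tendsto_mult tendsto_const)
  moreover have "eventually (\<lambda>m. exp (- x * ((ln (1 + h m) - ln 1) / h m)) = (1 - x / of_nat m) ^ m) sequentially"
  proof -
    have "eventually (\<lambda>m. dist (h m) 0 < 1) sequentially"
      using h0 by (rule tendstoD) simp
    then show ?thesis
      using eventually_gt_at_top[of 0]
    proof eventually_elim
      fix m :: nat assume m: "dist (h m) 0 < 1" "m > 0"
      have "1 + h m \<noteq> 0"
      proof
        assume "1 + h m = 0"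
        then have "h m = - 1" by (simp add: eq_neg_iff_add_eq_0 add.commute)
        with m(1) show False by simp
      qed
      moreover have "- x * ((ln (1 + h m) - ln 1) / h m) = of_nat m * ln (1 + h m)"
        using False m(2) by (simp add: h_def)
      ultimately show "exp (- x * ((ln (1 + h m) - ln 1) / h m)) = (1 - x / of_nat m) ^ m"
        by (simp add: exp_of_nat_mult h_def)
    qed
  qed
  ultimately show ?thesis
    by (simp add: Lim_transform_eventually)
qed simp

lemma cmod_one_minus_over_n_power_le:
  fixes x :: complex
  shows "cmod ((1 - x / of_nat m) ^ m) \<le> exp (cmod x)"
proof (cases "m = 0")
  case False
  have "cmod (1 - x / of_nat m) \<le> 1 + cmod x / m"
    using norm_triangle_ineq4[of 1 "x / of_nat m"] by (simp add: norm_divide)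
  then have "cmod (1 - x / of_nat m) ^ m \<le> (1 + cmod x / m) ^ m"
    by (intro power_mono) auto
  also have "\<dots> \<le> exp (cmod x)"
    using False by (intro exp_ge_one_plus_x_over_n_power_n) (auto intro: order_trans[OF _ norm_ge_zero])
  finally show ?thesis
    by (simp add: norm_power)
qed simp

text \<open>These tend to \<open>exp (- q)\<close>; unlike for the Taylor polynomials, zero-freeness on the disk and the
  logarithmic derivative \<open>- q' / (1 - q / m)\<close> are immediate.\<close>

definition euler_poly :: "complex poly \<Rightarrow> nat \<Rightarrow> complex poly" where
  "euler_poly q m = (1 - smult (1 / of_nat m) q) ^ m"

lemma poly_euler_poly: "poly (euler_poly q m) z = (1 - poly q z / of_nat m) ^ m"
  by (simp add: euler_poly_def)

context log_weight
begin

text \<open>The polynomials \<open>euler_poly q m\<close> have value 1 at 0 because q(0) = 0, and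
  their squared moduli tend boundedly on the circle to exp (- 2 Re q).\<close>

lemma szego_euler:
  assumes q: "poly q 0 = 0" and d: "d > (\<integral>z. exp (- 2 * Re (poly q z)) * exp (L z) \<partial>circle_measure)"
  shows "\<exists>p. poly p 0 = 1 \<and> wnorm (\<lambda>z. exp (L z)) p < d"
proof -
  obtain B where B: "B > 0" "\<And>z. norm z = 1 \<Longrightarrow> cmod (poly q z) \<le> B"
    using circle_bound_continuous[of "poly q"] continuous_on_poly[OF continuous_on_id] by metis
  have "(\<lambda>m. \<integral>z. (cmod (poly (euler_poly q m) z))\<^sup>2 * exp (L z) \<partial>circle_measure) \<longlonglongrightarrow>
      (\<integral>z. exp (- 2 * Re (poly q z)) * exp (L z) \<partial>circle_measure)"
  proof (rule integral_dominated_convergence[where w="\<lambda>z. (exp B)\<^sup>2 * exp (L z)"])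
    show "AE z in circle_measure. (\<lambda>m. (cmod (poly (euler_poly q m) z))\<^sup>2 * exp (L z)) \<longlonglongrightarrow>
        exp (- 2 * Re (poly q z)) * exp (L z)"
    proof (rule AE_I2)
      fix z
      have "(\<lambda>m. (cmod (poly (euler_poly q m) z))\<^sup>2 * exp (L z)) \<longlonglongrightarrow> (cmod (exp (- poly q z)))\<^sup>2 * exp (L z)"
        unfolding poly_euler_poly by (intro tendsto_intros tendsto_one_minus_over_n_power)
      moreover have "(cmod (exp (- poly q z)))\<^sup>2 = exp (- 2 * Re (poly q z))"
        by (simp add: power2_eq_square flip: exp_add)
      ultimately show "(\<lambda>m. (cmod (poly (euler_poly q m) z))\<^sup>2 * exp (L z)) \<longlonglongrightarrow> exp (- 2 * Re (poly q z)) * exp (L z)"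
        by simp
    qed
    show "AE z in circle_measure. norm ((cmod (poly (euler_poly q m) z))\<^sup>2 * exp (L z)) \<le> (exp B)\<^sup>2 * exp (L z)" for m
    proof (rule AE_I2)
      fix z assume "z \<in> space circle_measure"
      then have "exp (cmod (poly q z)) \<le> exp B"
        using B(2)[of z] by simp
      then have "cmod (poly (euler_poly q m) z) \<le> exp B"
        unfolding poly_euler_poly by (rule order_trans[OF cmod_one_minus_over_n_power_le])
      then show "norm ((cmod (poly (euler_poly q m) z))\<^sup>2 * exp (L z)) \<le> (exp B)\<^sup>2 * exp (L z)"
        by (simp add: mult_right_mono power_mono)
    qed
    show "(\<lambda>z. exp (- 2 * Re (poly q z)) * exp (L z)) \<in> borel_measurable circle_measure"
      by (intro borel_measurable_integrable circle_integrable_continuous_mult continuous_intros exp_L_integrable)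
    show "(\<lambda>z. (cmod (poly (euler_poly q m) z))\<^sup>2 * exp (L z)) \<in> borel_measurable circle_measure" for m
      by (intro borel_measurable_integrable wnorm_integrable weight_exp)
  qed (use exp_L_integrable in simp)
  then have "eventually (\<lambda>m. wnorm (\<lambda>z. exp (L z)) (euler_poly q m) < d) sequentially"
    unfolding wnorm_def using d by (rule order_tendstoD(2))
  then obtain m where "wnorm (\<lambda>z. exp (L z)) (euler_poly q m) < d"
    using eventually_happens'[OF sequentially_bot] by blast
  moreover have "poly (euler_poly q m) 0 = 1"
    using q by (simp add: poly_euler_poly)
  ultimately show ?thesis by blast
qed

text \<open>Fejer means of f converge almost everywhere along a subsequence and inherit the bound M,
  so a multiple of exp L dominates. The mean of f appears because exponents Re q with q(0) = 0 have
  mean zero.\<close>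

lemma szego_bounded:
  assumes f: "integrable circle_measure f" "\<And>z. cmod z = 1 \<Longrightarrow> \<bar>f z\<bar> \<le> M"
    and d: "d > (\<integral>z. exp ((\<integral>z. f z \<partial>circle_measure) - f z) * exp (L z) \<partial>circle_measure)"
  shows "\<exists>p. poly p 0 = 1 \<and> wnorm (\<lambda>z. exp (L z)) p < d"
proof -
  let ?c = "\<integral>z. f z \<partial>circle_measure"
  obtain r where r: "strict_mono r" "AE z in circle_measure. (\<lambda>K. fejer (r K) f z) \<longlonglongrightarrow> f z"
    using fejer_AE_subseq[OF f(1)] by blast
  have fexp: "integrable circle_measure (\<lambda>z. exp (?c - fejer K f z) * exp (L z))" for K
    unfolding fejer_def
    by (intro circle_integrable_continuous_mult continuous_intros exp_L_integrable)
  have "(\<lambda>K. \<integral>z. exp (?c - fejer (r K) f z) * exp (L z) \<partial>circle_measure) \<longlonglongrightarrow>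
      (\<integral>z. exp (?c - f z) * exp (L z) \<partial>circle_measure)"
  proof (rule integral_dominated_convergence[where w="\<lambda>z. exp (?c + M) * exp (L z)"])
    show "AE z in circle_measure. (\<lambda>K. exp (?c - fejer (r K) f z) * exp (L z)) \<longlonglongrightarrow> exp (?c - f z) * exp (L z)"
      using r(2) by eventually_elim (intro tendsto_intros)
    show "AE z in circle_measure. norm (exp (?c - fejer (r K) f z) * exp (L z)) \<le> exp (?c + M) * exp (L z)" for K
    proof (rule AE_I2)
      fix z assume "z \<in> space circle_measure"
      then have "\<bar>fejer (r K) f z\<bar> \<le> M"
        by (intro abs_fejer_bounded f) auto
      then show "norm (exp (?c - fejer (r K) f z) * exp (L z)) \<le> exp (?c + M) * exp (L z)"
        by (simp add: mult_right_mono)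
    qed
    show "(\<lambda>z. exp (?c - f z) * exp (L z)) \<in> borel_measurable circle_measure"
      using borel_measurable_integrable[OF f(1)] borel_measurable_integrable[OF exp_L_integrable] by measurable
  qed (use exp_L_integrable borel_measurable_integrable[OF fexp] in auto)
  then have "eventually (\<lambda>K. (\<integral>z. exp (?c - fejer (r K) f z) * exp (L z) \<partial>circle_measure) < d) sequentially"
    using d by (rule order_tendstoD(2))
  then obtain K where "(\<integral>z. exp (?c - fejer (r K) f z) * exp (L z) \<partial>circle_measure) < d"
    using eventually_happens'[OF sequentially_bot] by blast
  then show ?thesis
    using szego_euler[of "fejer_poly (r K) f" d] by (simp add: fejer_def poly_fejer_poly_0)
qed

text \<open>Taking f to be the truncation of L to [-M, M] turns the integral into exp (mean of f)
  times the integral of exp (L - f), and both factors tend to 1.\<close>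

lemma szego_approx:
  assumes d: "d > 1"
  shows "\<exists>p. poly p 0 = 1 \<and> wnorm (\<lambda>z. exp (L z)) p < d"
proof -
  define T where "T M z = max (- real M) (min (real M) (L z))" for M z
  have T: "integrable circle_measure (T M)" for M
  proof (rule circle.integrable_const_bound[where B="real M"])
    show "T M \<in> borel_measurable circle_measure"
      unfolding T_def using borel_measurable_integrable[OF L_integrable] by measurable
  qed (auto simp: T_def)
  have limT: "(\<lambda>M. T M z) \<longlonglongrightarrow> L z" for z
  proof -
    have "eventually (\<lambda>M. real M \<ge> \<bar>L z\<bar>) sequentially"
      by (rule eventually_mono[OF eventually_ge_at_top[of "nat \<lceil>\<bar>L z\<bar>\<rceil>"]]) (simp add: nat_ceiling_le_eq)
    then have "eventually (\<lambda>M. T M z = L z) sequentially"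
      by eventually_elim (auto simp: T_def)
    then show ?thesis by (simp add: tendsto_eventually)
  qed
  have mean: "(\<lambda>M. \<integral>z. T M z \<partial>circle_measure) \<longlonglongrightarrow> (\<integral>z. L z \<partial>circle_measure)"
  proof (rule integral_dominated_convergence[where w="\<lambda>z. \<bar>L z\<bar>"])
    show "AE z in circle_measure. norm (T M z) \<le> \<bar>L z\<bar>" for M
      by (rule AE_I2) (auto simp: T_def)
  qed (use L_integrable T limT in auto)
  have "(\<lambda>M. \<integral>z. exp (L z - T M z) \<partial>circle_measure) \<longlonglongrightarrow> (\<integral>z. 1 \<partial>circle_measure)"
  proof (rule integral_dominated_convergence[where w="\<lambda>z. 1 + exp (L z)"])
    show "AE z in circle_measure. (\<lambda>M. exp (L z - T M z)) \<longlonglongrightarrow> 1"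
    proof (rule AE_I2)
      fix z
      have "(\<lambda>M. exp (L z - T M z)) \<longlonglongrightarrow> exp (L z - L z)"
        by (intro tendsto_intros limT)
      then show "(\<lambda>M. exp (L z - T M z)) \<longlonglongrightarrow> 1" by simp
    qed
    \<comment> \<open>Where L <= M the truncation is at least L and the value is at most 1; where L
      > M it is M >= 0 and the value is at most exp L.\<close>
    show "AE z in circle_measure. norm (exp (L z - T M z)) \<le> 1 + exp (L z)" for M
    proof (rule AE_I2)
      fix z
      show "norm (exp (L z - T M z)) \<le> 1 + exp (L z)"
      proof (cases "L z \<le> real M")
        case True
        then have "exp (L z - T M z) \<le> 1"
          by (auto simp: T_def)
        then show ?thesis
          using exp_gt_zero[of "L z"] unfolding real_norm_def abs_exp_cancel by linarith
      next
        case False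
        then have "exp (L z - T M z) \<le> exp (L z)"
          by (subst exp_le_cancel_iff) (auto simp: T_def)
        then show ?thesis
          unfolding real_norm_def abs_exp_cancel by linarith
      qed
    qed
    show "(\<lambda>z. exp (L z - T M z)) \<in> borel_measurable circle_measure" for M
      using borel_measurable_integrable[OF L_integrable] borel_measurable_integrable[OF T[of M]] by measurable
  qed (use exp_L_integrable in auto)
  then have "(\<lambda>M. exp (\<integral>z. T M z \<partial>circle_measure) * (\<integral>z. exp (L z - T M z) \<partial>circle_measure)) \<longlonglongrightarrow> exp 0 * 1"
    using mean integral_L by (intro tendsto_intros) auto
  then have "eventually (\<lambda>M. exp (\<integral>z. T M z \<partial>circle_measure) * (\<integral>z. exp (L z - T M z) \<partial>circle_measure) < d) sequentially"
    using d by (intro order_tendstoD(2)) auto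
  then obtain M where M: "exp (\<integral>z. T M z \<partial>circle_measure) * (\<integral>z. exp (L z - T M z) \<partial>circle_measure) < d"
    using eventually_happens'[OF sequentially_bot] by blast
  have "exp (\<integral>z. T M z \<partial>circle_measure) * (\<integral>z. exp (L z - T M z) \<partial>circle_measure) =
      (\<integral>z. exp ((\<integral>z. T M z \<partial>circle_measure) - T M z) * exp (L z) \<partial>circle_measure)"
    by (subst integral_mult_right_zero[symmetric]) (simp add: algebra_simps flip: exp_add)
  with M have M': "(\<integral>z. exp ((\<integral>z. T M z \<partial>circle_measure) - T M z) * exp (L z) \<partial>circle_measure) < d"
    by simp
  show ?thesis
    by (rule szego_bounded[OF T _ M', of "real M"]) (auto simp: T_def)
qed

theorem szego_limit:
  "(\<lambda>n. wnorm (\<lambda>z. exp (L z)) (dual_poly (\<lambda>z. exp (L z)) n)) \<longlonglongrightarrow> 1"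
proof (rule order_tendstoI)
  fix d :: real assume "d < 1"
  then have "d < wnorm (\<lambda>z. exp (L z)) (dual_poly (\<lambda>z. exp (L z)) n)" for n
    using wnorm_dual_ge_1[OF is_dual_dual_poly[OF weight_exp], of n] by linarith
  then show "\<forall>\<^sub>F n in sequentially. d < wnorm (\<lambda>z. exp (L z)) (dual_poly (\<lambda>z. exp (L z)) n)"
    by simp
next
  fix d :: real assume "1 < d"
  then obtain p where p: "poly p 0 = 1" "wnorm (\<lambda>z. exp (L z)) p < d"
    using szego_approx by blast
  show "\<forall>\<^sub>F n in sequentially. wnorm (\<lambda>z. exp (L z)) (dual_poly (\<lambda>z. exp (L z)) n) < d"
    using eventually_ge_at_top[of "degree p"]
  proof eventually_elim
    fix n assume "degree p \<le> n"
    then have "wnorm (\<lambda>z. exp (L z)) (dual_poly (\<lambda>z. exp (L z)) n) \<le> wnorm (\<lambda>z. exp (L z)) p"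
      by (intro wnorm_dual_le[OF weight_exp is_dual_dual_poly[OF weight_exp]] p)
    then show "wnorm (\<lambda>z. exp (L z)) (dual_poly (\<lambda>z. exp (L z)) n) < d"
      using p(2) by linarith
  qed
qed

end

section \<open>The upper bound\<close>

lemma poly_pderiv_rpoly:
  assumes "\<And>a. a \<in> set as \<Longrightarrow> 1 - a * z \<noteq> 0"
  shows "poly (pderiv (rpoly as)) z = - poly (rpoly as) z * (\<Sum>a\<leftarrow>as. a / (1 - a * z))"
  using assms
proof (induction as)
  case (Cons a as)
  have nz: "1 - a * z \<noteq> 0"
    using Cons.prems by simp
  have "poly (pderiv (rpoly (a # as))) z =
      (1 - a * z) * poly (pderiv (rpoly as)) z - a * poly (rpoly as) z"
    unfolding rpoly_Cons pderiv_mult by (simp add: pderiv_pCons algebra_simps)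
  also have "poly (pderiv (rpoly as)) z = - poly (rpoly as) z * (\<Sum>a\<leftarrow>as. a / (1 - a * z))"
    using Cons by simp
  also have "(1 - a * z) * (- poly (rpoly as) z * (\<Sum>a\<leftarrow>as. a / (1 - a * z))) - a * poly (rpoly as) z =
      - ((1 - a * z) * poly (rpoly as) z) * (a / (1 - a * z) + (\<Sum>a\<leftarrow>as. a / (1 - a * z)))"
    using nz by (simp add: field_simps)
  finally show ?case
    by (simp add: poly_rpoly)
qed (simp add: pderiv_1)

text \<open>The function - z P' / P is the sum of the terms a z / (1 - a z), whose geometric series
  add up to the power sums. These can thus be read off from P and its derivative alone.\<close>

lemma log_deriv_coeff:
  assumes as: "\<And>a. a \<in> set as \<Longrightarrow> cmod a < 1"
  shows "(\<integral>z. cnj z ^ k * (- z * poly (pderiv (rpoly as)) z / poly (rpoly as) z) \<partial>circle_measure) =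
    (if k = 0 then 0 else psum as k)"
proof (rule integral_power_series_coeff)
  have one: "summable (\<lambda>k. norm (a ^ k))" if "cmod a < 1" for a :: complex
    using that by (simp add: norm_power summable_geometric)
  have "summable (\<lambda>k. \<Sum>a\<leftarrow>as. norm (a ^ k))"
    using as
  proof (induction as)
    case (Cons a as)
    then show ?case
      using one[of a] by (auto intro!: summable_add)
  qed simp
  then show "summable (\<lambda>k. norm (if k = 0 then 0 else psum as k))"
  proof (rule summable_comparison_test'[where N=0])
    fix k :: nat
    have "norm (psum as k) \<le> (\<Sum>a\<leftarrow>as. norm (a ^ k))"
      unfolding psum_def by (induction as) (auto intro: norm_triangle_le)
    moreover have "0 \<le> (\<Sum>a\<leftarrow>as. norm (a ^ k))"
      by (intro sum_list_nonneg) auto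
    ultimately show "norm (norm (if k = 0 then 0 else psum as k)) \<le> (\<Sum>a\<leftarrow>as. norm (a ^ k))"
      by (auto simp: sum_list_triv)
  qed
  fix z :: complex assume z: "norm z = 1"
  have az: "cmod (a * z) < 1" if "a \<in> set as" for a
    using as[OF that] z by (simp add: norm_mult)
  have nz: "1 - a * z \<noteq> 0" if "a \<in> set as" for a
    using az[OF that] by auto
  have "(\<lambda>k. \<Sum>a\<leftarrow>as. (if k = 0 then 0 else (a * z) ^ k)) sums (\<Sum>a\<leftarrow>as. a * z / (1 - a * z))"
  proof (rule sums_sum_list)
    fix a assume a: "a \<in> set as"
    have "(\<lambda>k. (a * z) ^ Suc k) sums (a * z * (1 / (1 - a * z)))"
      using sums_mult[OF geometric_sums[OF az[OF a]], of "a * z"] by simp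
    then show "(\<lambda>k. if k = 0 then 0 else (a * z) ^ k) sums (a * z / (1 - a * z))"
      using sums_Suc_iff[of "\<lambda>k. if k = 0 then 0 else (a * z) ^ k" "a * z / (1 - a * z)"] by simp
  qed
  moreover have "(\<Sum>a\<leftarrow>as. (if k = 0 then 0 else (a * z) ^ k)) = (if k = 0 then 0 else psum as k) * z ^ k" for k
    by (simp add: psum_def power_mult_distrib sum_list_mult_const)
  moreover have "(\<Sum>a\<leftarrow>as. a * z / (1 - a * z)) = - z * poly (pderiv (rpoly as)) z / poly (rpoly as) z"
  proof -
    have "poly (rpoly as) z \<noteq> 0"
      using poly_rpoly_nonzero[of as z] as z by simp
    then have "- z * poly (pderiv (rpoly as)) z / poly (rpoly as) z = z * (\<Sum>a\<leftarrow>as. a / (1 - a * z))"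
      using poly_pderiv_rpoly[of as z] nz by (simp add: field_simps)
    also have "\<dots> = (\<Sum>a\<leftarrow>as. a * z / (1 - a * z))"
      by (simp add: sum_list_const_mult[symmetric] mult.commute)
    finally show ?thesis by simp
  qed
  ultimately show "(\<lambda>k. (if k = 0 then 0 else psum as k) * z ^ k) sums (- z * poly (pderiv (rpoly as)) z / poly (rpoly as) z)"
    by (simp only:)
qed

lemma bessel_inequality:
  fixes g :: "complex \<Rightarrow> complex"
  assumes g: "continuous_on (sphere 0 1) g"
  shows "(\<Sum>k\<le>J. (cmod (\<integral>z. cnj z ^ k * g z \<partial>circle_measure))\<^sup>2) \<le> (\<integral>z. (cmod (g z))\<^sup>2 \<partial>circle_measure)"
proof -
  define c where "c k = (\<integral>z. cnj z ^ k * g z \<partial>circle_measure)" for k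
  define h where "h z = (\<Sum>k\<le>J. c k * z ^ k)" for z
  have h: "continuous_on (sphere 0 1) h"
    unfolding h_def by (intro continuous_intros)
  have gh: "(\<integral>z. g z * cnj (h z) \<partial>circle_measure) = of_real (\<Sum>k\<le>J. (cmod (c k))\<^sup>2)"
  proof -
    have "(\<integral>z. g z * cnj (h z) \<partial>circle_measure) = (\<integral>z. (\<Sum>k\<le>J. cnj (c k) * (cnj z ^ k * g z)) \<partial>circle_measure)"
      by (simp add: h_def cnj_sum sum_distrib_left mult_ac)
    also have "\<dots> = (\<Sum>k\<le>J. cnj (c k) * c k)"
      unfolding c_def
      by (subst Bochner_Integration.integral_sum)
        (auto intro!: integrable_mult_right circle_integrable_continuous continuous_intros g)
    finally show ?thesis
      by (simp add: complex_norm_square mult.commute del: of_real_power)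
  qed
  have hh: "(\<integral>z. h z * cnj (h z) \<partial>circle_measure) = of_real (\<Sum>k\<le>J. (cmod (c k))\<^sup>2)"
  proof -
    have coef: "(\<integral>z. z ^ k * cnj (h z) \<partial>circle_measure) = cnj (c k)" if "k \<le> J" for k
    proof -
      have "(\<integral>z. z ^ k * cnj (h z) \<partial>circle_measure) = (\<integral>z. (\<Sum>j\<le>J. cnj (c j) * (z ^ k * cnj z ^ j)) \<partial>circle_measure)"
        by (simp add: h_def cnj_sum sum_distrib_left mult_ac)
      also have "\<dots> = (\<Sum>j\<le>J. cnj (c j) * (if k = j then 1 else 0))"
        by (subst Bochner_Integration.integral_sum)
          (auto intro!: integrable_mult_right circle_integrable_continuous continuous_intros simp: integral_power_cnj)
      also have "\<dots> = cnj (c k)"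
        using that by (simp add: if_distrib cong: if_cong)
      finally show ?thesis .
    qed
    have "h z * cnj (h z) = (\<Sum>k\<le>J. c k * (z ^ k * cnj (h z)))" for z
      by (subst (1) h_def) (simp add: sum_distrib_right mult.assoc)
    then have "(\<integral>z. h z * cnj (h z) \<partial>circle_measure) = (\<integral>z. (\<Sum>k\<le>J. c k * (z ^ k * cnj (h z))) \<partial>circle_measure)"
      by (simp only:)
    also have "\<dots> = (\<Sum>k\<le>J. c k * cnj (c k))"
      using h coef by (subst Bochner_Integration.integral_sum)
        (auto intro!: integrable_mult_right circle_integrable_continuous continuous_intros)
    finally show ?thesis
      by (simp add: complex_norm_square del: of_real_power)
  qed
  define S where "S = (\<Sum>k\<le>J. (cmod (c k))\<^sup>2)"
  have i1: "integrable circle_measure (\<lambda>z. (cmod (g z))\<^sup>2)"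
    and i2: "integrable circle_measure (\<lambda>z. g z * cnj (h z))"
    and i3: "integrable circle_measure (\<lambda>z. h z * cnj (h z))"
    by (intro circle_integrable_continuous continuous_intros g h)+
  have "0 \<le> (\<integral>z. (cmod (g z - h z))\<^sup>2 \<partial>circle_measure)"
    by simp
  also have "\<dots> = (\<integral>z. (cmod (g z))\<^sup>2 - 2 * Re (g z * cnj (h z)) + Re (h z * cnj (h z)) \<partial>circle_measure)"
  proof (rule Bochner_Integration.integral_cong)
    fix z
    show "(cmod (g z - h z))\<^sup>2 = (cmod (g z))\<^sup>2 - 2 * Re (g z * cnj (h z)) + Re (h z * cnj (h z))"
      by (simp only: cmod_power2) (simp add: power2_eq_square algebra_simps)
  qed simp
  also have "\<dots> = (\<integral>z. (cmod (g z))\<^sup>2 \<partial>circle_measure) - 2 * Re (\<integral>z. g z * cnj (h z) \<partial>circle_measure) + Re (\<integral>z. h z * cnj (h z) \<partial>circle_measure)"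
  proof -
    define u where "u z = g z * cnj (h z)" for z
    define v where "v z = h z * cnj (h z)" for z
    have "integrable circle_measure u" "integrable circle_measure v"
      using i2 i3 by (simp_all add: u_def[abs_def] v_def[abs_def])
    then show ?thesis
      unfolding u_def[symmetric] v_def[symmetric] using i1 by simp
  qed
  also have "\<dots> = (\<integral>z. (cmod (g z))\<^sup>2 \<partial>circle_measure) - S"
    unfolding gh hh S_def by simp
  finally show ?thesis
    by (simp add: S_def c_def)
qed

text \<open>No majorant of the v m is assumed. Their minima with w are dominated by w and still tend
  to w, and by monotonicity the determinants of the minima stay below those of v m.\<close>

lemma rdet_le_limit:
  assumes w: "weight w" "\<And>m. weight (v m)"
    and lim: "AE z in circle_measure. (\<lambda>m. v m z) \<longlonglongrightarrow> w z"
    and le: "eventually (\<lambda>m. rdet (v m) n \<le> b m) sequentially" and b: "b \<longlonglongrightarrow> c"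
  shows "rdet w n \<le> c"
proof -
  define u where "u m z = min (v m z) (w z)" for m z
  have u: "weight (u m)" for m
  proof -
    have "integrable circle_measure (u m)"
      unfolding u_def using w by (intro integrable_min) (auto simp: weight_def)
    moreover have "AE z in circle_measure. u m z > 0"
      using w(1) w(2)[of m] unfolding weight_def u_def by (auto elim: eventually_elim2)
    ultimately show ?thesis by (simp add: weight_def)
  qed
  have "(\<lambda>m. rdet (u m) n) \<longlonglongrightarrow> rdet w n"
  proof (rule rdet_tendsto[OF w(1) u _ weight_integrable[OF w(1)]])
    show "AE z in circle_measure. (\<lambda>m. u m z) \<longlonglongrightarrow> w z"
      using lim
    proof eventually_elim
      fix z assume "(\<lambda>m. v m z) \<longlonglongrightarrow> w z"
      then have "(\<lambda>m. min (v m z) (w z)) \<longlonglongrightarrow> min (w z) (w z)"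
        by (intro tendsto_min tendsto_const)
      then show "(\<lambda>m. u m z) \<longlonglongrightarrow> w z"
        by (simp add: u_def)
    qed
  qed (auto simp: u_def)
  moreover have "eventually (\<lambda>m. rdet (u m) n \<le> b m) sequentially"
    using le
  proof eventually_elim
    fix m assume "rdet (v m) n \<le> b m"
    moreover have "rdet (u m) n \<le> rdet (v m) n"
      by (rule rdet_mono[OF u w(2)]) (simp add: u_def)
    ultimately show "rdet (u m) n \<le> b m" by simp
  qed
  ultimately show ?thesis
    by (intro tendsto_le[OF sequentially_bot b])
qed

lemma rpoly_zero_free_radius:
  assumes "\<And>a. a \<in> set as \<Longrightarrow> cmod a < 1"
  obtains R where "R > 1" "\<And>z. cmod z < R \<Longrightarrow> poly (rpoly as) z \<noteq> 0"
proof -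
  \<comment> \<open>Inserting 1 / 2 keeps the maximum defined and positive when the list is empty or
    consists of zeros.\<close>
  define \<rho> where "\<rho> = Max (insert (1 / 2) (cmod ` set as))"
  have rho: "\<rho> > 0" "\<rho> < 1"
    using assms by (auto simp: \<rho>_def Max_gr_iff)
  have le: "cmod a \<le> \<rho>" if "a \<in> set as" for a
    unfolding \<rho>_def using that by (intro Max_ge) auto
  show ?thesis
  proof (rule that[of "1 / \<rho>"])
    show "1 / \<rho> > 1"
      using rho by simp
    fix z assume z: "cmod z < 1 / \<rho>"
    have "1 - a * z \<noteq> 0" if "a \<in> set as" for a
    proof
      assume "1 - a * z = 0"
      then have "cmod a * cmod z = 1"
        by (metis eq_iff_diff_eq_0 norm_mult norm_one)
      moreover have "cmod a * cmod z \<le> \<rho> * cmod z"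
        using le[OF that] by (intro mult_right_mono) auto
      moreover have "\<rho> * cmod z < 1"
        using z rho by (simp add: field_simps)
      ultimately show False by simp
    qed
    then show "poly (rpoly as) z \<noteq> 0"
      by (auto simp: poly_rpoly prod_list_zero_iff)
  qed
qed

text \<open>For the Bernstein--Szego weight \<open>1 / \<bar>P\<bar>\<^sup>2\<close> the polynomial \<open>P\<close> itself is dual orthogonal, so the
  determinant formula in terms of the zeros is exact once the size reaches the degree of \<open>P\<close>.\<close>

lemma rdet_bernstein_szego_le:
  assumes as: "\<And>a. a \<in> set as \<Longrightarrow> cmod a < 1" and n: "n \<le> length as"
  shows "weight (\<lambda>z. exp (- log_rpoly as z))" "rdet (\<lambda>z. exp (- log_rpoly as z)) n \<le> exp (energy as)"
proof -
  let ?P = "rpoly as" and ?w = "\<lambda>z. exp (- log_rpoly as z)"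
  have nz: "poly ?P z \<noteq> 0" if "cmod z = 1" for z
    using poly_rpoly_nonzero[of as z] as that by simp
  have w_eq: "?w z = 1 / (cmod (poly ?P z))\<^sup>2" if "cmod z = 1" for z
    using nz[OF that] by (simp add: log_rpoly_def exp_minus inverse_eq_divide)
  have "continuous_on (sphere 0 1) (\<lambda>z. 1 / (cmod (poly ?P z))\<^sup>2)"
    using nz by (intro continuous_intros) auto
  then have "continuous_on (sphere 0 1) ?w"
    by (rule continuous_on_eq) (use w_eq in auto)
  then have wi: "integrable circle_measure ?w"
    by (rule circle_integrable_continuous)
  interpret lw: log_weight "\<lambda>z. - log_rpoly as z"
    using wi log_rpoly_integrable[of as, OF as] integral_log_rpoly_0[of as, OF as] by unfold_locales auto
  show w: "weight ?w"
    by (rule lw.weight_exp)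
  obtain R where R: "R > 1" "\<And>z. cmod z < R \<Longrightarrow> poly ?P z \<noteq> 0"
    using rpoly_zero_free_radius[of as] as by metis
  have "is_dual ?w (length as) ?P"
    unfolding is_dual_def
  proof (intro conjI ballI)
    fix j assume j: "j \<in> {1..length as}"
    \<comment> \<open>On the circle P / |P|^2 = 1 / cnj P, so the inner product is the conjugate of
      the integral of z^j / P, a function holomorphic beyond the closed disk and vanishing at 0 for
      j >= 1.\<close>
    have "wip ?w ?P (monom 1 j) = (\<integral>z. cnj (z ^ j * (1 / poly ?P z)) \<partial>circle_measure)"
      unfolding wip_def
    proof (rule Bochner_Integration.integral_cong)
      fix z assume "z \<in> space circle_measure"
      then have z: "cmod z = 1" by simp
      have "complex_of_real (?w z) = 1 / (poly ?P z * cnj (poly ?P z))"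
        unfolding w_eq[OF z] by (simp add: complex_norm_square del: of_real_power)
      then show "poly ?P z * cnj (poly (monom 1 j) z) * complex_of_real (?w z) = cnj (z ^ j * (1 / poly ?P z))"
        using nz[OF z] by (simp add: poly_monom)
    qed simp
    also have "\<dots> = cnj (\<integral>z. z ^ j * (1 / poly ?P z) \<partial>circle_measure)"
      by (rule Bochner_Integration.integral_cnj)
    also have "(\<integral>z. z ^ j * (1 / poly ?P z) \<partial>circle_measure) = 0"
    proof -
      have "(\<lambda>z. poly ?P z) holomorphic_on ball 0 R"
        unfolding poly_altdef by (intro holomorphic_intros)
      then have "(\<lambda>z. 1 / poly ?P z) holomorphic_on ball 0 R"
        using R(2) by (intro holomorphic_intros) auto
      from circle_integral_holomorphic[OF this R(1), of j] show ?thesis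
        using j by simp
    qed
    finally show "wip ?w ?P (monom 1 j) = 0" by simp
  qed (simp_all add: degree_rpoly)
  moreover have "wnorm ?w ?P = 1"
  proof -
    have "wnorm ?w ?P = (\<integral>z. 1 \<partial>circle_measure)"
      unfolding wnorm_def by (rule Bochner_Integration.integral_cong) (use w_eq nz in auto)
    then show ?thesis by simp
  qed
  ultimately have "rdet ?w (length as) = exp (energy as)"
    using rdet_zeros(2)[OF w] by simp
  \<comment> \<open>The exact value at size \<open>length as\<close> bounds all smaller sizes, as
    the determinants increase with the size.\<close>
  then show "rdet ?w n \<le> exp (energy as)"
    using incseqD[OF lw.incseq_rdet n] by simp
qed

text \<open>For k > J the factor 1 / k is at most 1 / J, and Bessel's inequality for - z P' / P
  bounds the sum of the |s_k|^2 by C^2. With a common C for a family of polynomials, limits need to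
  be taken in finitely many terms only.\<close>

lemma energy_le:
  assumes as: "\<And>a. a \<in> set as \<Longrightarrow> cmod a < 1" and J: "J > 0"
    and C: "\<And>z. cmod z = 1 \<Longrightarrow> cmod (poly (pderiv (rpoly as)) z / poly (rpoly as) z) \<le> C"
  shows "energy as \<le> (\<Sum>k\<le>J. (cmod (psum as k))\<^sup>2 / real k) + C\<^sup>2 / J"
proof -
  define g where "g z = - z * poly (pderiv (rpoly as)) z / poly (rpoly as) z" for z
  have nz: "poly (rpoly as) z \<noteq> 0" if "cmod z = 1" for z
    using poly_rpoly_nonzero[of as z] as that by simp
  have g: "continuous_on (sphere 0 1) g"
    unfolding g_def using nz by (intro continuous_intros) auto
  have bessel: "(\<Sum>k\<in>{1..N}. (cmod (psum as k))\<^sup>2) \<le> C\<^sup>2" for N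
  proof -
    have "(\<integral>z. cnj z ^ k * g z \<partial>circle_measure) = (if k = 0 then 0 else psum as k)" for k
      unfolding g_def by (rule log_deriv_coeff[OF as])
    then have "(\<Sum>k\<in>{1..N}. (cmod (psum as k))\<^sup>2) =
        (\<Sum>k\<in>{1..N}. (cmod (\<integral>z. cnj z ^ k * g z \<partial>circle_measure))\<^sup>2)"
      by (intro sum.cong) auto
    also have "\<dots> \<le> (\<Sum>k\<le>N. (cmod (\<integral>z. cnj z ^ k * g z \<partial>circle_measure))\<^sup>2)"
      by (intro sum_mono2) auto
    also have "\<dots> \<le> (\<integral>z. (cmod (g z))\<^sup>2 \<partial>circle_measure)"
      by (rule bessel_inequality[OF g])
    also have "\<dots> \<le> (\<integral>z. C\<^sup>2 \<partial>circle_measure)"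
    proof (rule integral_mono)
      show "integrable circle_measure (\<lambda>z. (cmod (g z))\<^sup>2)"
        by (intro circle_integrable_continuous continuous_intros g)
      fix z assume "z \<in> space circle_measure"
      then show "(cmod (g z))\<^sup>2 \<le> C\<^sup>2"
        using C[of z] by (intro power_mono) (auto simp: g_def norm_mult norm_divide)
    qed simp
    finally show ?thesis by simp
  qed
  have "(\<Sum>k<N. (cmod (psum as k))\<^sup>2 / real k) \<le> (\<Sum>k\<le>J. (cmod (psum as k))\<^sup>2 / real k) + C\<^sup>2 / J" for N
  proof -
    have "(\<Sum>k<N. (cmod (psum as k))\<^sup>2 / real k) \<le> (\<Sum>k\<in>{..J} \<union> {Suc J..N}. (cmod (psum as k))\<^sup>2 / real k)"
      by (intro sum_mono2) auto
    also have "\<dots> = (\<Sum>k\<le>J. (cmod (psum as k))\<^sup>2 / real k) + (\<Sum>k\<in>{Suc J..N}. (cmod (psum as k))\<^sup>2 / real k)"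
      by (rule sum.union_disjoint) auto
    also have "(\<Sum>k\<in>{Suc J..N}. (cmod (psum as k))\<^sup>2 / real k) \<le> (\<Sum>k\<in>{Suc J..N}. (cmod (psum as k))\<^sup>2 / real J)"
      using J by (intro sum_mono divide_left_mono) auto
    also have "\<dots> \<le> (\<Sum>k\<in>{1..N}. (cmod (psum as k))\<^sup>2 / real J)"
      by (intro sum_mono2) auto
    also have "\<dots> \<le> C\<^sup>2 / J"
      unfolding sum_divide_distrib[symmetric] using J by (intro divide_right_mono bessel) auto
    finally show ?thesis by simp
  qed
  then have "(\<Sum>k. (cmod (psum as k))\<^sup>2 / real k) \<le> (\<Sum>k\<le>J. (cmod (psum as k))\<^sup>2 / real k) + C\<^sup>2 / J"
    using energy_sums(1)[of as] as
    by (intro suminf_le_const[OF sums_summable]) auto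
  then show ?thesis
    by (simp add: energy_def)
qed

lemma circle_poly_coeff: "(\<integral>z. cnj z ^ k * poly p z \<partial>circle_measure) = coeff p k"
proof -
  have "(\<integral>z. cnj z ^ k * poly p z \<partial>circle_measure) = (\<integral>z. (\<Sum>i\<le>degree p. coeff p i * (z ^ i * cnj z ^ k)) \<partial>circle_measure)"
    by (simp add: poly_altdef sum_distrib_left mult_ac)
  also have "\<dots> = (\<Sum>i\<le>degree p. coeff p i * (if i = k then 1 else 0))"
    by (subst Bochner_Integration.integral_sum)
      (auto intro!: integrable_mult_right circle_integrable_continuous continuous_intros simp: integral_power_cnj)
  also have "\<dots> = coeff p k"
    by (auto simp: if_distrib coeff_eq_0 cong: if_cong)
  finally show ?thesis .
qed

lemma weight_exp_poly: "weight (\<lambda>z. exp (2 * Re (poly q z)))"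
  unfolding weight_def by (intro conjI circle_integrable_continuous continuous_intros) simp

lemma rdet_exp_poly_le:
  assumes q: "poly q 0 = 0" and S: "\<And>J. (\<Sum>k\<le>J. real k * (cmod (coeff q k))\<^sup>2) \<le> S"
  shows "rdet (\<lambda>z. exp (2 * Re (poly q z))) n \<le> exp S"
proof -
  have "bounded (poly q ` cball 0 1)"
    by (intro compact_imp_bounded compact_continuous_image continuous_intros compact_cball)
  then obtain B where B: "B > 0" "\<And>z. cmod z \<le> 1 \<Longrightarrow> cmod (poly q z) \<le> B"
    unfolding bounded_pos by auto
  obtain C where C: "C > 0" "\<And>z. norm z = 1 \<Longrightarrow> cmod (poly (pderiv q) z) \<le> C"
    using circle_bound_continuous[of "poly (pderiv q)"] continuous_on_poly[OF continuous_on_id] by metis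
  \<comment> \<open>M i >= 2 B keeps |q / M i| at most 1 / 2 on the closed disk: the Euler
    polynomial has no zero there, and its logarithmic derivative is at most 2 C on the circle,
    uniformly in i.\<close>
  define M where "M i = Suc (nat \<lceil>2 * B\<rceil>) + i" for i
  have M: "real (M i) \<ge> 2 * B" "M i > 0" for i
    unfolding M_def by linarith+
  have half: "cmod (1 - poly q z / of_nat (M i)) \<ge> 1 / 2" if "cmod z \<le> 1" for z i
  proof -
    have "cmod (poly q z / of_nat (M i)) \<le> 1 / 2"
      using B(2)[OF that] M[of i] by (simp add: norm_divide field_simps)
    then show ?thesis
      using norm_triangle_ineq2[of 1 "poly q z / of_nat (M i)"] by simp
  qed
  have nz: "1 - poly q z / of_nat (M i) \<noteq> 0" if "cmod z \<le> 1" for z i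
    using half[OF that, of i] by auto
  define P where "P i = euler_poly q (M i)" for i
  have Pnz: "poly (P i) z \<noteq> 0" if "cmod z \<le> 1" for z i
    unfolding P_def poly_euler_poly by (intro power_not_zero nz that)
  have P0: "poly (P i) 0 = 1" for i
    using q by (simp add: P_def poly_euler_poly)
  \<comment> \<open>A length of at least n lets \<open>rdet_bernstein_szego_le\<close> be applied at
    size n.\<close>
  have "\<exists>as. length as = max n (degree (P i)) \<and> P i = rpoly as" for i
    by (rule exists_rpoly) (simp_all add: P0)
  then obtain Z where Z: "\<And>i. length (Z i) = max n (degree (P i))" "\<And>i. P i = rpoly (Z i)"
    by metis
  \<comment> \<open>A parameter with |a| >= 1 would give the zero 1 / a in the closed disk.\<close>
  have small: "cmod a < 1" if "a \<in> set (Z i)" for a i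
  proof (rule ccontr)
    assume a: "\<not> cmod a < 1"
    then have "cmod a \<ge> 1" "a \<noteq> 0" by auto
    then have "cmod (1 / a) \<le> 1"
      by (simp add: norm_divide divide_le_eq_1)
    have "poly (rpoly (Z i)) (1 / a) = 0"
      using that \<open>a \<noteq> 0\<close> by (force simp: poly_rpoly prod_list_zero_iff)
    moreover have "poly (P i) (1 / a) \<noteq> 0"
      by (rule Pnz) fact
    ultimately show False
      by (simp add: Z)
  qed
  have logderiv: "poly (pderiv (P i)) z / poly (P i) z = - poly (pderiv q) z / (1 - poly q z / of_nat (M i))"
    if z: "cmod z \<le> 1" for z i
  proof -
    obtain m where m: "M i = Suc m"
      using M(2)[of i] by (cases "M i") auto
    define x where "x = 1 - poly q z / of_nat (Suc m)"
    have "x \<noteq> 0"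
      using nz[OF z, of i] by (simp add: x_def m)
    have "poly (pderiv (P i)) z = of_nat (Suc m) * x ^ m * (- (1 / of_nat (Suc m) * poly (pderiv q) z))"
      unfolding P_def euler_poly_def m pderiv_power_Suc
      by (simp add: x_def pderiv_diff pderiv_smult pderiv_1 del: of_nat_Suc)
    also have "\<dots> = - poly (pderiv q) z * x ^ m"
      by (simp add: field_simps del: of_nat_Suc)
    moreover have "poly (P i) z = x * x ^ m"
      by (simp add: P_def poly_euler_poly m x_def)
    ultimately have "poly (pderiv (P i)) z / poly (P i) z = - poly (pderiv q) z / x"
      using \<open>x \<noteq> 0\<close> by simp
    then show ?thesis
      by (simp add: x_def m)
  qed
  have ld_bound: "cmod (poly (pderiv (P i)) z / poly (P i) z) \<le> 2 * C" if z: "cmod z = 1" for z i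
  proof -
    have "cmod (poly (pderiv (P i)) z / poly (P i) z) = cmod (poly (pderiv q) z) / cmod (1 - poly q z / of_nat (M i))"
      using z by (simp add: logderiv norm_divide)
    also have "\<dots> \<le> C / (1 / 2)"
      using C(2)[OF z] half[of z i] z C(1) by (intro frac_le) auto
    finally show ?thesis by simp
  qed
  have Mlim: "filterlim M sequentially sequentially"
    unfolding M_def by (rule filterlim_subseq) (simp add: strict_mono_def)
  \<comment> \<open>The power sums are coefficients of - z P' / P, which tends boundedly on the
    circle to z q'; the k-th coefficient of the latter is k times that of q.\<close>
  have psum_lim: "(\<lambda>i. psum (Z i) k) \<longlonglongrightarrow> of_nat k * coeff q k" if k: "k > 0" for k
  proof -
    have "(\<lambda>i. \<integral>z. cnj z ^ k * (- z * poly (pderiv (P i)) z / poly (P i) z) \<partial>circle_measure) \<longlonglongrightarrow>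
        (\<integral>z. cnj z ^ k * poly (pCons 0 (pderiv q)) z \<partial>circle_measure)"
    proof (rule integral_dominated_convergence[where w="\<lambda>_. 2 * C"])
      show "AE z in circle_measure. (\<lambda>i. cnj z ^ k * (- z * poly (pderiv (P i)) z / poly (P i) z)) \<longlonglongrightarrow>
          cnj z ^ k * poly (pCons 0 (pderiv q)) z"
      proof (rule AE_I2)
        fix z assume "z \<in> space circle_measure"
        then have z: "cmod z \<le> 1" by simp
        have "(\<lambda>i. poly q z / of_nat (M i)) \<longlonglongrightarrow> 0"
          by (rule filterlim_compose[OF lim_const_over_n Mlim])
        then have "(\<lambda>i. cnj z ^ k * (- z * (- poly (pderiv q) z / (1 - poly q z / of_nat (M i))))) \<longlonglongrightarrow>
            cnj z ^ k * (- z * (- poly (pderiv q) z / (1 - 0)))"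
          by (intro tendsto_intros) auto
        moreover have "- z * poly (pderiv (P i)) z / poly (P i) z = - z * (- poly (pderiv q) z / (1 - poly q z / of_nat (M i)))" for i
          using logderiv[OF z, of i] by (metis times_divide_eq_right)
        ultimately show "(\<lambda>i. cnj z ^ k * (- z * poly (pderiv (P i)) z / poly (P i) z)) \<longlonglongrightarrow>
          cnj z ^ k * poly (pCons 0 (pderiv q)) z"
          by simp
      qed
      show "AE z in circle_measure. norm (cnj z ^ k * (- z * poly (pderiv (P i)) z / poly (P i) z)) \<le> 2 * C" for i
      proof (rule AE_I2)
        fix z assume "z \<in> space circle_measure"
        then have z: "cmod z = 1" by simp
        then show "norm (cnj z ^ k * (- z * poly (pderiv (P i)) z / poly (P i) z)) \<le> 2 * C"
          using ld_bound[OF z, of i] by (simp add: norm_mult norm_power norm_divide)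
      qed
      show "(\<lambda>z. cnj z ^ k * (- z * poly (pderiv (P i)) z / poly (P i) z)) \<in> borel_measurable circle_measure" for i
        by (intro circle_measurable_continuous continuous_intros) (simp add: Pnz)
      show "(\<lambda>z. cnj z ^ k * poly (pCons 0 (pderiv q)) z) \<in> borel_measurable circle_measure"
        by (intro circle_measurable_continuous continuous_intros)
    qed simp
    moreover have "(\<integral>z. cnj z ^ k * (- z * poly (pderiv (P i)) z / poly (P i) z) \<partial>circle_measure) = psum (Z i) k" for i
      using log_deriv_coeff[of "Z i" k] small k by (simp add: Z)
    moreover have "coeff (pCons 0 (pderiv q)) k = of_nat k * coeff q k"
      using k by (cases k) (simp_all add: coeff_pderiv)
    ultimately show ?thesis
      by (simp only: circle_poly_coeff)
  qed
  \<comment> \<open>For fixed J the limit over i involves only the power sums up to Suc J, with the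
    same tail bound for every i; J is sent to infinity afterwards. Using Suc J avoids division by
    0.\<close>
  have bound: "rdet (\<lambda>z. exp (2 * Re (poly q z))) n \<le> exp (S + (2 * C)\<^sup>2 / Suc J)" for J
  proof -
    have "rdet (\<lambda>z. exp (2 * Re (poly q z))) n \<le>
        exp ((\<Sum>k\<le>Suc J. (cmod (of_nat k * coeff q k))\<^sup>2 / real k) + (2 * C)\<^sup>2 / Suc J)"
    proof (rule rdet_le_limit[OF weight_exp_poly])
      show "weight (\<lambda>z. exp (- log_rpoly (Z i) z))" for i
        by (rule rdet_bernstein_szego_le(1)[of _ 0]) (use small in auto)
      show "AE z in circle_measure. (\<lambda>i. exp (- log_rpoly (Z i) z)) \<longlonglongrightarrow> exp (2 * Re (poly q z))"
      proof (rule AE_I2)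
        fix z assume "z \<in> space circle_measure"
        then have z: "cmod z \<le> 1" by simp
        have "(\<lambda>i. (1 - poly q z / of_nat (M i)) ^ M i) \<longlonglongrightarrow> exp (- poly q z)"
          by (rule filterlim_compose[OF tendsto_one_minus_over_n_power Mlim])
        then have "(\<lambda>i. inverse ((cmod (poly (P i) z))\<^sup>2)) \<longlonglongrightarrow> inverse ((cmod (exp (- poly q z)))\<^sup>2)"
          unfolding P_def poly_euler_poly by (intro tendsto_intros) auto
        moreover have "inverse ((cmod (exp (- poly q z)))\<^sup>2) = exp (2 * Re (poly q z))"
          by (simp add: power2_eq_square exp_minus[symmetric] flip: exp_add)
        moreover have "exp (- log_rpoly (Z i) z) = inverse ((cmod (poly (P i) z))\<^sup>2)" for i
          using Pnz[OF z, of i] unfolding log_rpoly_def Z(2)[symmetric]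
          by (simp add: exp_minus)
        ultimately show "(\<lambda>i. exp (- log_rpoly (Z i) z)) \<longlonglongrightarrow> exp (2 * Re (poly q z))"
          by simp
      qed
      show "\<forall>\<^sub>F i in sequentially. rdet (\<lambda>z. exp (- log_rpoly (Z i) z)) n \<le>
          exp ((\<Sum>k\<le>Suc J. (cmod (psum (Z i) k))\<^sup>2 / real k) + (2 * C)\<^sup>2 / Suc J)"
      proof (intro always_eventually allI)
        fix i
        have "rdet (\<lambda>z. exp (- log_rpoly (Z i) z)) n \<le> exp (energy (Z i))"
          by (rule rdet_bernstein_szego_le(2)) (use small in \<open>auto simp: Z(1)\<close>)
        also have "\<dots> \<le> exp ((\<Sum>k\<le>Suc J. (cmod (psum (Z i) k))\<^sup>2 / real k) + (2 * C)\<^sup>2 / Suc J)"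
          unfolding exp_le_cancel_iff
          by (rule energy_le) (use small ld_bound in \<open>auto simp: Z(2)[symmetric]\<close>)
        finally show "rdet (\<lambda>z. exp (- log_rpoly (Z i) z)) n \<le>
          exp ((\<Sum>k\<le>Suc J. (cmod (psum (Z i) k))\<^sup>2 / real k) + (2 * C)\<^sup>2 / Suc J)" .
      qed
      have "(\<lambda>i. (cmod (psum (Z i) k))\<^sup>2 / real k) \<longlonglongrightarrow> (cmod (of_nat k * coeff q k))\<^sup>2 / real k" for k
      proof (cases "k = 0")
        case False
        then show ?thesis
          by (intro tendsto_intros psum_lim) auto
      qed simp
      then show "(\<lambda>i. exp ((\<Sum>k\<le>Suc J. (cmod (psum (Z i) k))\<^sup>2 / real k) + (2 * C)\<^sup>2 / Suc J)) \<longlonglongrightarrow>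
          exp ((\<Sum>k\<le>Suc J. (cmod (of_nat k * coeff q k))\<^sup>2 / real k) + (2 * C)\<^sup>2 / Suc J)"
        by (intro tendsto_exp tendsto_add tendsto_sum tendsto_const)
    qed
    also have "(\<Sum>k\<le>Suc J. (cmod (of_nat k * coeff q k))\<^sup>2 / real k) = (\<Sum>k\<le>Suc J. real k * (cmod (coeff q k))\<^sup>2)"
      by (intro sum.cong) (auto simp: norm_mult power_mult_distrib power2_eq_square)
    finally show ?thesis
      using S[of "Suc J"] by (smt (verit) exp_le_cancel_iff)
  qed
  have "(\<lambda>J. exp (S + (2 * C)\<^sup>2 / Suc J)) \<longlonglongrightarrow> exp (S + 0)"
    by (intro tendsto_intros LIMSEQ_Suc[OF lim_const_over_n])
  then show ?thesis
    using bound by (intro tendsto_lowerbound[where F=sequentially]) auto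
qed

section \<open>The upper bound for general L and the limit\<close>

lemma coeff_fejer_poly:
  "coeff (fejer_poly K f) k = (if k \<in> {1..K} then of_real (1 - k / Suc K) * fcoef f k else 0)"
proof -
  have "coeff (fejer_poly K f) k = (\<Sum>m\<in>{1..K}. if m = k then of_real (1 - k / Suc K) * fcoef f k else 0)"
    unfolding fejer_poly_def coeff_sum by (intro sum.cong) auto
  then show ?thesis
    by (subst (asm) sum.delta) auto
qed

context log_weight
begin

text \<open>The coefficients of a Fejer mean are those of L times factors in [0, 1], so S bounds
  every mean as well. The exponentials of the means converge almost everywhere along a subsequence,
  which is all that \<open>rdet_le_limit\<close> asks.\<close>

lemma rdet_upper_bound:
  assumes S: "\<And>J. (\<Sum>k\<le>J. real k * (cmod (fcoef L k))\<^sup>2) \<le> S"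
  shows "rdet (\<lambda>z. exp (L z)) n \<le> exp S"
proof -
  obtain r where r: "strict_mono r" "AE z in circle_measure. (\<lambda>K. fejer (r K) L z) \<longlonglongrightarrow> L z"
    using fejer_AE_subseq[OF L_integrable] by blast
  have fej: "2 * Re (poly (fejer_poly K L) z) = fejer K L z" for K z
    by (simp add: fejer_def integral_L)
  show ?thesis
  proof (rule rdet_le_limit[OF weight_exp])
    show "weight (\<lambda>z. exp (2 * Re (poly (fejer_poly (r K) L) z)))" for K
      by (rule weight_exp_poly)
    show "AE z in circle_measure. (\<lambda>K. exp (2 * Re (poly (fejer_poly (r K) L) z))) \<longlonglongrightarrow> exp (L z)"
      unfolding fej using r(2) by eventually_elim (intro tendsto_exp)
    show "\<forall>\<^sub>F K in sequentially. rdet (\<lambda>z. exp (2 * Re (poly (fejer_poly (r K) L) z))) n \<le> exp S"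
    proof (intro always_eventually allI rdet_exp_poly_le poly_fejer_poly_0)
      fix K J
      have "cmod (coeff (fejer_poly (r K) L) k) \<le> cmod (fcoef L k)" for k
      proof (cases "k \<in> {1..r K}")
        case True
        have "cmod (coeff (fejer_poly (r K) L) k) = \<bar>1 - real k / Suc (r K)\<bar> * cmod (fcoef L k)"
          using True unfolding coeff_fejer_poly by (simp only: if_True norm_mult norm_of_real)
        also have "\<dots> \<le> 1 * cmod (fcoef L k)"
          using True by (intro mult_right_mono) (auto simp: field_simps)
        finally show ?thesis by simp
      next
        case False
        then show ?thesis unfolding coeff_fejer_poly by (simp only: if_False) simp
      qed
      then have "(\<Sum>k\<le>J. real k * (cmod (coeff (fejer_poly (r K) L) k))\<^sup>2) \<le> (\<Sum>k\<le>J. real k * (cmod (fcoef L k))\<^sup>2)"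
        by (intro sum_mono mult_left_mono power_mono) auto
      then show "(\<Sum>k\<le>J. real k * (cmod (coeff (fejer_poly (r K) L) k))\<^sup>2) \<le> S"
        using S[of J] by simp
    qed
  qed simp
qed

text \<open>For a finite sum the two bounds squeeze the determinants; for a divergent sum the
  partial sums in the lower bound already exceed every level.\<close>

lemma rdet_limit:
  "(\<lambda>n. ereal (rdet (\<lambda>z. exp (L z)) n)) \<longlonglongrightarrow>
    exp_ereal (\<Sum>k. ereal (real (Suc k) * (cmod (fcoef L (Suc k)))\<^sup>2))"
proof -
  define a where "a k = real (Suc k) * (cmod (fcoef L (Suc k)))\<^sup>2" for k
  have a_nonneg: "a k \<ge> 0" for k
    by (simp add: a_def)
  \<comment> \<open>The term k = 0 vanishes, which accounts for the shift between the two index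
    ranges.\<close>
  have part: "(\<Sum>k\<le>J. real k * (cmod (fcoef L k))\<^sup>2) = (\<Sum>k<J. a k)" for J
    unfolding lessThan_Suc_atMost[symmetric] sum.lessThan_Suc_shift by (simp add: a_def)
  note lower = rdet_lower_bound[OF szego_limit, unfolded part]
  show ?thesis
  proof (cases "summable a")
    case True
    then have "a sums suminf a" by (rule summable_sums)
    then have sum_eq: "(\<Sum>k. ereal (a k)) = ereal (suminf a)"
      using sums_ereal by (metis sums_unique)
    have "(\<lambda>n. rdet (\<lambda>z. exp (L z)) n) \<longlonglongrightarrow> exp (suminf a)"
    proof (rule order_tendstoI)
      fix c assume c: "c < exp (suminf a)"
      have "(\<lambda>J. exp (\<Sum>k<J. a k)) \<longlonglongrightarrow> exp (suminf a)"
        using True by (intro tendsto_exp summable_LIMSEQ)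
      then have "eventually (\<lambda>J. c < exp (\<Sum>k<J. a k)) sequentially"
        using c by (rule order_tendstoD(1))
      then obtain J where "c < exp (\<Sum>k<J. a k)"
        using eventually_happens'[OF sequentially_bot] by blast
      then show "\<forall>\<^sub>F n in sequentially. c < rdet (\<lambda>z. exp (L z)) n"
        by (rule lower)
    next
      fix c assume c: "exp (suminf a) < c"
      have "rdet (\<lambda>z. exp (L z)) n \<le> exp (suminf a)" for n
        by (rule rdet_upper_bound) (use True a_nonneg in \<open>auto simp: part intro: sum_le_suminf\<close>)
      then show "\<forall>\<^sub>F n in sequentially. rdet (\<lambda>z. exp (L z)) n < c"
        using c by (intro always_eventually allI) (meson le_less_trans)
    qed
    then show ?thesis
      unfolding a_def[symmetric] sum_eq by simp
  next
    case False
    have sum_eq: "(\<Sum>k. ereal (a k)) = \<infinity>"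
    proof (rule ccontr)
      assume "(\<Sum>k. ereal (a k)) \<noteq> \<infinity>"
      then have "summable a"
        using summable_ereal[of a] a_nonneg by blast
      with False show False by blast
    qed
    have "(\<lambda>n. ereal (rdet (\<lambda>z. exp (L z)) n)) \<longlonglongrightarrow> \<infinity>"
      unfolding tendsto_PInfty
    proof
      fix c :: real
      \<comment> \<open>The argument |c| + 1 is positive, so exponentiating the logarithm returns a
        value above c even for negative c.\<close>
      obtain J where J: "(\<Sum>k<J. a k) > ln (\<bar>c\<bar> + 1)"
        using summableI_nonneg_bounded[of a "ln (\<bar>c\<bar> + 1)"] a_nonneg False by (meson not_less)
      have "c < exp (ln (\<bar>c\<bar> + 1))" by simp
      also have "\<dots> < exp (\<Sum>k<J. a k)"
        using J by (subst exp_less_cancel_iff)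
      finally have "\<forall>\<^sub>F n in sequentially. c < rdet (\<lambda>z. exp (L z)) n"
        by (rule lower)
      then show "\<forall>\<^sub>F n in sequentially. ereal c < ereal (rdet (\<lambda>z. exp (L z)) n)"
        by simp
    qed
    moreover have "exp_ereal \<infinity> = \<infinity>"
      by (simp only: infinity_ereal_def exp_ereal.simps)
    ultimately show ?thesis
      unfolding a_def[symmetric] sum_eq by simp
  qed
qed

end

section \<open>Back to Toeplitz matrices and integer frequencies\<close>

lemma circle_powi: "cmod z = 1 \<Longrightarrow> z powi (- (int j - int i)) = z ^ i * cnj z ^ j"
proof -
  assume z: "cmod z = 1"
  then have "z \<noteq> 0" by auto
  have "z powi (- (int j - int i)) = z powi (int i - int j)"
    by simp
  also have "\<dots> = z ^ i / z ^ j"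
    using \<open>z \<noteq> 0\<close> by (simp add: power_int_diff)
  also have "\<dots> = z ^ i * cnj z ^ j"
    using circle_mult_cnj[OF z] \<open>z \<noteq> 0\<close> by (simp add: field_simps flip: power_mult_distrib)
  finally show ?thesis .
qed

lemma fourier_coeff_eq_fcoef: "fourier_coeff (\<lambda>z. complex_of_real (f z)) (int k) = fcoef f k"
  unfolding fourier_coeff_def fcoef_def
  by (rule Bochner_Integration.integral_cong) (use circle_powi[of _ k 0] in auto)

text \<open>The inverse of z on the circle is \<open>cnj z\<close>, so the entry c_(j-i) is the
  integral of z^i cnj z^j against the weight. The matrix of index n has size n + 1, hence
  \<open>Suc n\<close>.\<close>

lemma toeplitz_det_eq_tdet:
  assumes "integrable circle_measure (\<lambda>z. exp (f z))"
  shows "toeplitz_det (density circle_measure (\<lambda>z. ennreal (exp (f z)))) n = tdet (\<lambda>z. exp (f z)) (Suc n)"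
proof -
  have "measure_coeff (density circle_measure (\<lambda>z. ennreal (exp (f z)))) (int j - int i) =
      wip (\<lambda>z. exp (f z)) (monom 1 i) (monom 1 j)" for i j
  proof -
    have meas: "(\<lambda>z. z powi (- (int j - int i))) \<in> borel_measurable circle_measure"
      by (intro circle_measurable_continuous continuous_intros) auto
    have "measure_coeff (density circle_measure (\<lambda>z. ennreal (exp (f z)))) (int j - int i) =
        (\<integral>z. exp (f z) *\<^sub>R z powi (- (int j - int i)) \<partial>circle_measure)"
      unfolding measure_coeff_def using assms by (intro integral_density meas) auto
    also have "\<dots> = wip (\<lambda>z. exp (f z)) (monom 1 i) (monom 1 j)"
      unfolding wip_def
      by (rule Bochner_Integration.integral_cong)
        (auto simp: circle_powi poly_monom scaleR_conv_of_real simp del: minus_diff_eq)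
    finally show ?thesis .
  qed
  then show ?thesis
    by (simp add: toeplitz_det_def toeplitz_mat_def tdet_def)
qed

theorem theorem1p1:
  fixes L :: "complex \<Rightarrow> real"
  assumes "integrable circle_measure L"
    and "integrable circle_measure (\<lambda>z. exp (L z))"
  defines "\<mu> \<equiv> density circle_measure (\<lambda>z. ennreal (exp (L z)))"
    and "Lhat \<equiv> fourier_coeff (\<lambda>z. complex_of_real (L z))"
  shows "(\<forall>n. toeplitz_det \<mu> n * exp (- of_nat (n + 1) * Lhat 0) \<in> \<real>) \<and>
    (\<lambda>n. ereal (Re (toeplitz_det \<mu> n * exp (- of_nat (n + 1) * Lhat 0))))
      \<longlonglongrightarrow> exp_ereal (\<Sum>k. ereal (real (Suc k) * (cmod (Lhat (int (Suc k))))\<^sup>2))"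
proof -
  define c where "c = (\<integral>z. L z \<partial>circle_measure)"
  define L0 where "L0 z = L z - c" for z
  have exp_L: "exp (L z) = exp c * exp (L0 z)" for z
    by (simp add: L0_def flip: exp_add)
  interpret log_weight L0
  proof
    show "integrable circle_measure L0"
      unfolding L0_def using assms(1) by simp
    have "integrable circle_measure (\<lambda>z. exp (- c) * exp (L z))"
      using assms(2) by simp
    then show "integrable circle_measure (\<lambda>z. exp (L0 z))"
      by (simp add: L0_def exp_diff exp_minus field_simps)
    show "(\<integral>z. L0 z \<partial>circle_measure) = 0"
      unfolding L0_def using assms(1) by (simp add: c_def)
  qed
  have Lhat0: "Lhat 0 = of_real c"
    using fourier_coeff_eq_fcoef[of L 0] by (simp add: Lhat_def fcoef_0 c_def)
  have Lhat: "Lhat (int (Suc k)) = fcoef L0 (Suc k)" for k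
  proof -
    have "fcoef (\<lambda>_. c) (Suc k) = 0"
      using integral_power_cnj[of 0 "Suc k"] by (simp add: fcoef_def)
    then have "fcoef L0 (Suc k) = fcoef L (Suc k)"
      using fcoef_diff[OF assms(1), of "\<lambda>_. c" "Suc k"] by (simp add: L0_def[abs_def])
    then show ?thesis
      using fourier_coeff_eq_fcoef[of L "Suc k"] by (simp only: Lhat_def)
  qed
  \<comment> \<open>Scaling by exp c multiplies a determinant of size n + 1 by exp c ^ (n + 1),
    which the normalization cancels. That the result is \<open>of_real\<close> of something also
    settles the realness claim.\<close>
  have key: "toeplitz_det \<mu> n * exp (- of_nat (n + 1) * Lhat 0) = of_real (rdet (\<lambda>z. exp (L0 z)) (Suc n))" for n
  proof -
    have w: "weight (\<lambda>z. exp (L z))"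
      using assms(2) by (simp add: weight_def)
    have "toeplitz_det \<mu> n = of_real (rdet (\<lambda>z. exp (L z)) (Suc n))"
      unfolding \<mu>_def toeplitz_det_eq_tdet[OF assms(2)] by (rule tdet_eq_rdet[OF w])
    also have "rdet (\<lambda>z. exp (L z)) (Suc n) = exp c ^ Suc n * rdet (\<lambda>z. exp (L0 z)) (Suc n)"
      unfolding exp_L by (rule rdet_scale[OF weight_exp]) simp
    finally have "toeplitz_det \<mu> n * exp (- of_nat (n + 1) * Lhat 0) =
        of_real (exp c ^ Suc n * rdet (\<lambda>z. exp (L0 z)) (Suc n)) * of_real (exp (- real (n + 1) * c))"
      unfolding Lhat0 exp_of_real[symmetric] by simp
    also have "\<dots> = of_real ((exp c ^ Suc n * exp (- real (n + 1) * c)) * rdet (\<lambda>z. exp (L0 z)) (Suc n))"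
      by simp
    also have "exp c ^ Suc n * exp (- real (n + 1) * c) = 1"
      unfolding exp_of_nat_mult[symmetric] exp_add[symmetric] by (simp add: algebra_simps)
    finally show ?thesis by simp
  qed
  show ?thesis
    unfolding key Lhat using LIMSEQ_Suc[OF rdet_limit] by simp
qed

end
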